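(* Let $T>0$, $\sigma>0$, $\varepsilon=1$, $x_0\in\mathbb T^2$, $w=e_1$, $x_c(t)=x_0+tw$. Let $u_n$ be the smooth divergence-free coefficients on $[0,T]\times\mathbb T^2$ defined in the context. Let $E_*\in\mathbb R^2\setminus\{0\}$ be constant and put $$\overline X(t)=(e^{-\sigma t}E_*,0).$$ Then there are exact (energy) solutions $\widehat X_n=(\widehat E_n,b_n)$ of the planar Maxwell--Ohm system with coefficients $u_n$ such that $$\widehat X_n(0)\longrightarrow(E_*,0)\ \text{in }\mathcal H_2,\qquad \liminf_{n\to\infty}\|\widehat X_n(T)-\overline X(T)\|_{\mathcal H_2}>0.$$ Their currents $\widehat j_n=\sigma(\widehat E_n+b_nRu_n)$ are bounded in $L^2((0,T)\times\mathbb T^2)$, and their Lorentz forces satisfy $$b_nR\widehat j_n\ \overset{*}{\rightharpoonup}\ -\frac{t}{2T^2}\,w\,dt\,\delta_{x=x_c(t)}$$ as vector-valued Radon measures on $[0,T]\times\mathbb T^2$.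
   Context: $\mathbb T^2=(\mathbb R/2\pi\mathbb Z)^2$; $R(z_1,z_2)=(z_2,-z_1)$. States are $X=(E,b)$, $E$ $\mathbb R^2$-valued and $b$ real-valued; with $\varepsilon=1$, $\|X\|_{\mathcal H_2}^2=\|E\|_{L^2}^2+\|b\|_{L^2}^2$. The planar Maxwell--Ohm system with coefficient $v$ is $$\partial_tE-R\nabla b=-j,\qquad \partial_tb+\operatorname{curl}E=0,\qquad j=\sigma(E+bRv),\qquad \operatorname{curl}E=\partial_1E_2-\partial_2E_1.$$ Energy solutions are mild solutions $X\in C([0,T];\mathcal H_2)$: $X(t)=S(t)X(0)+\int_0^tS(t-s)(-\sigma b(s)Rv(s),0)\,ds$, with $S$ the contraction semigroup on $\mathcal H_2$ generated by $(E,b)\mapsto(R\nabla b-\sigma E,-\operatorname{curl}E)$ on its maximal domain. Coefficients $u_n$: fix $r_0>0$ such that the closed disk of radius $r_0$ about the origin lies in one coordinate chart of $\mathbb T^2$. Fix $\Theta\in C^\infty(\mathbb R;[0,1])$ with $\Theta(z)=0$ for $z\le0$, $\Theta(z)=z$ for $\frac14\le z\le\frac34$, $\Theta(z)=1$ for $z\ge1$, with $|\Theta'|+|\Theta''|\le C$ and $\Theta(z)\le Cz$ on $[0,1]$. For $L\ge2$ let $\chi_L(r)=\Theta(L^{-1}\log(r_0/r))$ for $0<r<r_0$, $\chi_L(r)=0$ for $r\ge r_0$, $\chi_L(0)=1$. For $A\ge1$ set $\psi_{A,L}(x)=-A(Rw\cdot x)\chi_L(|x|)$ and $W_{A,L}=R\nabla\psi_{A,L}$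 (extended by zero to $\mathbb T^2$). With $\delta_n=e^{-n}$ ($n\ge1$), $A_n(t)=1+\frac{2}{\sigma(t+\delta_n)}$ and $L_n(t)=n+A_n(t)^2$, set $u_n(t,x)=W_{A_n(t),L_n(t)}(x-x_c(t))$. These are smooth, divergence-free, and tend to $0$ strongly in $L^2(0,T;H^1(\mathbb T^2))$. The measure $-\frac{t}{2T^2}w\,dt\,\delta_{x=x_c(t)}$ acts on $\Psi\in C([0,T]\times\mathbb T^2;\mathbb R^2)$ by $-\int_0^T\frac{t}{2T^2}\,w\cdot\Psi(t,x_c(t))\,dt$. *)

theory Defs
  imports "HOL-Analysis.Analysis"
begin

section \<open>The torus and its Lebesgue spaces\<close>

text \<open>
  Points of the torus (R / 2 pi Z)^2 are given by representatives in the plane, continuous and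
  smooth functions on it are doubly 2 pi-periodic functions on the plane, and its Lebesgue measure
  is the Borel-Lebesgue measure on the fundamental cell [-pi, pi)^2.
\<close>

definition torus_cell :: "(real^2) set" where
  "torus_cell = {x. \<forall>i. - pi \<le> x $ i \<and> x $ i < pi}"

definition torus :: "(real^2) measure" where
  "torus = restrict_space lborel torus_cell"

definition wrap :: "real^2 \<Rightarrow> real^2" where
  "wrap x = (\<chi> i. x $ i - 2 * pi * of_int \<lfloor>(x $ i + pi) / (2 * pi)\<rfloor>)"

definition periodic :: "(real^2 \<Rightarrow> 'b) \<Rightarrow> bool" where
  "periodic f \<longleftrightarrow> (\<forall>x i. f (x + axis i (2 * pi)) = f x)"

definition square_integrable :: "(real^2 \<Rightarrow> 'b::euclidean_space) \<Rightarrow> bool" where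
  "square_integrable f \<longleftrightarrow>
     f \<in> borel_measurable torus \<and> integrable torus (\<lambda>x. (norm (f x))\<^sup>2)"

definition l2_eq :: "(real^2 \<Rightarrow> 'b::euclidean_space) \<Rightarrow> (real^2 \<Rightarrow> 'b) \<Rightarrow> bool" where
  "l2_eq f g \<longleftrightarrow> square_integrable f \<and> square_integrable g \<and> (AE x in torus. f x = g x)"

lemma square_integrable_zero: "square_integrable (\<lambda>_. 0)"
  by (simp add: square_integrable_def)

lemma square_integrable_add:
  assumes "square_integrable f" "square_integrable g"
  shows "square_integrable (\<lambda>x. f x + g x)"
proof -
  have [measurable]: "f \<in> borel_measurable torus" "g \<in> borel_measurable torus"
    using assms by (auto simp: square_integrable_def)
  have i: "integrable torus (\<lambda>x. 2 * (norm (f x))\<^sup>2 + 2 * (norm (g x))\<^sup>2)"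
    using assms by (auto simp: square_integrable_def)
  have "integrable torus (\<lambda>x. (norm (f x + g x))\<^sup>2)"
  proof (rule Bochner_Integration.integrable_bound[OF i])
    have "(norm (f x + g x))\<^sup>2 \<le> 2 * (norm (f x))\<^sup>2 + 2 * (norm (g x))\<^sup>2" for x
    proof -
      have "(norm (f x + g x))\<^sup>2 \<le> (norm (f x) + norm (g x))\<^sup>2"
        by (intro power_mono norm_triangle_ineq norm_ge_zero)
      also have "\<dots> \<le> 2 * (norm (f x))\<^sup>2 + 2 * (norm (g x))\<^sup>2"
        using zero_le_power2[of "norm (f x) - norm (g x)"]
        by (simp add: power2_eq_square algebra_simps)
      finally show ?thesis .
    qed
    then show "AE x in torus. norm ((norm (f x + g x))\<^sup>2)
        \<le> norm (2 * (norm (f x))\<^sup>2 + 2 * (norm (g x))\<^sup>2)"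
      by auto
  qed measurable
  then show ?thesis by (simp add: square_integrable_def)
qed

lemma square_integrable_scaleR:
  "square_integrable f \<Longrightarrow> square_integrable (\<lambda>x. c *\<^sub>R f x)"
  by (auto simp: square_integrable_def power_mult_distrib)

lemma square_integrable_uminus:
  "square_integrable f \<Longrightarrow> square_integrable (\<lambda>x. - f x)"
  using square_integrable_scaleR[of f "-1"] by simp

lemma square_integrable_diff:
  "square_integrable f \<Longrightarrow> square_integrable g \<Longrightarrow> square_integrable (\<lambda>x. f x - g x)"
  using square_integrable_add[of f "\<lambda>x. - g x"] square_integrable_uminus[of g] by simp

lemma integrable_inner_l2:
  assumes "square_integrable f" "square_integrable g"
  shows "integrable torus (\<lambda>x. f x \<bullet> g x)"
proof -
  have "f x \<bullet> g x = ((norm (f x + g x))\<^sup>2 - (norm (f x))\<^sup>2 - (norm (g x))\<^sup>2) / 2" for x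
    by (simp add: power2_norm_eq_inner inner_add_left inner_add_right inner_commute)
  moreover have "integrable torus
      (\<lambda>x. ((norm (f x + g x))\<^sup>2 - (norm (f x))\<^sup>2 - (norm (g x))\<^sup>2) / 2)"
    using assms square_integrable_add[OF assms] by (auto simp: square_integrable_def)
  ultimately show ?thesis by presburger
qed

text \<open>Elements of L^2(T^2; 'b) are almost-everywhere classes of functions on the cell:
  \<^term>\<open>abs_l2 f\<close> is the class of a square integrable f, and \<^term>\<open>rep_l2 F\<close> is some
  representative of F, whose values outside the cell carry no information.\<close>

quotient_type (overloaded) 'b l2 = "real^2 \<Rightarrow> 'b::euclidean_space" / partial: l2_eq
  morphisms rep_l2 abs_l2
proof (rule part_equivpI)
  show "\<exists>x::real^2 \<Rightarrow> 'b. l2_eq x x"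
    using square_integrable_zero by (auto simp: l2_eq_def)
  show "symp (l2_eq :: (real^2 \<Rightarrow> 'b) \<Rightarrow> _)"
    by (auto simp: l2_eq_def symp_def)
  show "transp (l2_eq :: (real^2 \<Rightarrow> 'b) \<Rightarrow> _)"
    by (auto simp: l2_eq_def transp_def)
qed

instantiation l2 :: (euclidean_space) real_inner
begin

lift_definition zero_l2 :: "'a l2" is "\<lambda>_. 0"
  by (simp add: l2_eq_def square_integrable_zero)

lift_definition plus_l2 :: "'a l2 \<Rightarrow> 'a l2 \<Rightarrow> 'a l2" is "\<lambda>f g x. f x + g x"
  by (auto simp: l2_eq_def square_integrable_add)

lift_definition minus_l2 :: "'a l2 \<Rightarrow> 'a l2 \<Rightarrow> 'a l2" is "\<lambda>f g x. f x - g x"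
  by (auto simp: l2_eq_def square_integrable_diff)

lift_definition uminus_l2 :: "'a l2 \<Rightarrow> 'a l2" is "\<lambda>f x. - f x"
  by (auto simp: l2_eq_def square_integrable_uminus)

lift_definition scaleR_l2 :: "real \<Rightarrow> 'a l2 \<Rightarrow> 'a l2" is "\<lambda>c f x. c *\<^sub>R f x"
  by (auto simp: l2_eq_def square_integrable_scaleR)

lift_definition inner_l2 :: "'a l2 \<Rightarrow> 'a l2 \<Rightarrow> real" is "\<lambda>f g. LINT x|torus. f x \<bullet> g x"
proof -
  fix f f' g g' :: "real^2 \<Rightarrow> 'a"
  assume a: "l2_eq f f'" "l2_eq g g'"
  show "(LINT x|torus. f x \<bullet> g x) = (LINT x|torus. f' x \<bullet> g' x)"
  proof (rule integral_cong_AE)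
    show "AE x in torus. f x \<bullet> g x = f' x \<bullet> g' x"
      using a by (auto simp: l2_eq_def)
  qed (use a in \<open>auto simp: l2_eq_def square_integrable_def\<close>)
qed

definition norm_l2 :: "'a l2 \<Rightarrow> real" where
  "norm_l2 f = sqrt (f \<bullet> f)"

definition sgn_l2 :: "'a l2 \<Rightarrow> 'a l2" where
  "sgn_l2 f = inverse (norm f) *\<^sub>R f"

definition dist_l2 :: "'a l2 \<Rightarrow> 'a l2 \<Rightarrow> real" where
  "dist_l2 f g = norm (f - g)"

definition uniformity_l2 :: "('a l2 \<times> 'a l2) filter" where
  "uniformity_l2 = (INF e\<in>{0<..}. principal {(x, y). dist x y < e})"

definition open_l2 :: "'a l2 set \<Rightarrow> bool" where
  "open_l2 U \<longleftrightarrow> (\<forall>x\<in>U. \<forall>\<^sub>F (x', y) in uniformity. x' = x \<longrightarrow> y \<in> U)"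

instance
proof
  fix x y z :: "'a l2" and a b :: real and U :: "'a l2 set"
  show "x + y + z = x + (y + z)"
    by transfer (auto simp: l2_eq_def algebra_simps square_integrable_add)
  show "x + y = y + x"
    by transfer (auto simp: l2_eq_def algebra_simps square_integrable_add)
  show "0 + x = x"
    by transfer (auto simp: l2_eq_def)
  show "- x + x = 0"
    by transfer (auto simp: l2_eq_def square_integrable_zero)
  show "x - y = x + - y"
    by transfer (auto simp: l2_eq_def square_integrable_diff)
  show "a *\<^sub>R (x + y) = a *\<^sub>R x + a *\<^sub>R y"
    by transfer (auto simp: l2_eq_def scaleR_add_right
        intro!: square_integrable_add square_integrable_scaleR)
  show "(a + b) *\<^sub>R x = a *\<^sub>R x + b *\<^sub>R x"
    by transfer (auto simp: l2_eq_def scaleR_add_left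
        intro!: square_integrable_add square_integrable_scaleR)
  show "a *\<^sub>R b *\<^sub>R x = (a * b) *\<^sub>R x"
    by transfer (auto simp: l2_eq_def intro!: square_integrable_scaleR)
  show "1 *\<^sub>R x = x"
    by transfer (auto simp: l2_eq_def)
  show "inner x y = inner y x"
    by transfer (simp add: inner_commute)
  show "inner (x + y) z = inner x z + inner y z"
    by transfer (simp add: l2_eq_def inner_add_left integrable_inner_l2)
  show "inner (a *\<^sub>R x) y = a * inner x y"
    by transfer simp
  show "0 \<le> inner x x"
    by transfer (simp add: integral_nonneg_AE)
  show "inner x x = 0 \<longleftrightarrow> x = 0"
  proof transfer
    fix x :: "real^2 \<Rightarrow> 'a"
    assume "l2_eq x x"
    then have "square_integrable x" by (simp add: l2_eq_def)
    moreover from this have "(LINT t|torus. x t \<bullet> x t) = 0 \<longleftrightarrow> (AE t in torus. x t \<bullet> x t = 0)"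
      by (intro integral_nonneg_eq_0_iff_AE integrable_inner_l2) auto
    ultimately show "(LINT t|torus. x t \<bullet> x t) = 0 \<longleftrightarrow> l2_eq x (\<lambda>_. 0)"
      by (simp add: l2_eq_def square_integrable_zero)
  qed
qed (rule norm_l2_def sgn_l2_def dist_l2_def uniformity_l2_def open_l2_def)+

end

section \<open>Differentiation\<close>

definition pd :: "2 \<Rightarrow> (real^2 \<Rightarrow> real) \<Rightarrow> real^2 \<Rightarrow> real" where
  "pd i f x = frechet_derivative f (at x) (axis i 1)"

definition grad :: "(real^2 \<Rightarrow> real) \<Rightarrow> real^2 \<Rightarrow> real^2" where
  "grad f x = (\<chi> i. pd i f x)"

fun times_differentiable :: "nat \<Rightarrow> (real^2 \<Rightarrow> real) \<Rightarrow> bool" where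
  "times_differentiable 0 f \<longleftrightarrow> continuous_on UNIV f"
| "times_differentiable (Suc k) f \<longleftrightarrow>
     f differentiable_on UNIV \<and> (\<forall>i. times_differentiable k (pd i f))"

definition test_function :: "(real^2 \<Rightarrow> real) \<Rightarrow> bool" where
  "test_function \<phi> \<longleftrightarrow> periodic \<phi> \<and> (\<forall>k. times_differentiable k \<phi>)"

text \<open>Distributional gradient and curl on the torus, as elements of L^2.\<close>

definition weak_grad :: "real l2 \<Rightarrow> (real^2) l2 \<Rightarrow> bool" where
  "weak_grad b G \<longleftrightarrow> (\<forall>\<phi>. test_function \<phi> \<longrightarrow> (\<forall>i.
     (LINT x|torus. rep_l2 b x * pd i \<phi> x) = - (LINT x|torus. rep_l2 G x $ i * \<phi> x)))"

definition weak_curl :: "(real^2) l2 \<Rightarrow> real l2 \<Rightarrow> bool" where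
  "weak_curl E c \<longleftrightarrow> (\<forall>\<phi>. test_function \<phi> \<longrightarrow>
     (LINT x|torus. rep_l2 E x $ 2 * pd 1 \<phi> x - rep_l2 E x $ 1 * pd 2 \<phi> x)
       = - (LINT x|torus. rep_l2 c x * \<phi> x))"

section \<open>The planar Maxwell--Ohm system\<close>

text \<open>The norm of the product type is the Euclidean combination of the two L^2 norms, which is the
  norm of the space H_2 for epsilon = 1.\<close>

type_synonym state = "(real^2) l2 \<times> real l2"

definition rot :: "real^2 \<Rightarrow> real^2" where
  "rot z = vector [z $ 2, - z $ 1]"

text \<open>Graph of the operator (E, b) |-> (R grad b - sigma E, - curl E). Its domain is the maximal
  one: all states whose distributional R grad b and curl E belong to L^2.\<close>

definition maxwell_ohm_operator :: "real \<Rightarrow> (state \<times> state) set" where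
  "maxwell_ohm_operator \<sigma> =
     {((E, b), (abs_l2 (\<lambda>x. rot (rep_l2 G x)) - \<sigma> *\<^sub>R E, - c)) | E b G c.
        weak_grad b G \<and> weak_curl E c}"

definition contraction_semigroup :: "(real \<Rightarrow> 'a \<Rightarrow> 'a::real_normed_vector) \<Rightarrow> bool" where
  "contraction_semigroup S \<longleftrightarrow>
     (\<forall>t\<ge>0. linear (S t) \<and> (\<forall>x. norm (S t x) \<le> norm x)) \<and>
     S 0 = id \<and>
     (\<forall>s\<ge>0. \<forall>t\<ge>0. S (s + t) = S s \<circ> S t) \<and>
     (\<forall>x. ((\<lambda>t. S t x) \<longlongrightarrow> x) (at_right 0))"

definition generator :: "(real \<Rightarrow> 'a \<Rightarrow> 'a::real_normed_vector) \<Rightarrow> ('a \<times> 'a) set" where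
  "generator S = {(x, y). ((\<lambda>h. (S h x - x) /\<^sub>R h) \<longlongrightarrow> y) (at_right 0)}"

definition magnetic_term :: "(real^2 \<Rightarrow> real^2) \<Rightarrow> real l2 \<Rightarrow> (real^2) l2" where
  "magnetic_term v b = abs_l2 (\<lambda>x. rep_l2 b x *\<^sub>R rot (v x))"

text \<open>For bounded continuous coefficients the Duhamel integrand is a continuous curve in H_2, so the
  integral below is the usual vector-valued one.\<close>

definition mild_solution ::
    "(real \<Rightarrow> state \<Rightarrow> state) \<Rightarrow> real \<Rightarrow> real \<Rightarrow> (real \<Rightarrow> real^2 \<Rightarrow> real^2) \<Rightarrow> (real \<Rightarrow> state) \<Rightarrow> bool" where
  "mild_solution S \<sigma> T v X \<longleftrightarrow>
     (\<forall>t\<in>{0..T}.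
        ((\<lambda>s. S (t - s) (- (\<sigma> *\<^sub>R magnetic_term (v s) (snd (X s))), 0))
           has_integral (X t - S t (X 0))) {0..t})"

definition energy_solution ::
    "real \<Rightarrow> real \<Rightarrow> (real \<Rightarrow> real^2 \<Rightarrow> real^2) \<Rightarrow> (real \<Rightarrow> state) \<Rightarrow> bool" where
  "energy_solution \<sigma> T v X \<longleftrightarrow>
     continuous_on {0..T} X \<and>
     (\<exists>S. contraction_semigroup S \<and> generator S = maxwell_ohm_operator \<sigma> \<and>
          mild_solution S \<sigma> T v X)"

definition current :: "real \<Rightarrow> (real^2 \<Rightarrow> real^2) \<Rightarrow> state \<Rightarrow> (real^2) l2" where
  "current \<sigma> v X = \<sigma> *\<^sub>R (fst X + magnetic_term v (snd X))"

definition ohmic_state :: "real \<Rightarrow> real^2 \<Rightarrow> real \<Rightarrow> state" where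
  "ohmic_state \<sigma> E t = (abs_l2 (\<lambda>_. exp (- \<sigma> * t) *\<^sub>R E), 0)"

text \<open>The L^1 function b R j.\<close>

definition lorentz_force :: "real \<Rightarrow> (real^2 \<Rightarrow> real^2) \<Rightarrow> state \<Rightarrow> real^2 \<Rightarrow> real^2" where
  "lorentz_force \<sigma> v X x = rep_l2 (snd X) x *\<^sub>R rot (rep_l2 (current \<sigma> v X) x)"

section \<open>The coefficients\<close>

definition cutoff_profile :: "(real \<Rightarrow> real) \<Rightarrow> bool" where
  "cutoff_profile \<Theta> \<longleftrightarrow>
     (\<forall>k z. (deriv ^^ k) \<Theta> field_differentiable at z) \<and>
     (\<forall>z. 0 \<le> \<Theta> z \<and> \<Theta> z \<le> 1) \<and>
     (\<forall>z\<le>0. \<Theta> z = 0) \<and>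
     (\<forall>z. 1/4 \<le> z \<and> z \<le> 3/4 \<longrightarrow> \<Theta> z = z) \<and>
     (\<forall>z\<ge>1. \<Theta> z = 1) \<and>
     (\<exists>C. (\<forall>z. \<bar>deriv \<Theta> z\<bar> + \<bar>deriv (deriv \<Theta>) z\<bar> \<le> C) \<and>
          (\<forall>z. 0 \<le> z \<and> z \<le> 1 \<longrightarrow> \<Theta> z \<le> C * z))"

definition chi :: "(real \<Rightarrow> real) \<Rightarrow> real \<Rightarrow> real \<Rightarrow> real \<Rightarrow> real" where
  "chi \<Theta> r0 L r = (if r = 0 then 1 else if r < r0 then \<Theta> (ln (r0 / r) / L) else 0)"

definition e_dir :: "real^2" where
  "e_dir = axis 1 1"

definition stream :: "(real \<Rightarrow> real) \<Rightarrow> real \<Rightarrow> real \<Rightarrow> real \<Rightarrow> real^2 \<Rightarrow> real" where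
  "stream \<Theta> r0 A L x = - A * (rot e_dir \<bullet> x) * chi \<Theta> r0 L (norm x)"

text \<open>The field W, extended by zero from the disk to the torus. The closed disk of radius r0 embeds in
  one coordinate chart of the torus exactly if r0 < pi; W then vanishes near the boundary of the
  cell, and \<^const>\<open>wrap\<close> moves the argument to its representative in the cell.\<close>

definition W_field :: "(real \<Rightarrow> real) \<Rightarrow> real \<Rightarrow> real \<Rightarrow> real \<Rightarrow> real^2 \<Rightarrow> real^2" where
  "W_field \<Theta> r0 A L x = rot (grad (stream \<Theta> r0 A L) (wrap x))"

definition A_coeff :: "real \<Rightarrow> nat \<Rightarrow> real \<Rightarrow> real" where
  "A_coeff \<sigma> n t = 1 + 2 / (\<sigma> * (t + exp (- real n)))"

definition L_coeff :: "real \<Rightarrow> nat \<Rightarrow> real \<Rightarrow> real" where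
  "L_coeff \<sigma> n t = real n + (A_coeff \<sigma> n t)\<^sup>2"

definition x_c :: "real^2 \<Rightarrow> real \<Rightarrow> real^2" where
  "x_c x0 t = x0 + t *\<^sub>R e_dir"

definition u_coeff :: "(real \<Rightarrow> real) \<Rightarrow> real \<Rightarrow> real \<Rightarrow> real^2 \<Rightarrow> nat \<Rightarrow> real \<Rightarrow> real^2 \<Rightarrow> real^2" where
  "u_coeff \<Theta> r0 \<sigma> x0 n t x = W_field \<Theta> r0 (A_coeff \<sigma> n t) (L_coeff \<sigma> n t) (x - x_c x0 t)"

end

theory Submission
  imports Defs
begin

text \<open>
  The coefficients are built to feed a wave packet that sits at the moving point x_c(t). Light travels
  with speed 1, and so does this point, so a packet g(x - x_c(t)) that is much narrower in the direction
  of motion e_1 than transversally is nearly a solution of the wave equation. Ohm's law damps it;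
  but in the core of u_n the conductor moves with velocity A e_1, and for A > 1 the induced
  current drives the packet instead of damping it.

  Precisely, let \<gamma> = a(t) g(x - x_c(t)) be a potential, E = R grad \<partial>_t \<gamma> and b = \<Delta> \<gamma>. Faraday's law
  holds identically. In Ampere's law the terms with three derivatives of g in direction e_1 cancel
  because of the unit speed, and those with two such derivatives cancel if 2 a' = \<sigma> (A - 1) a. For
  A = A_n this is a' / a = 1 / (t + \<delta>_n) with \<delta>_n = exp (- n), solved by a(t) = (t + \<delta>_n) / (2 T), which grows from
  \<delta>_n / (2 T) to at least 1 / 2 (growth_balance, residual_eq). Choose g = p \<otimes> q with p'' and q of unit
  L^2 norm. All remaining terms contain p or p' and are small by Poincare's inequality once the support
  of p is narrow (Poincare_bump, norm_K_small). What survives is \<beta> = a p'' q, which equals b and E_2 up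
  to small terms. Hence the initial data converge to the Ohmic state, while at time T the distance from
  it stays bounded below.

  The packet, added to the Ohmic state, is only an approximate solution. For fixed n the coefficient is
  bounded, so a Volterra equation corrects it to an exact one at a cost proportional to the residual, with a
  constant that depends on n (Volterra_solution, exact_near_approximate). This constant, and the radius
  of the core, are known before the width of p is chosen, so for every n the correction can be made
  smaller than 1 / (n + 1) (concentrating_packet_exists).

  The leading part of the current is \<sigma> (E + b R u_n) = \<sigma> (1 - A_n) \<beta> e_2 with
  \<sigma> (1 - A_n) = - 2 / (t + \<delta>_n); its L^2 norm is 1 / T, so the currents are bounded. The leading part
  of the Lorentz force is \<sigma> (1 - A_n) \<beta>^2 e_1. It has total mass - (t + \<delta>_n) / (2 T^2) and
  concentrates at x_c(t). The background field contributes nothing in the limit, because \<beta> tends to 0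
  in L^1 although not in L^2 (lorentz_estimate).

  The semigroup is constructed through truncation to finitely many modes of a real Fourier basis, the
  Hartley functions cos (k x) + sin (k x). A pair belongs to the graph of the Maxwell-Ohm operator if
  and only if all its truncations satisfy an identity between bounded operators
  (maxwell_ohm_operator_spectral), and for an operator described in this way the limit of the truncated
  flows is a contraction semigroup with exactly this generator (generator_evolution). Completeness of
  the Hartley functions rests on the Stone-Weierstrass theorem (hbasis_complete).
\<close>

section \<open>Classes of square integrable functions\<close>

lemma rep_l2_square_integrable: "square_integrable (rep_l2 F)"
  using Quotient3_rep_reflp[OF Quotient3_l2, of F] by (simp add: l2_eq_def)

lemma abs_rep_l2: "abs_l2 (rep_l2 F) = F"
  by (rule Quotient3_abs_rep[OF Quotient3_l2])

lemma abs_l2_eqI: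
  assumes "square_integrable f" "square_integrable g" "AE x in torus. f x = g x"
  shows "abs_l2 f = abs_l2 g"
  using Quotient3_rel[OF Quotient3_l2, of f g] assms by (auto simp: l2_eq_def)

lemma rep_abs_l2:
  assumes "square_integrable f"
  shows "AE x in torus. rep_l2 (abs_l2 f) x = f x"
proof -
  have "l2_eq (rep_l2 (abs_l2 f)) f"
    using Quotient3_rel[OF Quotient3_l2, of "rep_l2 (abs_l2 f)" f] assms
      rep_l2_square_integrable[of "abs_l2 f"] abs_rep_l2[of "abs_l2 f"]
    by (auto simp: l2_eq_def)
  then show ?thesis by (simp add: l2_eq_def)
qed

lemma l2_eqI: "(AE x in torus. rep_l2 F x = rep_l2 G x) \<Longrightarrow> F = G"
  using abs_l2_eqI[OF rep_l2_square_integrable rep_l2_square_integrable, of F G]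
  by (simp add: abs_rep_l2)

lemma rep_l2_measurable [measurable]: "rep_l2 F \<in> borel_measurable torus"
  using rep_l2_square_integrable[of F] by (simp add: square_integrable_def)

lemma square_integrable_measurable: "square_integrable f \<Longrightarrow> f \<in> borel_measurable torus"
  by (simp add: square_integrable_def)

lemma abs_l2_add:
  "square_integrable f \<Longrightarrow> square_integrable g \<Longrightarrow> abs_l2 f + abs_l2 g = abs_l2 (\<lambda>x. f x + g x)"
  by (rule plus_l2.abs_eq) (auto simp: eq_onp_def l2_eq_def)

lemma abs_l2_diff:
  "square_integrable f \<Longrightarrow> square_integrable g \<Longrightarrow> abs_l2 f - abs_l2 g = abs_l2 (\<lambda>x. f x - g x)"
  by (rule minus_l2.abs_eq) (auto simp: eq_onp_def l2_eq_def)

lemma abs_l2_scaleR: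
  "square_integrable f \<Longrightarrow> c *\<^sub>R abs_l2 f = abs_l2 (\<lambda>x. c *\<^sub>R f x)"
  by (rule scaleR_l2.abs_eq) (auto simp: eq_onp_def l2_eq_def)

lemma abs_l2_zero: "abs_l2 (\<lambda>_. 0) = 0"
  by (simp add: zero_l2_def)

lemma inner_abs_l2:
  "square_integrable f \<Longrightarrow> square_integrable g \<Longrightarrow> abs_l2 f \<bullet> abs_l2 g = (LINT x|torus. f x \<bullet> g x)"
  by (rule inner_l2.abs_eq) (auto simp: eq_onp_def l2_eq_def)

lemma inner_rep_l2: "F \<bullet> G = (LINT x|torus. rep_l2 F x \<bullet> rep_l2 G x)"
  using inner_abs_l2[OF rep_l2_square_integrable rep_l2_square_integrable, of F G]
  by (simp add: abs_rep_l2)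

lemma norm_abs_l2:
  "square_integrable f \<Longrightarrow> (norm (abs_l2 f))\<^sup>2 = (LINT x|torus. (norm (f x))\<^sup>2)"
  by (simp add: power2_norm_eq_inner inner_abs_l2)

lemma norm_rep_l2: "(norm F)\<^sup>2 = (LINT x|torus. (norm (rep_l2 F x))\<^sup>2)"
  by (simp add: power2_norm_eq_inner inner_rep_l2)

lemma rep_l2_diff: "AE x in torus. rep_l2 (F - G) x = rep_l2 F x - rep_l2 G x"
  using rep_abs_l2[OF square_integrable_diff[OF rep_l2_square_integrable rep_l2_square_integrable], of F G]
  by (simp add: abs_l2_diff[symmetric] rep_l2_square_integrable abs_rep_l2)

lemma rep_l2_scaleR: "AE x in torus. rep_l2 (c *\<^sub>R F) x = c *\<^sub>R rep_l2 F x"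
  using rep_abs_l2[OF square_integrable_scaleR[OF rep_l2_square_integrable], of c F]
  by (simp add: abs_l2_scaleR[symmetric] rep_l2_square_integrable abs_rep_l2)

lemma torus_cell_subset: "torus_cell \<subseteq> cbox (\<chi> i. - pi) (\<chi> i. pi)"
  by (auto simp: torus_cell_def mem_box_cart less_imp_le)

lemma torus_cell_borel [measurable]: "torus_cell \<in> sets borel"
  unfolding torus_cell_def by measurable

lemma space_torus [simp]: "space torus = torus_cell"
  by (simp add: torus_def space_restrict_space)

lemma finite_measure_torus: "finite_measure torus"
proof
  have "emeasure lborel torus_cell \<le> emeasure lborel (cbox (\<chi> i. - pi) (\<chi> i. pi) :: (real^2) set)"
    by (intro emeasure_mono torus_cell_subset) auto
  also have "\<dots> < \<infinity>"
    by (metis emeasure_lborel_cbox_finite)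
  finally show "emeasure torus (space torus) \<noteq> \<infinity>"
    by (simp add: torus_def emeasure_restrict_space space_restrict_space)
qed

interpretation torus: finite_measure torus
  by (rule finite_measure_torus)

lemma measurable_torus: "f \<in> borel_measurable borel \<Longrightarrow> f \<in> borel_measurable torus"
  unfolding torus_def by (rule measurable_restrict_space1) simp

lemma square_integrable_bounded:
  fixes f :: "real^2 \<Rightarrow> 'b::euclidean_space"
  assumes "f \<in> borel_measurable torus" "\<And>x. x \<in> torus_cell \<Longrightarrow> norm (f x) \<le> C"
  shows "square_integrable f"
  unfolding square_integrable_def
proof (intro conjI assms(1) torus.integrable_const_bound[where B="C\<^sup>2"])
  show "AE x in torus. norm ((norm (f x))\<^sup>2) \<le> C\<^sup>2"
    using assms(2) by (intro AE_I2) (auto intro: power_mono)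
qed (use assms(1) in measurable)

section \<open>Completeness of the space of square integrable functions\<close>

text \<open>On a finite measure space the L^1 norm is controlled by the L^2 norm. Integrating
  |f| \<le> |f|^2 / s + s, where s is the L^2 norm of f, gives this with a constant that is good enough for
  summing a geometric series.\<close>

lemma nn_integral_norm_l2_le:
  fixes F :: "'b::euclidean_space l2"
  shows "(\<integral>\<^sup>+x. ennreal (norm (rep_l2 F x)) \<partial>torus) \<le> ennreal ((1 + measure torus torus_cell) * norm F)"
proof (cases "norm F = 0")
  case True
  then have "F = 0" by simp
  then have "AE x in torus. rep_l2 F x = 0"
    using rep_abs_l2[OF square_integrable_zero] by (simp add: abs_l2_zero)
  then have "(\<integral>\<^sup>+x. ennreal (norm (rep_l2 F x)) \<partial>torus) = (\<integral>\<^sup>+x. 0 \<partial>torus)"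
    by (intro nn_integral_cong_AE) auto
  then show ?thesis by simp
next
  case False
  define s where "s = norm F"
  have s: "s > 0" using False by (simp add: s_def)
  have i: "integrable torus (\<lambda>x. (norm (rep_l2 F x))\<^sup>2)"
    using rep_l2_square_integrable[of F] by (simp add: square_integrable_def)
  have i2: "integrable torus (\<lambda>x. (norm (rep_l2 F x))\<^sup>2 / s + s)"
    using i by (intro Bochner_Integration.integrable_add) auto
  have "(\<integral>\<^sup>+x. ennreal (norm (rep_l2 F x)) \<partial>torus)
      \<le> (\<integral>\<^sup>+x. ennreal ((norm (rep_l2 F x))\<^sup>2 / s + s) \<partial>torus)"
  proof (intro nn_integral_mono ennreal_leI)
    fix x
    have "0 \<le> (norm (rep_l2 F x) - s)\<^sup>2" by simp
    then have "norm (rep_l2 F x) * s * 2 \<le> (norm (rep_l2 F x))\<^sup>2 + s\<^sup>2"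
      by (simp add: power2_diff algebra_simps)
    moreover have "0 \<le> norm (rep_l2 F x) * s" using s by simp
    ultimately have "norm (rep_l2 F x) * s \<le> (norm (rep_l2 F x))\<^sup>2 + s\<^sup>2" by linarith
    then show "norm (rep_l2 F x) \<le> (norm (rep_l2 F x))\<^sup>2 / s + s"
      using s by (simp add: field_simps power2_eq_square)
  qed
  also have "\<dots> = ennreal (LINT x|torus. (norm (rep_l2 F x))\<^sup>2 / s + s)"
    using s by (intro nn_integral_eq_integral i2) (auto intro!: add_nonneg_nonneg)
  also have "(LINT x|torus. (norm (rep_l2 F x))\<^sup>2 / s + s) = s\<^sup>2 / s + s * measure torus torus_cell"
    using i by (subst Bochner_Integration.integral_add) (auto simp: norm_rep_l2 s_def)
  finally show ?thesis using s by (simp add: s_def power2_eq_square algebra_simps)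
qed

text \<open>Riesz and Fischer: along a subsequence with distances below 2^-k the increments are summable in
  L^1, so the representatives converge almost everywhere, and Fatou's lemma bounds the L^2 distance
  between the limit and the k-th term.\<close>

instance l2 :: (euclidean_space) banach
proof
  fix X :: "nat \<Rightarrow> 'a l2"
  assume "Cauchy X"
  then have "\<exists>r. strict_mono r \<and> (\<forall>k. \<forall>m\<ge>r k. \<forall>n\<ge>r k. dist (X m) (X n) < (1/2)^k)"
  proof -
    have ex: "\<exists>M. \<forall>m\<ge>M. \<forall>n\<ge>M. dist (X m) (X n) < (1/2)^k" for k :: nat
      using \<open>Cauchy X\<close> unfolding Cauchy_def by auto
    then obtain M where M: "\<And>k m n. m \<ge> M k \<Longrightarrow> n \<ge> M k \<Longrightarrow> dist (X m) (X n) < (1/2)^k"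
      by metis
    \<comment> \<open>Adding up the thresholds makes the subsequence monotone; the summand k makes it strictly so.\<close>
    define r where "r k = (\<Sum>i\<le>k. M i) + k" for k
    have "M k \<le> r k" for k
      unfolding r_def by (intro trans_le_add1 member_le_sum) auto
    moreover have "strict_mono r" unfolding strict_mono_Suc_iff r_def by auto
    ultimately show ?thesis using M by (meson order_trans)
  qed
  then obtain r where r: "strict_mono r"
    and d: "\<And>k m n. m \<ge> r k \<Longrightarrow> n \<ge> r k \<Longrightarrow> dist (X m) (X n) < (1/2)^k" by blast
  define f where "f k = rep_l2 (X (r k))" for k
  have f_meas [measurable]: "f k \<in> borel_measurable torus" for k unfolding f_def by simp
  define C where "C = 1 + measure torus torus_cell"
  have C: "C \<ge> 0" by (simp add: C_def)
  have L1: "(\<integral>\<^sup>+x. ennreal (norm (f (Suc k) x - f k x)) \<partial>torus) \<le> ennreal (C * (1/2)^k)" for k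
  proof -
    have "(\<integral>\<^sup>+x. ennreal (norm (f (Suc k) x - f k x)) \<partial>torus)
        = (\<integral>\<^sup>+x. ennreal (norm (rep_l2 (X (r (Suc k)) - X (r k)) x)) \<partial>torus)"
      using rep_l2_diff[of "X (r (Suc k))" "X (r k)"]
      by (intro nn_integral_cong_AE) (auto simp: f_def)
    also have "\<dots> \<le> ennreal (C * norm (X (r (Suc k)) - X (r k)))"
      unfolding C_def by (rule nn_integral_norm_l2_le)
    also have "\<dots> \<le> ennreal (C * (1/2)^k)"
      using d[of k "r (Suc k)" "r k"] r C
      by (intro ennreal_leI mult_left_mono) (auto simp: dist_norm strict_mono_less_eq less_imp_le)
    finally show ?thesis .
  qed
  have "(\<integral>\<^sup>+x. (\<Sum>k. ennreal (norm (f (Suc k) x - f k x))) \<partial>torus)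
      = (\<Sum>k. \<integral>\<^sup>+x. ennreal (norm (f (Suc k) x - f k x)) \<partial>torus)"
    by (intro nn_integral_suminf) measurable
  also have "\<dots> \<le> (\<Sum>k. ennreal (C * (1/2)^k))"
    by (intro suminf_le L1) auto
  also have "\<dots> = ennreal (\<Sum>k. C * (1/2)^k)"
    using C by (intro suminf_ennreal2) (auto intro!: summable_mult summable_geometric)
  also have "\<dots> < \<infinity>" by simp
  finally have "AE x in torus. (\<Sum>k. ennreal (norm (f (Suc k) x - f k x))) \<noteq> \<infinity>"
    by (intro nn_integral_PInf_AE) (auto simp: less_top)
  then have conv: "AE x in torus. convergent (\<lambda>k. f k x)"
  proof eventually_elim
    case (elim x)
    then have "summable (\<lambda>k. norm (f (Suc k) x - f k x))"
      by (intro summable_suminf_not_top) auto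
    then have "summable (\<lambda>k. f (Suc k) x - f k x)" by (rule summable_norm_cancel)
    then have "convergent (\<lambda>n. \<Sum>k<n. f (Suc k) x - f k x)" by (simp add: summable_iff_convergent)
    then have "convergent (\<lambda>n. f n x - f 0 x)" using sum_lessThan_telescope[of "\<lambda>k. f k x"] by simp
    then show ?case using convergent_add[OF _ convergent_const[of "f 0 x"], of "\<lambda>n. f n x - f 0 x"] by simp
  qed
  define g where "g x = lim (\<lambda>k. f k x)" for x
  have g_meas [measurable]: "g \<in> borel_measurable torus"
    unfolding g_def by measurable
  have lim: "AE x in torus. (\<lambda>k. f k x) \<longlonglongrightarrow> g x"
    using conv by eventually_elim (simp add: g_def convergent_LIMSEQ_iff)
  have fatou: "(\<integral>\<^sup>+x. ennreal ((norm (g x - f k x))\<^sup>2) \<partial>torus) \<le> ennreal (((1/2)^k)\<^sup>2)" for k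
  proof -
    have "(\<integral>\<^sup>+x. ennreal ((norm (g x - f k x))\<^sup>2) \<partial>torus)
       = (\<integral>\<^sup>+x. liminf (\<lambda>m. ennreal ((norm (f m x - f k x))\<^sup>2)) \<partial>torus)"
    proof (rule nn_integral_cong_AE)
      show "AE x in torus. ennreal ((norm (g x - f k x))\<^sup>2)
         = liminf (\<lambda>m. ennreal ((norm (f m x - f k x))\<^sup>2))"
        using lim
      proof eventually_elim
        case (elim x)
        have L: "(\<lambda>m. ennreal ((norm (f m x - f k x))\<^sup>2)) \<longlonglongrightarrow> ennreal ((norm (g x - f k x))\<^sup>2)"
          by (intro tendsto_intros elim)
        show ?case by (rule lim_imp_Liminf[OF sequentially_bot L, symmetric])
      qed
    qed
    also have "\<dots> \<le> liminf (\<lambda>m. \<integral>\<^sup>+x. ennreal ((norm (f m x - f k x))\<^sup>2) \<partial>torus)"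
      by (intro nn_integral_liminf) measurable
    also have "\<dots> \<le> ennreal (((1/2)^k)\<^sup>2)"
    proof (rule Liminf_le)
      show "\<forall>\<^sub>F m in sequentially. (\<integral>\<^sup>+x. ennreal ((norm (f m x - f k x))\<^sup>2) \<partial>torus) \<le> ennreal (((1/2)^k)\<^sup>2)"
        using eventually_ge_at_top[of k]
      proof eventually_elim
        case (elim m)
        have "(\<integral>\<^sup>+x. ennreal ((norm (f m x - f k x))\<^sup>2) \<partial>torus)
          = (\<integral>\<^sup>+x. ennreal ((norm (rep_l2 (X (r m) - X (r k)) x))\<^sup>2) \<partial>torus)"
          using rep_l2_diff[of "X (r m)" "X (r k)"]
          by (intro nn_integral_cong_AE) (auto simp: f_def)
        also have "\<dots> = ennreal (LINT x|torus. (norm (rep_l2 (X (r m) - X (r k)) x))\<^sup>2)"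
          using rep_l2_square_integrable[of "X (r m) - X (r k)"]
          by (intro nn_integral_eq_integral) (auto simp: square_integrable_def)
        also have "\<dots> = ennreal ((norm (X (r m) - X (r k)))\<^sup>2)"
          by (simp add: norm_rep_l2)
        also have "\<dots> \<le> ennreal (((1/2)^k)\<^sup>2)"
          using d[of k "r m" "r k"] elim r
          by (intro ennreal_leI power_mono) (auto simp: dist_norm strict_mono_less_eq less_imp_le)
        finally show ?case .
      qed
    qed simp
    finally show ?thesis .
  qed
  have sq_diff: "square_integrable (\<lambda>x. g x - f k x)" for k
    unfolding square_integrable_def
  proof (intro conjI)
    show "integrable torus (\<lambda>x. (norm (g x - f k x))\<^sup>2)"
      by (rule integrableI_bounded) (use le_less_trans[OF fatou[of k]] in auto)
  qed measurable
  have sqg: "square_integrable g"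
    using square_integrable_add[OF sq_diff[of 0] rep_l2_square_integrable[of "X (r 0)"]] by (simp add: f_def)
  have bnd: "norm (abs_l2 g - X (r k)) \<le> (1/2)^k" for k
  proof -
    have "abs_l2 g - X (r k) = abs_l2 (\<lambda>x. g x - f k x)"
      using abs_l2_diff[OF sqg rep_l2_square_integrable[of "X (r k)"]] by (simp add: abs_rep_l2 f_def)
    then have "ennreal ((norm (abs_l2 g - X (r k)))\<^sup>2) = ennreal (LINT x|torus. (norm (g x - f k x))\<^sup>2)"
      using sq_diff[of k] by (simp add: norm_abs_l2)
    also have "\<dots> = (\<integral>\<^sup>+x. ennreal ((norm (g x - f k x))\<^sup>2) \<partial>torus)"
      using sq_diff[of k] by (intro nn_integral_eq_integral[symmetric]) (auto simp: square_integrable_def)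
    also have "\<dots> \<le> ennreal (((1/2)^k)\<^sup>2)" by (rule fatou)
    finally have "(norm (abs_l2 g - X (r k)))\<^sup>2 \<le> ((1/2)^k)\<^sup>2" by (subst (asm) ennreal_le_iff) auto
    then show ?thesis by (rule power2_le_imp_le) simp
  qed
  have "(\<lambda>k. X (r k)) \<longlonglongrightarrow> abs_l2 g"
  proof (rule LIMSEQ_I)
    fix e :: real assume "e > 0"
    then obtain k0 where k0: "(1/2)^k0 < e" using real_arch_pow_inv[of e "1/2"] by auto
    have "norm (X (r k) - abs_l2 g) < e" if "k \<ge> k0" for k
    proof -
      have "norm (X (r k) - abs_l2 g) \<le> (1/2)^k" using bnd[of k] by (simp add: norm_minus_commute)
      also have "\<dots> \<le> (1/2)^k0" using that by (intro power_decreasing) auto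
      finally show ?thesis using k0 by simp
    qed
    then show "\<exists>no. \<forall>n\<ge>no. norm (X (r n) - abs_l2 g) < e" by blast
  qed
  then have "X \<longlonglongrightarrow> abs_l2 g"
    using Cauchy_converges_subseq[OF \<open>Cauchy X\<close> r] unfolding o_def by blast
  then show "convergent X" by (rule convergentI)
qed

section \<open>Integration on the torus\<close>

definition vec2 :: "real \<Rightarrow> real \<Rightarrow> real^2" where
  "vec2 s t = s *\<^sub>R axis 1 1 + t *\<^sub>R axis 2 1"

lemma vec2_nth [simp]: "vec2 s t $ 1 = s" "vec2 s t $ 2 = t"
  by (simp_all add: vec2_def axis_def)

lemma vec2_eta: "vec2 (x $ 1) (x $ 2) = x"
  by (simp add: vec_eq_iff forall_2)

lemma vec2_measurable [measurable]: "(\<lambda>z. vec2 (fst z) (snd z)) \<in> borel_measurable borel"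
  unfolding vec2_def by (intro borel_measurable_continuous_onI continuous_intros)

definition circle :: "real measure" where
  "circle = restrict_space lborel {-pi..<pi}"

lemma space_circle [simp]: "space circle = {-pi..<pi}"
  by (simp add: circle_def space_restrict_space)

interpretation circle: finite_measure circle
  by standard (simp add: circle_def emeasure_restrict_space space_restrict_space)

interpretation circle2: pair_sigma_finite circle circle
  by standard

lemma Basis_real2: "(Basis :: (real^2) set) = {axis 1 1, axis 2 1}"
  by (auto simp: Basis_vec_def UNIV_2)

text \<open>A measure that gives every box its volume is Lebesgue measure. This identifies the measure of the
  plane with a product measure, to which Fubini's theorem applies.\<close>

lemma lborel_real2: "(lborel :: (real^2) measure) = distr (lborel \<Otimes>\<^sub>M lborel) borel (\<lambda>z. vec2 (fst z) (snd z))"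
proof (rule lborel_eqI)
  fix l u :: "real^2"
  assume lu: "\<And>b. b \<in> Basis \<Longrightarrow> l \<bullet> b \<le> u \<bullet> b"
  have lu1: "l $ 1 \<le> u $ 1" and lu2: "l $ 2 \<le> u $ 2"
    using lu[of "axis 1 1"] lu[of "axis 2 1"] by (auto simp: Basis_real2 inner_axis)
  have ne: "(axis 1 1 :: real^2) \<noteq> axis 2 1"
    by (simp add: axis_eq_axis)
  have "(\<lambda>z. vec2 (fst z) (snd z)) -` box l u = {l $ 1<..<u $ 1} \<times> {l $ 2<..<u $ 2}"
    by (auto simp: mem_box_cart forall_2)
  moreover have "emeasure (lborel \<Otimes>\<^sub>M lborel) ({l $ 1<..<u $ 1} \<times> {l $ 2<..<u $ 2})
     = ennreal (u $ 1 - l $ 1) * ennreal (u $ 2 - l $ 2)"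
    using lu1 lu2 by (subst lborel.emeasure_pair_measure_Times) auto
  moreover have "(\<lambda>z. vec2 (fst z) (snd z)) \<in> borel_measurable (lborel \<Otimes>\<^sub>M lborel)"
    unfolding lborel_prod by simp
  ultimately show "emeasure (distr (lborel \<Otimes>\<^sub>M lborel) borel (\<lambda>z. vec2 (fst z) (snd z))) (box l u)
      = ennreal (\<Prod>b\<in>Basis. (u - l) \<bullet> b)"
    using lu1 lu2 ne by (subst emeasure_distr) (auto simp: Basis_real2 inner_axis space_pair_measure ennreal_mult)
qed simp

lemma circle2_measurable: "(\<lambda>z. vec2 (fst z) (snd z)) \<in> measurable (circle \<Otimes>\<^sub>M circle) torus"
proof -
  have "(\<lambda>z. vec2 (fst z) (snd z)) \<in> borel_measurable (circle \<Otimes>\<^sub>M circle)"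
  proof -
    have [measurable]: "(\<lambda>s::real. s) \<in> measurable circle borel"
      unfolding circle_def by (rule measurable_restrict_space1) simp
    have "fst \<in> borel_measurable (circle \<Otimes>\<^sub>M circle)" "snd \<in> borel_measurable (circle \<Otimes>\<^sub>M circle)"
      using measurable_compose[OF measurable_fst \<open>(\<lambda>s::real. s) \<in> measurable circle borel\<close>]
        measurable_compose[OF measurable_snd \<open>(\<lambda>s::real. s) \<in> measurable circle borel\<close>]
      by auto
    then show ?thesis unfolding vec2_def by measurable
  qed
  then show ?thesis
    unfolding torus_def
    by (intro measurable_restrict_space2)
      (auto simp: space_pair_measure torus_cell_def forall_2)
qed

text \<open>Every slice of a subset of the cell is contained in one period, so Cavalieri's principle for the
  plane restricts to the cell.\<close>

lemma torus_eq_distr: "torus = distr (circle \<Otimes>\<^sub>M circle) torus (\<lambda>z. vec2 (fst z) (snd z))"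
proof (rule measure_eqI)
  fix A assume A: "A \<in> sets torus"
  then have Ac: "A \<subseteq> torus_cell" and Ab: "A \<in> sets borel"
    by (auto simp: torus_def sets_restrict_space)
  define B where "B = (\<lambda>z. vec2 (fst z) (snd z)) -` A"
  have Bm: "B \<in> sets borel"
    unfolding B_def using measurable_sets[OF vec2_measurable Ab] by simp
  have Bm': "B \<in> sets (lborel \<Otimes>\<^sub>M lborel)" unfolding lborel_prod using Bm by simp
  have Bsub: "B \<subseteq> {-pi..<pi} \<times> {-pi..<pi}"
    using Ac by (auto simp: B_def torus_cell_def forall_2 dest!: subsetD[of A])
  have Bsect: "Pair s -` B \<in> sets lborel" for s using sets_Pair1[OF Bm'] by simp
  have sub: "Pair s -` B \<subseteq> {-pi..<pi}" for s using Bsub by auto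
  have meas: "(\<lambda>s. emeasure lborel (Pair s -` B)) \<in> borel_measurable lborel"
    using lborel.measurable_emeasure_Pair[OF Bm'] .
  have "emeasure torus A = emeasure lborel A"
    using Ac Ab by (simp add: torus_def emeasure_restrict_space)
  also have "\<dots> = emeasure (lborel \<Otimes>\<^sub>M lborel) B"
    unfolding B_def using Ab
    by (subst lborel_real2, subst emeasure_distr) (auto simp: lborel_prod)
  also have "\<dots> = (\<integral>\<^sup>+s. emeasure lborel (Pair s -` B) \<partial>lborel)"
    by (rule lborel.emeasure_pair_measure_alt[OF Bm'])
  also have "\<dots> = (\<integral>\<^sup>+s. emeasure lborel (Pair s -` B) * indicator {-pi..<pi} s \<partial>lborel)"
  proof (intro nn_integral_cong)
    fix s
    have "Pair s -` B = {}" if "s \<notin> {-pi..<pi}" using Bsub that by auto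
    then show "emeasure lborel (Pair s -` B) = emeasure lborel (Pair s -` B) * indicator {-pi..<pi} s"
      by (cases "s \<in> {-pi..<pi}") simp_all
  qed
  also have "\<dots> = (\<integral>\<^sup>+s. emeasure lborel (Pair s -` B) \<partial>circle)"
    unfolding circle_def using meas by (subst nn_integral_restrict_space) auto
  also have "\<dots> = (\<integral>\<^sup>+s. emeasure circle (Pair s -` B) \<partial>circle)"
    using sub Bsect by (intro nn_integral_cong) (auto simp: circle_def emeasure_restrict_space)
  also have "\<dots> = emeasure (circle \<Otimes>\<^sub>M circle) B"
  proof (rule circle.emeasure_pair_measure_alt[symmetric])
    have "B = (\<lambda>z. vec2 (fst z) (snd z)) -` A \<inter> space (circle \<Otimes>\<^sub>M circle)"
      using Bsub by (auto simp: B_def space_pair_measure)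
    then show "B \<in> sets (circle \<Otimes>\<^sub>M circle)"
      using measurable_sets[OF circle2_measurable A] by simp
  qed
  also have "\<dots> = emeasure (distr (circle \<Otimes>\<^sub>M circle) torus (\<lambda>z. vec2 (fst z) (snd z))) A"
    using A Bsub circle2_measurable
    by (subst emeasure_distr) (auto simp: B_def space_pair_measure intro!: arg_cong[of _ _ "emeasure (circle \<Otimes>\<^sub>M circle)"])
  finally show "emeasure torus A = emeasure (distr (circle \<Otimes>\<^sub>M circle) torus (\<lambda>z. vec2 (fst z) (snd z))) A" .
qed simp

lemma torus_Fubini:
  fixes f :: "real^2 \<Rightarrow> real"
  assumes "integrable torus f"
  shows "(LINT x|torus. f x) = (LINT s|circle. LINT t|circle. f (vec2 s t))"
    and "(LINT x|torus. f x) = (LINT t|circle. LINT s|circle. f (vec2 s t))"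
proof -
  have fm: "f \<in> borel_measurable torus" using assms by auto
  have i: "integrable (circle \<Otimes>\<^sub>M circle) (\<lambda>z. f (vec2 (fst z) (snd z)))"
    using assms by (subst (asm) torus_eq_distr) (simp add: integrable_distr_eq circle2_measurable fm)
  have e: "(LINT x|torus. f x) = (LINT z|(circle \<Otimes>\<^sub>M circle). f (vec2 (fst z) (snd z)))"
    by (subst torus_eq_distr) (simp add: integral_distr circle2_measurable fm)
  show "(LINT x|torus. f x) = (LINT s|circle. LINT t|circle. f (vec2 s t))"
    unfolding e using circle2.integral_fst'[OF i] by simp
  have i': "integrable (circle \<Otimes>\<^sub>M circle) (case_prod (\<lambda>s t. f (vec2 s t)))"
    using i by (simp add: case_prod_beta')
  show "(LINT x|torus. f x) = (LINT t|circle. LINT s|circle. f (vec2 s t))"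
    unfolding e using circle2.integral_snd[OF i'] by (simp add: case_prod_beta')
qed

lemma circle_integral_FTC:
  fixes F f :: "real \<Rightarrow> real"
  assumes "\<And>s. (F has_real_derivative f s) (at s)" "continuous_on UNIV f"
  shows "(LINT s|circle. f s) = F pi - F (- pi)"
proof -
  have fm: "f \<in> borel_measurable borel" using assms(2) by (rule borel_measurable_continuous_onI)
  have "(LINT s|circle. f s) = (LINT s|lborel. indicator {-pi..<pi} s *\<^sub>R f s)"
    unfolding circle_def by (rule integral_restrict_space) simp
  also have "\<dots> = (LINT s|lborel. indicator {-pi..pi} s *\<^sub>R f s)"
  proof (rule integral_cong_AE)
    show "AE s in lborel. indicator {-pi..<pi} s *\<^sub>R f s = indicator {-pi..pi} s *\<^sub>R f s"
      using AE_lborel_singleton[of pi] by eventually_elim (auto simp: indicator_def)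
  qed (use fm in auto)
  also have "\<dots> = F pi - F (- pi)"
    using assms by (intro integral_FTC_Icc)
      (auto simp: has_real_derivative_iff_has_vector_derivative intro: has_vector_derivative_at_within continuous_on_subset)
  finally show ?thesis .
qed

lemma integrable_torus_continuous:
  fixes f :: "real^2 \<Rightarrow> 'b::euclidean_space"
  assumes "continuous_on UNIV f"
  shows "integrable torus f"
proof -
  have "compact (f ` cbox (\<chi> i. - pi) (\<chi> i. pi))"
    using assms by (intro compact_continuous_image) (auto intro: continuous_on_subset)
  then obtain B where B: "\<And>x. x \<in> cbox (\<chi> i. - pi) (\<chi> i. pi) \<Longrightarrow> norm (f x) \<le> B"
    using compact_imp_bounded bounded_iff by (metis imageI)
  show ?thesis
  proof (rule torus.integrable_const_bound[where B=B])
    show "AE x in torus. norm (f x) \<le> B" using B torus_cell_subset by (intro AE_I2) auto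
    show "f \<in> borel_measurable torus"
      using assms by (intro measurable_torus borel_measurable_continuous_onI)
  qed
qed

lemma square_integrable_continuous:
  fixes f :: "real^2 \<Rightarrow> 'b::euclidean_space"
  assumes "continuous_on UNIV f"
  shows "square_integrable f"
  unfolding square_integrable_def
  using assms by (intro conjI measurable_torus borel_measurable_continuous_onI integrable_torus_continuous continuous_intros)

lemma integrable_circle_continuous:
  fixes f :: "real \<Rightarrow> real"
  assumes "continuous_on UNIV f"
  shows "integrable circle f"
proof -
  have "compact (f ` {-pi..pi})"
    using assms by (intro compact_continuous_image) (auto intro: continuous_on_subset)
  then obtain B where B: "\<And>x. x \<in> {-pi..pi} \<Longrightarrow> norm (f x) \<le> B"
    using compact_imp_bounded bounded_iff by (metis imageI)
  show ?thesis
  proof (rule circle.integrable_const_bound[where B=B])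
    show "AE x in circle. norm (f x) \<le> B" using B by (intro AE_I2) auto
    show "f \<in> borel_measurable circle" unfolding circle_def
      using assms by (intro measurable_restrict_space1) (simp add: borel_measurable_continuous_onI)
  qed
qed

lemma torus_integral_product:
  fixes f g :: "real \<Rightarrow> real"
  assumes "continuous_on UNIV f" "continuous_on UNIV g"
  shows "(LINT x|torus. f (x $ 1) * g (x $ 2)) = (LINT s|circle. f s) * (LINT t|circle. g t)"
proof -
  have "integrable torus (\<lambda>x. f (x $ 1) * g (x $ 2))"
    by (intro integrable_torus_continuous continuous_intros
        continuous_on_compose2[OF assms(1)] continuous_on_compose2[OF assms(2)]) auto
  then show ?thesis by (subst torus_Fubini(1)) simp_all
qed

text \<open>On each line in direction i the integral over one period is the difference of two equal values
  of h. Fubini's theorem, with the order of integration chosen according to i, does the rest.\<close>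

lemma torus_integral_partial_zero:
  fixes h h' :: "real^2 \<Rightarrow> real"
  assumes per: "periodic h"
    and der: "\<And>x. ((\<lambda>s. h (x + s *\<^sub>R axis i 1)) has_real_derivative h' x) (at 0)"
    and cont: "continuous_on UNIV h'"
  shows "(LINT x|torus. h' x) = 0"
proof -
  \<comment> \<open>Differentiability at 0 along all translates is differentiability along the whole line.\<close>
  have line: "((\<lambda>s. h (y + s *\<^sub>R axis i 1)) has_real_derivative h' (y + s *\<^sub>R axis i 1)) (at s)" for y s
    using der[of "y + s *\<^sub>R axis i 1"] DERIV_shift[of "\<lambda>s. h (y + s *\<^sub>R axis i 1)" _ 0 s]
    by (simp add: algebra_simps)
  have cont': "continuous_on UNIV (\<lambda>s. h' (y + s *\<^sub>R axis i 1))" for y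
    by (rule continuous_on_compose2[OF cont]) (auto intro!: continuous_intros)
  have zero: "(LINT s|circle. h' (y + s *\<^sub>R axis i 1)) = 0" for y
  proof -
    have "h ((y + (- pi) *\<^sub>R axis i 1) + axis i (2 * pi)) = h (y + (- pi) *\<^sub>R axis i 1)"
      using per by (simp only: periodic_def)
    moreover have "(y + (- pi) *\<^sub>R axis i 1) + axis i (2 * pi) = y + pi *\<^sub>R axis i 1"
      by (simp add: vec_eq_iff axis_def)
    ultimately have "h (y + pi *\<^sub>R axis i 1) = h (y + (- pi) *\<^sub>R axis i 1)" by metis
    then show ?thesis
      using circle_integral_FTC[OF line[of y] cont'[of y]] by simp
  qed
  have i: "i = 1 \<or> i = 2" using exhaust_2[of i] .
  have int: "integrable torus h'" by (rule integrable_torus_continuous[OF cont])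
  show ?thesis
  proof (cases "i = 1")
    case True
    have "vec2 s t = t *\<^sub>R axis 2 1 + s *\<^sub>R axis i 1" for s t using True by (simp add: vec2_def)
    then show ?thesis using zero by (subst torus_Fubini(2)[OF int]) simp
  next
    case False
    then have "vec2 s t = s *\<^sub>R axis 1 1 + t *\<^sub>R axis i 1" for s t using i by (simp add: vec2_def)
    then show ?thesis using zero by (subst torus_Fubini(1)[OF int]) simp
  qed
qed

text \<open>If F is an antiderivative of a periodic function, then F(y + 2 pi) - F(y) does not depend on y.\<close>

lemma circle_integral_shift:
  fixes f :: "real \<Rightarrow> real"
  assumes cont: "continuous_on UNIV f" and per: "\<And>s. f (s + 2 * pi) = f s"
  shows "(LINT s|circle. f (s - c)) = (LINT s|circle. f s)"
proof -
  obtain F where F': "\<And>x. (F has_vector_derivative f x) (at x)"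
    using einterval_antiderivative[of "-\<infinity>" "\<infinity>" f] cont
    by (auto simp: continuous_on_eq_continuous_at)
  then have F: "(F has_real_derivative f x) (at x)" for x
    by (simp add: has_real_derivative_iff_has_vector_derivative)
  have "((\<lambda>y. F (y + 2 * pi) - F y) has_real_derivative f (y + 2 * pi) - f y) (at y)" for y
    using F[of "y + 2 * pi"] F[of y] by (intro derivative_intros) (simp add: DERIV_shift add.commute)
  then have "(\<lambda>y. F (y + 2 * pi) - F y) x = (\<lambda>y. F (y + 2 * pi) - F y) y" for x y
    using per by (intro DERIV_isconst_all) auto
  from this[of "- pi - c" "- pi"] have e: "F (pi - c) - F (- pi - c) = F pi - F (- pi)"
    by (simp add: algebra_simps)
  have "((\<lambda>s. F (s - c)) has_real_derivative f (s - c)) (at s)" for s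
    using F[of "s - c"] DERIV_shift[of F "f (s - c)" s "- c"] by simp
  moreover have "continuous_on UNIV (\<lambda>s. f (s - c))"
    by (rule continuous_on_compose2[OF cont]) (auto intro!: continuous_intros)
  ultimately have "(LINT s|circle. f (s - c)) = F (pi - c) - F (- pi - c)"
    by (rule circle_integral_FTC)
  then show ?thesis using e circle_integral_FTC[OF F cont] by simp
qed

lemma has_real_derivative_pd:
  assumes "f differentiable (at x)"
  shows "((\<lambda>s. f (x + s *\<^sub>R axis i 1)) has_real_derivative pd i f x) (at 0)"
proof -
  have "(f has_derivative frechet_derivative f (at x)) (at x)"
    using assms by (simp add: frechet_derivative_works)
  then have d: "(f has_derivative frechet_derivative f (at x)) (at (x + 0 *\<^sub>R axis i 1))"
    by simp
  have l: "((\<lambda>s. x + s *\<^sub>R axis i 1) has_derivative (\<lambda>s. s *\<^sub>R axis i 1)) (at 0)"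
    by (auto intro!: derivative_eq_intros)
  have "((f \<circ> (\<lambda>s. x + s *\<^sub>R axis i 1)) has_derivative
      (frechet_derivative f (at x) \<circ> (\<lambda>s. s *\<^sub>R axis i 1))) (at 0)"
    using l d by (rule diff_chain_at)
  moreover have "(frechet_derivative f (at x) \<circ> (\<lambda>s. s *\<^sub>R axis i 1)) = (\<lambda>s. pd i f x * s)"
    using linear_frechet_derivative[OF assms] by (auto simp: pd_def linear_cmul)
  ultimately show ?thesis by (simp add: has_field_derivative_def o_def)
qed

lemma pd_eqI:
  assumes "(f has_derivative f') (at x)"
  shows "pd i f x = f' (axis i 1)"
  using frechet_derivative_at[OF assms] by (simp add: pd_def)

lemma test_function_derivative:
  assumes "test_function \<phi>"
  shows "((\<lambda>s. \<phi> (x + s *\<^sub>R axis i 1)) has_real_derivative pd i \<phi> x) (at 0)"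
    "continuous_on UNIV \<phi>" "continuous_on UNIV (pd i \<phi>)"
proof -
  have "times_differentiable 1 \<phi>" using assms by (simp add: test_function_def)
  then have d: "\<phi> differentiable_on UNIV" and "continuous_on UNIV (pd i \<phi>)" by auto
  then show "continuous_on UNIV (pd i \<phi>)" by simp
  show "continuous_on UNIV \<phi>" using d by (rule differentiable_imp_continuous_on)
  have "\<phi> differentiable (at x)" using d by (simp add: differentiable_on_def)
  then show "((\<lambda>s. \<phi> (x + s *\<^sub>R axis i 1)) has_real_derivative pd i \<phi> x) (at 0)"
    by (rule has_real_derivative_pd)
qed

text \<open>For a periodic continuously differentiable function this makes the classical partial derivative
  the distributional one.\<close>

lemma torus_integration_by_parts:
  assumes \<phi>: "test_function \<phi>" and per: "periodic f"
    and der: "\<And>x. ((\<lambda>s. f (x + s *\<^sub>R axis i 1)) has_real_derivative f' x) (at 0)"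
    and cont: "continuous_on UNIV f" "continuous_on UNIV f'"
  shows "(LINT x|torus. f x * pd i \<phi> x) = - (LINT x|torus. f' x * \<phi> x)"
proof -
  note t = test_function_derivative[OF \<phi>]
  have "(LINT x|torus. f' x * \<phi> x + f x * pd i \<phi> x) = 0"
  proof (rule torus_integral_partial_zero[where h="\<lambda>x. f x * \<phi> x" and i=i])
    show "periodic (\<lambda>x. f x * \<phi> x)"
      using per \<phi> by (simp add: periodic_def test_function_def)
    show "((\<lambda>s. f (x + s *\<^sub>R axis i 1) * \<phi> (x + s *\<^sub>R axis i 1)) has_real_derivative
        f' x * \<phi> x + f x * pd i \<phi> x) (at 0)" for x
      using DERIV_mult[OF der[of x] t(1)[of x i]] by (simp add: mult.commute)
    show "continuous_on UNIV (\<lambda>x. f' x * \<phi> x + f x * pd i \<phi> x)"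
      using cont t(2,3) by (intro continuous_intros)
  qed
  moreover have "integrable torus (\<lambda>x. f' x * \<phi> x)" "integrable torus (\<lambda>x. f x * pd i \<phi> x)"
    using cont t(2,3) by (auto intro!: integrable_torus_continuous continuous_intros)
  ultimately show ?thesis by simp
qed

section \<open>The Hartley functions\<close>

text \<open>The kernel cas = cos + sin of the Hartley transform turns the characters of the torus into a real
  orthonormal basis that is indexed by all of Z^2, without separate families of sines and cosines.
  Differentiation maps the function with frequency k to a multiple of the one with frequency - k.\<close>

definition cas :: "real \<Rightarrow> real" where "cas \<theta> = cos \<theta> + sin \<theta>"

definition phase :: "int \<times> int \<Rightarrow> real^2 \<Rightarrow> real" where
  "phase k x = of_int (fst k) * x $ 1 + of_int (snd k) * x $ 2"

definition freq :: "2 \<Rightarrow> int \<times> int \<Rightarrow> real" where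
  "freq i k = (if i = 1 then of_int (fst k) else of_int (snd k))"

definition hartley :: "int \<times> int \<Rightarrow> real^2 \<Rightarrow> real" where
  "hartley k x = cas (phase k x) / (2 * pi)"

lemma phase_shift: "phase k (x + s *\<^sub>R axis i 1) = phase k x + s * freq i k"
  using exhaust_2[of i] by (auto simp: phase_def freq_def axis_def algebra_simps)

lemma phase_add: "phase (k + l) x = phase k x + phase l x"
  and phase_diff: "phase (k - l) x = phase k x - phase l x"
  and phase_uminus: "phase (- k) x = - phase k x"
  by (simp_all add: phase_def algebra_simps)

lemma freq_uminus: "freq i (- k) = - freq i k"
  by (simp add: freq_def)

lemma continuous_on_phase [continuous_intros]: "continuous_on A (phase k)"
  unfolding phase_def by (intro continuous_intros)

lemma continuous_on_hartley: "continuous_on A (hartley k)"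
  unfolding hartley_def cas_def by (intro continuous_intros continuous_on_compose2[OF continuous_on_phase[of UNIV]]) auto

lemma phase_periodic:
  "cos (phase k (x + axis i (2 * pi))) = cos (phase k x)"
  "sin (phase k (x + axis i (2 * pi))) = sin (phase k x)"
proof -
  have "phase k (x + axis i (2 * pi)) = phase k x + 2 * pi * of_int (if i = 1 then fst k else snd k)"
    using exhaust_2[of i] by (auto simp: phase_def axis_def algebra_simps)
  then show "cos (phase k (x + axis i (2 * pi))) = cos (phase k x)"
    "sin (phase k (x + axis i (2 * pi))) = sin (phase k x)"
    by (simp_all add: cos_add sin_add)
qed

lemma integral_phase_zero:
  assumes "k \<noteq> 0"
  shows "(LINT x|torus. cos (phase k x)) = 0" "(LINT x|torus. sin (phase k x)) = 0"
proof -
  obtain i where i: "freq i k \<noteq> 0"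
  proof -
    have "fst k \<noteq> 0 \<or> snd k \<noteq> 0" using assms by (metis prod.collapse zero_prod_def)
    then have "freq 1 k \<noteq> 0 \<or> freq 2 k \<noteq> 0" by (auto simp: freq_def)
    then show thesis using that by blast
  qed
  show "(LINT x|torus. cos (phase k x)) = 0"
  proof (rule torus_integral_partial_zero[where h="\<lambda>x. sin (phase k x) / freq i k" and i=i])
    show "((\<lambda>s. sin (phase k (x + s *\<^sub>R axis i 1)) / freq i k) has_real_derivative cos (phase k x)) (at 0)" for x
      unfolding phase_shift using i by (auto intro!: derivative_eq_intros)
  qed (auto simp: periodic_def phase_periodic intro!: continuous_intros)
  show "(LINT x|torus. sin (phase k x)) = 0"
  proof (rule torus_integral_partial_zero[where h="\<lambda>x. - cos (phase k x) / freq i k" and i=i])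
    show "((\<lambda>s. - cos (phase k (x + s *\<^sub>R axis i 1)) / freq i k) has_real_derivative sin (phase k x)) (at 0)" for x
      unfolding phase_shift using i by (auto intro!: derivative_eq_intros)
  qed (auto simp: periodic_def phase_periodic intro!: continuous_intros)
qed

lemma measure_torus: "measure torus torus_cell = 4 * pi\<^sup>2"
proof -
  have "measure torus torus_cell = (LINT x|torus. (\<lambda>_. 1) (x $ 1) * (\<lambda>_. 1) (x $ 2))"
    using torus.emeasure_eq_measure by simp
  also have "\<dots> = (LINT s|circle. 1) * (LINT s|circle. 1)"
    by (subst torus_integral_product) auto
  also have "(LINT s|circle. 1) = 2 * pi"
    using circle_integral_FTC[of "\<lambda>s. s" "\<lambda>_. 1"] by simp
  finally show ?thesis by (simp add: power2_eq_square)
qed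

definition hbasis :: "int \<times> int \<Rightarrow> real l2" where
  "hbasis k = abs_l2 (hartley k)"

lemma square_integrable_hartley: "square_integrable (hartley k)"
  by (rule square_integrable_continuous[OF continuous_on_hartley])

text \<open>The product formula cas a * cas b = cos (a - b) + sin (a + b): integrals of sines vanish, and the
  integral of the cosine survives only for equal frequencies.\<close>

lemma hbasis_orthonormal: "hbasis k \<bullet> hbasis l = (if k = l then 1 else 0)"
proof -
  have e: "hartley k x * hartley l x = (cos (phase (k - l) x) + sin (phase (k + l) x)) / (4 * pi\<^sup>2)" for x
    by (simp add: hartley_def cas_def phase_diff phase_add cos_diff sin_add power2_eq_square field_simps)
  have i: "integrable torus (\<lambda>x. cos (phase m x))" "integrable torus (\<lambda>x. sin (phase m x))" for m
    by (intro integrable_torus_continuous continuous_intros)+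
  have s: "(LINT x|torus. sin (phase m x)) = 0" for m
    using integral_phase_zero(2)[of m] by (cases "m = 0") (auto simp: phase_def)
  have c: "(LINT x|torus. cos (phase m x)) = (if m = 0 then 4 * pi\<^sup>2 else 0)" for m
    using integral_phase_zero(1)[of m] by (cases "m = 0") (auto simp: phase_def measure_torus)
  have "hbasis k \<bullet> hbasis l = (LINT x|torus. (cos (phase (k - l) x) + sin (phase (k + l) x)) / (4 * pi\<^sup>2))"
    unfolding hbasis_def by (simp add: inner_abs_l2 square_integrable_hartley e)
  also have "\<dots> = (if k = l then 1 else 0)"
    by (simp add: i s c)
  finally show ?thesis .
qed

section \<open>Completeness of the Hartley system\<close>

text \<open>The span of the Hartley functions. It is an algebra, because
  2 cos t = cas t + cas (- t) and 2 sin t = cas t - cas (- t) turn the product formula for cas into a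
  linear combination of four Hartley functions.\<close>

inductive trig_poly :: "(real^2 \<Rightarrow> real) \<Rightarrow> bool" where
  cas: "trig_poly (\<lambda>x. cas (phase k x))"
| add: "trig_poly f \<Longrightarrow> trig_poly g \<Longrightarrow> trig_poly (\<lambda>x. f x + g x)"
| scale: "trig_poly f \<Longrightarrow> trig_poly (\<lambda>x. c * f x)"

lemma trig_poly_cas_mult: "trig_poly g \<Longrightarrow> trig_poly (\<lambda>x. cas (phase k x) * g x)"
proof (induction rule: trig_poly.induct)
  case (cas l)
  have "cas (phase k x) * cas (phase l x) = (1/2 * cas (phase (k - l) x) + 1/2 * cas (phase (l - k) x))
     + (1/2 * cas (phase (k + l) x) + (-1/2) * cas (phase (- (k + l)) x))" for x
    unfolding phase_uminus
    by (simp add: cas_def phase_diff phase_add cos_diff cos_add sin_add sin_diff algebra_simps)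
  then show ?case by (simp only:) (intro trig_poly.intros)
next
  case (add f g)
  then show ?case unfolding distrib_left by (intro trig_poly.add)
next
  case (scale f c)
  then show ?case using trig_poly.scale[of "\<lambda>x. cas (phase k x) * f x" c] by (simp add: mult.left_commute)
qed

lemma trig_poly_mult: "trig_poly f \<Longrightarrow> trig_poly g \<Longrightarrow> trig_poly (\<lambda>x. f x * g x)"
proof (induction rule: trig_poly.induct)
  case (cas k)
  then show ?case by (rule trig_poly_cas_mult)
next
  case (add f1 f2)
  then show ?case unfolding distrib_right by (intro trig_poly.add) auto
next
  case (scale f c)
  then show ?case using trig_poly.scale[of "\<lambda>x. f x * g x" c] by (simp add: mult.assoc)
qed

lemma trig_poly_cos_sin:
  "trig_poly (\<lambda>x. cos (phase k x))" "trig_poly (\<lambda>x. sin (phase k x))"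
proof -
  have "cos (phase k x) = 1/2 * cas (phase k x) + 1/2 * cas (phase (- k) x)"
    and "sin (phase k x) = 1/2 * cas (phase k x) + (-1/2) * cas (phase (- k) x)" for x
    by (simp_all add: cas_def phase_uminus field_simps)
  then show "trig_poly (\<lambda>x. cos (phase k x))" "trig_poly (\<lambda>x. sin (phase k x))"
    by (simp_all only:) (intro trig_poly.intros)+
qed

text \<open>The torus as a product of two circles: a compact subset of a Euclidean space, on which the
  Stone-Weierstrass theorem provides uniform polynomial approximation.\<close>

definition torus_embed :: "real^2 \<Rightarrow> complex \<times> complex" where
  "torus_embed x = (cis (x $ 1), cis (x $ 2))"

text \<open>The real coordinates of the embedding are the functions cos x_i and sin x_i, and trigonometric
  polynomials form an algebra.\<close>

lemma trig_poly_polynomial: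
  assumes "real_polynomial_function p"
  shows "trig_poly (\<lambda>x. p (torus_embed x))"
  using assms
proof (induction rule: real_polynomial_function.induct)
  case (linear f)
  interpret f: bounded_linear f by fact
  have e: "torus_embed x = ((cos (x $ 1) *\<^sub>R (1, 0) + sin (x $ 1) *\<^sub>R (\<i>, 0)) +
      (cos (x $ 2) *\<^sub>R (0, 1) + sin (x $ 2) *\<^sub>R (0, \<i>)))" for x
    by (simp add: torus_embed_def complex_eq_iff)
  have "f (torus_embed x) = ((f (1, 0) * cos (phase (1, 0) x) + f (\<i>, 0) * sin (phase (1, 0) x)) +
      (f (0, 1) * cos (phase (0, 1) x) + f (0, \<i>) * sin (phase (0, 1) x)))" for x
    unfolding e f.add f.scaleR by (simp add: phase_def)
  then show ?case by (simp only:) (intro trig_poly.add trig_poly.scale trig_poly_cos_sin)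
next
  case (const c)
  have "cas (phase 0 x) = 1" for x by (simp add: phase_def cas_def)
  then show ?case using trig_poly.scale[OF trig_poly.cas[of 0], of c] by simp
next
  case (add f g)
  then show ?case by (intro trig_poly.add)
next
  case (mult f g)
  then show ?case by (intro trig_poly_mult)
qed

lemma trig_poly_continuous: "trig_poly f \<Longrightarrow> continuous_on UNIV f"
  by (induction rule: trig_poly.induct) (auto simp: cas_def intro!: continuous_intros)

lemma integrable_rep_times_bounded:
  fixes F :: "real l2"
  assumes "\<psi> \<in> borel_measurable torus" "\<And>x. x \<in> torus_cell \<Longrightarrow> \<bar>\<psi> x\<bar> \<le> B"
  shows "integrable torus (\<lambda>x. rep_l2 F x * \<psi> x)"
  using integrable_inner_l2[OF rep_l2_square_integrable square_integrable_bounded, of \<psi> B F] assms by simp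

lemma integrable_rep_times_continuous:
  fixes F :: "real l2"
  assumes "continuous_on UNIV \<psi>"
  shows "integrable torus (\<lambda>x. rep_l2 F x * \<psi> x)"
  using integrable_inner_l2[OF rep_l2_square_integrable square_integrable_continuous, of \<psi> F] assms by simp

lemma orthogonal_trig_poly:
  assumes "\<And>k. F \<bullet> hbasis k = 0" "trig_poly f"
  shows "(LINT x|torus. rep_l2 F x * f x) = 0"
  using assms(2)
proof (induction rule: trig_poly.induct)
  case (cas k)
  have "F \<bullet> hbasis k = (LINT x|torus. rep_l2 F x * hartley k x)"
    using inner_abs_l2[OF rep_l2_square_integrable square_integrable_hartley, of F k]
    by (simp add: abs_rep_l2 hbasis_def)
  also have "\<dots> = (LINT x|torus. rep_l2 F x * cas (phase k x)) / (2 * pi)"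
    by (simp add: hartley_def)
  finally show ?case using assms(1)[of k] by simp
next
  case (add f g)
  then have "integrable torus (\<lambda>x. rep_l2 F x * f x)" "integrable torus (\<lambda>x. rep_l2 F x * g x)"
    by (auto intro: integrable_rep_times_continuous trig_poly_continuous)
  then show ?case using add by (simp add: distrib_left)
next
  case (scale f c)
  then show ?case by (simp add: mult.left_commute)
qed

lemma continuous_on_torus_embed: "continuous_on A torus_embed"
  unfolding torus_embed_def by (intro continuous_intros)

lemma torus_embed_inj:
  assumes "x \<in> torus_cell" "y \<in> torus_cell" "torus_embed x = torus_embed y"
  shows "x = y"
proof -
  have "x $ i = y $ i" for i
  proof -
    have c: "cis (x $ i) = cis (y $ i)"
      using assms(3) exhaust_2[of i] by (auto simp: torus_embed_def)
    then have "cos (x $ i) = cos (y $ i)" "sin (x $ i) = sin (y $ i)" by (simp_all add: complex_eq_iff)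
    then obtain n :: int where n: "x $ i = y $ i + 2 * pi * of_int n"
      using sin_cos_eq_iff by (metis)
    have b: "- pi \<le> x $ i" "x $ i < pi" "- pi \<le> y $ i" "y $ i < pi"
      using assms(1,2) by (auto simp: torus_cell_def)
    have "2 * pi * of_int n < 2 * pi * 1" "2 * pi * (- 1) < 2 * pi * of_int n" using n b by linarith+
    then have "of_int n < (1::real)" "- 1 < (of_int n::real)"
      by (simp_all only: mult_less_cancel_left_pos pi_gt_zero zero_less_mult_iff zero_less_numeral simp_thms)
    then have "n = 0" by linarith
    then show ?thesis using n by simp
  qed
  then show ?thesis by (simp add: vec_eq_iff)
qed

text \<open>F is integrable, so a uniform approximation of the continuous function by trigonometric
  polynomials changes the integral by arbitrarily little.\<close>

lemma orthogonal_continuous: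
  assumes orth: "\<And>k. F \<bullet> hbasis k = 0" and g: "continuous_on UNIV (g :: complex \<times> complex \<Rightarrow> real)"
  shows "(LINT x|torus. rep_l2 F x * g (torus_embed x)) = 0"
proof (rule ccontr)
  assume ne: "(LINT x|torus. rep_l2 F x * g (torus_embed x)) \<noteq> 0"
  define I where "I = (LINT x|torus. \<bar>rep_l2 F x\<bar>)"
  have I: "I \<ge> 0" unfolding I_def by simp
  have intF: "integrable torus (\<lambda>x. rep_l2 F x)"
    using integrable_rep_times_continuous[of "\<lambda>_. 1" F] by simp
  \<comment> \<open>With this accuracy the approximation error, at most e times the L^1 norm I of F, falls short of the integral.\<close>
  define e where "e = \<bar>LINT x|torus. rep_l2 F x * g (torus_embed x)\<bar> / (I + 1)"
  have e: "e > 0" using ne I by (simp add: e_def)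
  define S where "S = sphere (0::complex) 1 \<times> sphere (0::complex) 1"
  have "compact S" unfolding S_def by (intro compact_Times) auto
  then obtain p where p: "real_polynomial_function p" and pe: "\<And>z. z \<in> S \<Longrightarrow> \<bar>g z - p z\<bar> < e"
    using Stone_Weierstrass_real_polynomial_function[of S g e] e g continuous_on_subset by blast
  have t: "trig_poly (\<lambda>x. p (torus_embed x))" by (rule trig_poly_polynomial[OF p])
  have zero: "(LINT x|torus. rep_l2 F x * p (torus_embed x)) = 0"
    by (rule orthogonal_trig_poly[OF orth t])
  have cg: "continuous_on UNIV (\<lambda>x. g (torus_embed x))"
    by (rule continuous_on_compose2[OF g continuous_on_torus_embed]) auto
  have i1: "integrable torus (\<lambda>x. rep_l2 F x * g (torus_embed x))"
    by (rule integrable_rep_times_continuous[OF cg])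
  have i2: "integrable torus (\<lambda>x. rep_l2 F x * p (torus_embed x))"
    by (rule integrable_rep_times_continuous[OF trig_poly_continuous[OF t]])
  have "\<bar>LINT x|torus. rep_l2 F x * g (torus_embed x)\<bar>
     = \<bar>LINT x|torus. rep_l2 F x * g (torus_embed x) - rep_l2 F x * p (torus_embed x)\<bar>"
    using zero i1 i2 by simp
  also have "\<dots> \<le> (LINT x|torus. \<bar>rep_l2 F x * g (torus_embed x) - rep_l2 F x * p (torus_embed x)\<bar>)"
    by (rule integral_abs_bound)
  also have "\<dots> \<le> (LINT x|torus. e * \<bar>rep_l2 F x\<bar>)"
  proof (rule integral_mono)
    fix x
    have "torus_embed x \<in> S" by (simp add: S_def torus_embed_def)
    then have "\<bar>rep_l2 F x\<bar> * \<bar>g (torus_embed x) - p (torus_embed x)\<bar> \<le> \<bar>rep_l2 F x\<bar> * e"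
      using pe by (intro mult_left_mono) (auto simp: less_imp_le)
    then show "\<bar>rep_l2 F x * g (torus_embed x) - rep_l2 F x * p (torus_embed x)\<bar> \<le> e * \<bar>rep_l2 F x\<bar>"
      by (simp add: abs_mult[symmetric] right_diff_distrib mult.commute)
  qed (use i1 i2 intF in auto)
  also have "\<dots> = e * I" by (simp add: I_def)
  also have "\<dots> < e * (I + 1)" using e by simp
  also have "\<dots> = \<bar>LINT x|torus. rep_l2 F x * g (torus_embed x)\<bar>"
    using I by (simp add: e_def)
  finally show False by simp
qed

text \<open>The indicator of K is the pointwise limit of continuous functions of the distance to the image
  of K in the product of circles; it is there that functions must be continuous to be approximable by
  trigonometric polynomials, and the embedding is injective on the cell.\<close>

lemma orthogonal_compact:
  assumes orth: "\<And>k. F \<bullet> hbasis k = 0" and K: "compact K" "K \<subseteq> torus_cell"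
  shows "(LINT x|torus. rep_l2 F x * indicator K x) = 0"
proof (cases "K = {}")
  case False
  define C where "C = torus_embed ` K"
  have C: "compact C" "C \<noteq> {}"
    using K(1) False by (auto simp: C_def intro: compact_continuous_image continuous_on_torus_embed)
  \<comment> \<open>Tent functions of slope n that decrease to the indicator of K on the cell.\<close>
  define \<psi> where "\<psi> n x = max 0 (1 - real n * infdist (torus_embed x) C)" for n x
  have cont: "continuous_on UNIV (\<lambda>z. max 0 (1 - real n * infdist z C))" for n
    by (intro continuous_intros)
  have zero: "(LINT x|torus. rep_l2 F x * \<psi> n x) = 0" for n
    unfolding \<psi>_def by (rule orthogonal_continuous[OF orth cont])
  have b: "0 \<le> \<psi> n x" "\<psi> n x \<le> 1" for n x
    by (auto simp: \<psi>_def infdist_nonneg)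
  have [measurable]: "\<psi> n \<in> borel_measurable torus" for n
    unfolding \<psi>_def
    by (intro measurable_torus borel_measurable_continuous_onI continuous_on_compose2[OF cont continuous_on_torus_embed]) auto
  have [measurable]: "K \<in> sets torus"
    using K by (auto simp: torus_def sets_restrict_space compact_imp_closed)
  have intF: "integrable torus (\<lambda>x. rep_l2 F x)"
    using integrable_rep_times_continuous[of "\<lambda>_. 1" F] by simp
  have "(\<lambda>n. LINT x|torus. rep_l2 F x * \<psi> n x) \<longlonglongrightarrow> (LINT x|torus. rep_l2 F x * indicator K x)"
  proof (rule integral_dominated_convergence[where w="\<lambda>x. \<bar>rep_l2 F x\<bar>"])
    show "AE x in torus. (\<lambda>n. rep_l2 F x * \<psi> n x) \<longlonglongrightarrow> rep_l2 F x * indicator K x"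
    proof (intro AE_I2 tendsto_mult tendsto_const)
      fix x assume "x \<in> space torus"
      then have x: "x \<in> torus_cell" by simp
      show "(\<lambda>n. \<psi> n x) \<longlonglongrightarrow> indicator K x"
      proof (cases "x \<in> K")
        case True
        then have "infdist (torus_embed x) C = 0" by (simp add: C_def)
        then show ?thesis using True by (simp add: \<psi>_def)
      next
        case xK: False
        have "torus_embed x \<notin> C"
          using xK x K(2) torus_embed_inj unfolding C_def by (auto simp: subset_iff)
        then have d: "infdist (torus_embed x) C > 0"
          using C infdist_pos_not_in_closed[of C] by (simp add: compact_imp_closed)
        have "\<forall>\<^sub>F n in sequentially. \<psi> n x = 0"
        proof -
          obtain n0 :: nat where "1 / infdist (torus_embed x) C < real n0" using reals_Archimedean2 by blast
          then have "1 - real n * infdist (torus_embed x) C \<le> 0" if "n \<ge> n0" for n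
          proof -
            have "1 / infdist (torus_embed x) C \<le> real n" using \<open>_ < real n0\<close> that by linarith
            then show ?thesis using d by (simp add: field_simps)
          qed
          then show ?thesis unfolding \<psi>_def eventually_sequentially by (intro exI[of _ n0]) auto
        qed
        then have "(\<lambda>n. \<psi> n x) \<longlonglongrightarrow> 0" by (rule tendsto_eventually)
        then show ?thesis using xK by simp
      qed
    qed
    show "AE x in torus. norm (rep_l2 F x * \<psi> n x) \<le> \<bar>rep_l2 F x\<bar>" for n
      using b by (intro AE_I2) (auto simp: abs_mult mult_left_le)
  qed (use intF in \<open>auto intro: borel_measurable_indicator\<close>)
  then show ?thesis using zero LIMSEQ_unique[OF _ tendsto_const] by fastforce
qed simp

text \<open>Otherwise F is positive on a set of positive measure, hence by inner regularity on a compact set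
  of positive measure, and its integral over that set cannot vanish.\<close>

lemma orthogonal_AE_nonpos:
  assumes orth: "\<And>k. F \<bullet> hbasis k = 0"
  shows "AE x in torus. rep_l2 F x \<le> 0"
proof (rule ccontr)
  assume neg: "\<not> (AE x in torus. rep_l2 F x \<le> 0)"
  define A where "A = {x \<in> space torus. rep_l2 F x > 0}"
  have A: "A \<in> sets torus" unfolding A_def by measurable
  then have Ab: "A \<in> sets borel" and Ac: "A \<subseteq> torus_cell" by (auto simp: torus_def sets_restrict_space)
  have pos: "emeasure torus A \<noteq> 0"
    using neg A by (subst (asm) AE_iff_measurable[of A]) (auto simp: A_def not_le)
  \<comment> \<open>Inner regularity is a statement about measures on the Borel sets of the whole plane.\<close>
  define M where "M = distr torus borel (\<lambda>x. x)"
  have m: "(\<lambda>x. x) \<in> measurable torus borel" by (rule measurable_torus) simp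
  have eM: "emeasure M B = emeasure torus B" if "B \<in> sets borel" "B \<subseteq> torus_cell" for B
    unfolding M_def using that m by (subst emeasure_distr) (auto intro!: arg_cong[of _ _ "emeasure torus"])
  have "emeasure M (space M) \<noteq> \<infinity>"
    unfolding M_def using m by (subst emeasure_distr) (auto simp: torus.emeasure_eq_measure)
  then have "emeasure M A = (SUP K \<in> {K. K \<subseteq> A \<and> compact K}. emeasure M K)"
    using Ab by (intro inner_regular) (auto simp: M_def)
  then have "\<exists>K. K \<subseteq> A \<and> compact K \<and> emeasure M K \<noteq> 0"
    using pos eM[OF Ab Ac] by (metis (no_types, lifting) SUP_bot_conv(2) bot_ennreal mem_Collect_eq)
  then obtain K where K: "K \<subseteq> A" "compact K" "emeasure M K \<noteq> 0" by blast
  have Kc: "K \<subseteq> torus_cell" using K Ac by auto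
  have Kb: "K \<in> sets borel" using K(2) by (simp add: compact_imp_closed)
  have [measurable]: "K \<in> sets torus" using Kb Kc by (auto simp: torus_def sets_restrict_space)
  have int: "integrable torus (\<lambda>x. rep_l2 F x * indicator K x)"
    by (rule integrable_rep_times_bounded[where B=1]) (auto simp: indicator_def)
  have "(LINT x|torus. rep_l2 F x * indicator K x) = 0"
    by (rule orthogonal_compact[OF orth K(2) Kc])
  moreover have nn: "AE x in torus. 0 \<le> rep_l2 F x * indicator K x"
    using K(1) by (intro AE_I2) (auto simp: indicator_def A_def less_imp_le)
  ultimately have "AE x in torus. rep_l2 F x * indicator K x = 0"
    using integral_nonneg_eq_0_iff_AE[OF int] by simp
  then have "AE x in torus. x \<notin> K"
    by (rule eventually_mono) (use K(1) in \<open>auto simp: A_def indicator_def split: if_splits\<close>)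
  then have "emeasure torus K = 0"
    by (subst (asm) AE_iff_measurable[of K]) (use Kc in auto)
  then show False using K(3) eM[OF Kb Kc] by simp
qed

lemma hbasis_complete:
  assumes "\<And>k. F \<bullet> hbasis k = 0"
  shows "F = 0"
proof -
  have "AE x in torus. rep_l2 F x \<le> 0" by (rule orthogonal_AE_nonpos[OF assms])
  moreover have "AE x in torus. rep_l2 (- F) x \<le> 0" by (rule orthogonal_AE_nonpos) (simp add: assms)
  moreover have "AE x in torus. rep_l2 (- F) x = - rep_l2 F x"
    using rep_l2_scaleR[of "-1" F] by simp
  moreover have "AE x in torus. rep_l2 (0 :: real l2) x = 0"
    using rep_abs_l2[OF square_integrable_zero] by (simp add: abs_l2_zero)
  ultimately have "AE x in torus. rep_l2 F x = rep_l2 0 x" by eventually_elim auto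
  then show ?thesis by (rule l2_eqI)
qed

section \<open>Linear Volterra equations\<close>

text \<open>This single notion covers the semigroup (with M = 1), its approximations by finitely many modes,
  and the time-dependent magnetic perturbation. Continuity in operator norm would be false for the
  semigroup.\<close>

definition strongly_continuous_family :: "real \<Rightarrow> (real \<Rightarrow> 'a::real_normed_vector \<Rightarrow> 'b::real_normed_vector) \<Rightarrow> bool" where
  "strongly_continuous_family M U \<longleftrightarrow>
     (\<forall>t\<ge>0. linear (U t) \<and> (\<forall>x. norm (U t x) \<le> M * norm x)) \<and>
     (\<forall>x. continuous_on {0..} (\<lambda>t. U t x))"

lemma strongly_continuous_familyD:
  assumes "strongly_continuous_family M U"
  shows "t \<ge> 0 \<Longrightarrow> linear (U t)" "t \<ge> 0 \<Longrightarrow> norm (U t x) \<le> M * norm x"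
    "continuous_on {0..} (\<lambda>t. U t x)"
  using assms by (auto simp: strongly_continuous_family_def)

text \<open>The uniform bound upgrades strong continuity to joint continuity.\<close>

lemma continuous_on_family_apply:
  assumes U: "strongly_continuous_family M U"
    and f: "continuous_on A f" and g: "continuous_on A g" and nn: "\<And>z. z \<in> A \<Longrightarrow> f z \<ge> 0"
  shows "continuous_on A (\<lambda>z. U (f z) (g z))"
  unfolding continuous_on_def
proof
  fix z assume z: "z \<in> A"
  note D = strongly_continuous_familyD[OF U]
  have 1: "((\<lambda>y. U (f y) (g z)) \<longlongrightarrow> U (f z) (g z)) (at z within A)"
    using continuous_on_compose2[OF D(3) f] nn z by (auto simp: continuous_on_def)
  have 2: "((\<lambda>y. U (f y) (g y - g z)) \<longlongrightarrow> 0) (at z within A)"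
  proof (rule Lim_null_comparison)
    show "\<forall>\<^sub>F y in at z within A. norm (U (f y) (g y - g z)) \<le> M * norm (g y - g z)"
      using nn D(2) by (auto simp: eventually_at_filter)
    have "((\<lambda>y. g y - g z) \<longlongrightarrow> 0) (at z within A)"
      using g z by (simp add: continuous_on_def Lim_null[symmetric])
    then show "((\<lambda>y. M * norm (g y - g z)) \<longlongrightarrow> 0) (at z within A)"
      by (intro tendsto_mult_right_zero tendsto_norm_zero)
  qed
  have "\<forall>\<^sub>F y in at z within A. U (f y) (g z) + U (f y) (g y - g z) = U (f y) (g y)"
    using nn D(1) by (auto simp: eventually_at_filter linear_diff)
  then show "((\<lambda>y. U (f y) (g y)) \<longlongrightarrow> U (f z) (g z)) (at z within A)"
    using tendsto_add[OF 1 2] by (simp add: tendsto_cong)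
qed

lemma exp_decay_integral:
  fixes t K :: real
  assumes "t \<ge> 0" "K > 0"
  shows "((\<lambda>s. exp (- K * (t - s))) has_integral (1 - exp (- K * t)) / K) {0..t}"
proof -
  have "((\<lambda>s. exp (- K * (t - s))) has_integral (exp (- K * (t - t)) / K - exp (- K * (t - 0)) / K)) {0..t}"
    using assms by (intro fundamental_theorem_of_calculus[where f="\<lambda>s. exp (- K * (t - s)) / K"])
      (auto intro!: derivative_eq_intros simp flip: has_real_derivative_iff_has_vector_derivative)
  then show ?thesis using assms by (simp add: diff_divide_distrib)
qed

text \<open>Rescaling [0, t] to [0, 1] moves the parameter from the domain of integration to the integrand.\<close>

lemma continuous_on_moving_integral:
  fixes G :: "real \<Rightarrow> real \<Rightarrow> 'a::banach"
  assumes G: "continuous_on {(t, s). 0 \<le> s \<and> s \<le> t} (\<lambda>(t, s). G t s)"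
  shows "continuous_on {0..} (\<lambda>t. integral {0..t} (G t))"
proof -
  have ct: "continuous_on {0..t} (G t)" for t
  proof -
    have "continuous_on {0..t} (\<lambda>s. (\<lambda>(t, s). G t s) (t, s))"
      by (rule continuous_on_compose2[OF G]) (auto intro!: continuous_intros)
    then show ?thesis by simp
  qed
  have e: "integral {0..t} (G t) = t *\<^sub>R integral (cbox 0 1) (\<lambda>r. G t (t * r))" if "t \<ge> 0" for t
  proof (cases "t = 0")
    case False
    then have t: "t > 0" using that by simp
    have "(G t has_integral integral {0..t} (G t)) {0..t}"
      using ct by (intro integrable_integral integrable_continuous_interval)
    from has_integral_stretch_real[OF this, of t] t
    have "((\<lambda>r. G t (t * r)) has_integral (1 / t) *\<^sub>R integral {0..t} (G t)) {0..1}"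
      by (simp add: image_divide_atLeastAtMost)
    then show ?thesis using t by (simp add: integral_unique)
  qed simp
  have "continuous_on {0..} (\<lambda>t. integral (cbox 0 1) (\<lambda>r. G t (t * r)))"
  proof (rule integral_continuous_on_param)
    have "continuous_on ({0..} \<times> cbox 0 1) (\<lambda>z. (\<lambda>(t, s). G t s) (fst z, fst z * snd z))"
      by (rule continuous_on_compose2[OF G])
        (auto intro!: continuous_intros simp: mult_left_le)
    then show "continuous_on ({0..} \<times> cbox 0 1) (\<lambda>(t, r). G t (t * r))"
      by (simp add: case_prod_beta')
  qed
  then have "continuous_on {0..} (\<lambda>t. t *\<^sub>R integral (cbox 0 1) (\<lambda>r. G t (t * r)))"
    by (intro continuous_intros)
  then show ?thesis by (rule continuous_on_eq) (simp add: e)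
qed

text \<open>For the weighted function W(t) = exp (- K t) Z(t) the integral operator carries the factor
  exp (- K (t - s)), whose integral is at most 1 / K. With K = 2 M + 1 its Lipschitz constant M / K is
  below 1 / 2, so Banach's fixed point theorem gives a bounded continuous W. The contraction estimate
  also bounds W by twice the data, which is the growth bound for Z; it is this bound that later
  compares exact with approximate solutions.\<close>

theorem Volterra_solution:
  fixes S B :: "real \<Rightarrow> 'a::banach \<Rightarrow> 'a"
  assumes S: "strongly_continuous_family 1 S" and B: "strongly_continuous_family M B" and M: "M \<ge> 0"
    and \<rho>: "continuous_on {0..} \<rho>" "\<And>t. t \<ge> 0 \<Longrightarrow> norm (\<rho> t) \<le> R"
  shows "\<exists>Z. continuous_on {0..} Z \<and>
    (\<forall>t\<ge>0. ((\<lambda>s. S (t - s) (B s (Z s) + \<rho> s)) has_integral (Z t - S t z0)) {0..t}) \<and>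
    (\<forall>t\<ge>0. norm (Z t) \<le> 2 * (norm z0 + R) * exp ((2 * M + 1) * t))"
proof -
  note SD = strongly_continuous_familyD[OF S] and BD = strongly_continuous_familyD[OF B]
  have R: "R \<ge> 0" using \<rho>(2)[of 0] norm_ge_zero order_trans by blast
  \<comment> \<open>The summand 1 makes K at least 1, so that the forcing is also divided by at least 1.\<close>
  define K where "K = 2 * M + 1"
  have K: "K \<ge> 1" using M by (simp add: K_def)
  define G where "G W t s = exp (- K * (t - s)) *\<^sub>R S (t - s) (B s (W s) + exp (- K * s) *\<^sub>R \<rho> s)" for W t s
  define J where "J W t = exp (- K * t) *\<^sub>R S t z0 + integral {0..t} (G W t)" for W t
  have v: "continuous_on {0..} (\<lambda>s. B s (W s) + exp (- K * s) *\<^sub>R \<rho> s)"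
    if "continuous_on {0..} W" for W
    using \<rho>(1) that by (intro continuous_intros continuous_on_family_apply[OF B]) auto
  have G: "continuous_on {(t, s). 0 \<le> s \<and> s \<le> t} (\<lambda>(t, s). G W t s)"
    if W: "continuous_on {0..} W" for W
  proof -
    have "continuous_on {(t, s). 0 \<le> s \<and> s \<le> t}
       (\<lambda>z. exp (- K * (fst z - snd z)) *\<^sub>R S (fst z - snd z) (B (snd z) (W (snd z)) + exp (- K * snd z) *\<^sub>R \<rho> (snd z)))"
      by (intro continuous_intros continuous_on_family_apply[OF S] continuous_on_compose2[OF v[OF W]]) auto
    then show ?thesis by (simp add: G_def case_prod_beta')
  qed
  have Gt: "continuous_on {0..t} (G W t)" if "continuous_on {0..} W" for W t
  proof -
    have "continuous_on {0..t} (\<lambda>s. (\<lambda>(t, s). G W t s) (t, s))"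
      by (rule continuous_on_compose2[OF G[OF that]]) (auto intro!: continuous_intros)
    then show ?thesis by simp
  qed
  have J_cont: "continuous_on {0..} (J W)" if "continuous_on {0..} W" for W
    unfolding J_def
    by (intro continuous_intros continuous_on_moving_integral G that SD(3))
  have decay: "norm (integral {0..t} f) \<le> c / K"
    if t: "t \<ge> 0" and f: "continuous_on {0..t} f" and c: "c \<ge> 0"
      and le: "\<And>s. s \<in> {0..t} \<Longrightarrow> norm (f s) \<le> exp (- K * (t - s)) * c" for t c and f :: "real \<Rightarrow> 'a"
  proof -
    have I: "((\<lambda>s. exp (- K * (t - s)) * c) has_integral (1 - exp (- K * t)) / K * c) {0..t}"
      using exp_decay_integral[OF t] K by (intro has_integral_mult_left) auto
    have "norm (integral {0..t} f) \<le> integral {0..t} (\<lambda>s. exp (- K * (t - s)) * c)"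
      by (rule integral_norm_bound_integral[OF integrable_continuous_interval[OF f] has_integral_integrable[OF I] le])
    also have "\<dots> = (1 - exp (- K * t)) / K * c" using I by (rule integral_unique)
    also have "\<dots> \<le> 1 / K * c" using K c by (intro mult_right_mono divide_right_mono) auto
    finally show ?thesis by simp
  qed
  have J_bound: "norm (J W t) \<le> norm z0 + (M * w + R) / K"
    if t: "t \<ge> 0" and W: "continuous_on {0..} W" and w: "\<And>s. s \<ge> 0 \<Longrightarrow> norm (W s) \<le> w" for W w t
  proof -
    have w0: "w \<ge> 0" using w[of 0] norm_ge_zero order_trans by blast
    have "norm (integral {0..t} (G W t)) \<le> (M * w + R) / K"
    proof (rule decay[OF t Gt[OF W]])
      show "0 \<le> M * w + R" using M w0 R by simp
      fix s assume s: "s \<in> {0..t}"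
      have "norm (S (t - s) (B s (W s) + exp (- K * s) *\<^sub>R \<rho> s)) \<le> norm (B s (W s) + exp (- K * s) *\<^sub>R \<rho> s)"
        using SD(2)[of "t - s"] s by simp
      also have "\<dots> \<le> norm (B s (W s)) + exp (- K * s) * norm (\<rho> s)"
        using norm_triangle_ineq[of "B s (W s)" "exp (- K * s) *\<^sub>R \<rho> s"] by simp
      also have "\<dots> \<le> M * w + 1 * R"
      proof (intro add_mono mult_mono)
        show "norm (B s (W s)) \<le> M * w"
          using BD(2)[of s "W s"] mult_left_mono[OF w[of s] M] s by simp
      qed (use s K R \<rho>(2) in auto)
      finally show "norm (G W t s) \<le> exp (- K * (t - s)) * (M * w + R)"
        unfolding G_def by simp
    qed
    moreover have "norm (exp (- K * t) *\<^sub>R S t z0) \<le> 1 * norm z0"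
      using SD(2)[OF t, of z0] t K unfolding norm_scaleR by (intro mult_mono) auto
    ultimately show ?thesis unfolding J_def using norm_triangle_ineq[of "exp (- K * t) *\<^sub>R S t z0" "integral {0..t} (G W t)"] by simp
  qed
  have J_diff: "norm (J W t - J W' t) \<le> M * w / K"
    if t: "t \<ge> 0" and W: "continuous_on {0..} W" "continuous_on {0..} W'"
      and w: "\<And>s. s \<ge> 0 \<Longrightarrow> norm (W s - W' s) \<le> w" for W W' w t
  proof -
    have w0: "w \<ge> 0" using w[of 0] norm_ge_zero order_trans by blast
    have "J W t - J W' t = integral {0..t} (\<lambda>s. G W t s - G W' t s)"
      unfolding J_def using Gt W by (subst Henstock_Kurzweil_Integration.integral_diff) (auto intro: integrable_continuous_interval)
    also have "norm \<dots> \<le> M * w / K"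
    proof (rule decay[OF t])
      show "continuous_on {0..t} (\<lambda>s. G W t s - G W' t s)" using Gt W by (intro continuous_intros) auto
      show "0 \<le> M * w" using M w0 by simp
      fix s assume s: "s \<in> {0..t}"
      have ls: "linear (S (t - s))" "linear (B s)" using SD(1) BD(1) s by auto
      have "G W t s - G W' t s = exp (- K * (t - s)) *\<^sub>R S (t - s) (B s (W s - W' s))"
        unfolding G_def by (simp add: linear_diff[OF ls(1), symmetric] linear_diff[OF ls(2)] scaleR_diff_right[symmetric])
      moreover have "norm (S (t - s) (B s (W s - W' s))) \<le> M * w"
      proof -
        have "norm (S (t - s) (B s (W s - W' s))) \<le> norm (B s (W s - W' s))"
          using SD(2)[of "t - s"] s by simp
        also have "\<dots> \<le> M * norm (W s - W' s)" using BD(2) s by simp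
        also have "\<dots> \<le> M * w" using w M s by (intro mult_left_mono) auto
        finally show ?thesis .
      qed
      ultimately show "norm (G W t s - G W' t s) \<le> exp (- K * (t - s)) * (M * w)" by simp
    qed
    finally show ?thesis .
  qed
  \<comment> \<open>Functions on the half line are extended to negative times by their value at 0.\<close>
  define \<Phi> where "\<Phi> W = Bcontfun (\<lambda>t. J (apply_bcontfun W) (max 0 t))" for W :: "real \<Rightarrow>\<^sub>C 'a"
  have ap: "apply_bcontfun (\<Phi> W) t = J (apply_bcontfun W) (max 0 t)" for W t
  proof -
    have "(\<lambda>t. J (apply_bcontfun W) (max 0 t)) \<in> bcontfun"
    proof (rule bcontfun_normI)
      show "continuous_on UNIV (\<lambda>t. J (apply_bcontfun W) (max 0 t))"
        by (rule continuous_on_compose2[OF J_cont]) (auto intro!: continuous_intros)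
      show "norm (J (apply_bcontfun W) (max 0 t)) \<le> norm z0 + (M * norm W + R) / K" for t
        by (rule J_bound) (auto intro: norm_bounded)
    qed
    then show ?thesis by (simp add: \<Phi>_def Bcontfun_inverse)
  qed
  have "\<exists>!W. \<Phi> W = W"
  proof (rule banach_fix_type)
    show "0 \<le> M / K" "M / K < 1" using M K by (auto simp: K_def field_simps)
    show "\<forall>W W'. dist (\<Phi> W) (\<Phi> W') \<le> M / K * dist W W'"
    proof (intro allI dist_bound)
      fix W W' t
      show "dist (apply_bcontfun (\<Phi> W) t) (apply_bcontfun (\<Phi> W') t) \<le> M / K * dist W W'"
        unfolding ap dist_norm
        using J_diff[of "max 0 t" "apply_bcontfun W" "apply_bcontfun W'" "norm (W - W')"] dist_bounded[of W _ W']
        by (simp add: dist_norm)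
    qed
  qed
  then obtain W where W: "\<Phi> W = W" by blast
  define w where "w = apply_bcontfun W"
  have cw: "continuous_on {0..} w" by (simp add: w_def)
  have fix_eq: "w t = J w t" if "t \<ge> 0" for t
    using ap[of W t] that by (simp add: W w_def max_def)
  define Z where "Z t = exp (K * t) *\<^sub>R w t" for t
  have wZ: "w t = exp (- K * t) *\<^sub>R Z t" for t by (simp add: Z_def exp_minus)
  have "norm W \<le> norm z0 + (M * norm W + R) / K"
  proof (rule norm_bound)
    fix t
    show "norm (apply_bcontfun W t) \<le> norm z0 + (M * norm W + R) / K"
      using ap[of W t] J_bound[of "max 0 t" "apply_bcontfun W" "norm W"] norm_bounded[of W] by (simp add: W)
  qed
  moreover have "(M * norm W + R) / K \<le> norm W / 2 + R"
  proof -
    have "M * norm W + R \<le> (norm W / 2 + R) * K"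
      using M R mult_nonneg_nonneg[of M R] norm_ge_zero[of W] by (simp add: K_def algebra_simps)
    then show ?thesis using K by (simp add: pos_divide_le_eq)
  qed
  ultimately have nW: "norm W \<le> 2 * (norm z0 + R)" by simp
  show ?thesis
  proof (intro exI[of _ Z] conjI allI impI)
    show "continuous_on {0..} Z" unfolding Z_def by (intro continuous_intros cw)
    fix t :: real assume t: "t \<ge> 0"
    have "norm (w t) \<le> 2 * (norm z0 + R)" using norm_bounded[of W t] nW by (simp add: w_def)
    then show "norm (Z t) \<le> 2 * (norm z0 + R) * exp ((2 * M + 1) * t)"
      unfolding Z_def K_def[symmetric] by (simp add: mult.commute)
    have "(G w t has_integral integral {0..t} (G w t)) {0..t}"
      using Gt[OF cw] by (intro integrable_integral integrable_continuous_interval)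
    then have "((\<lambda>s. exp (K * t) *\<^sub>R G w t s) has_integral exp (K * t) *\<^sub>R integral {0..t} (G w t)) {0..t}"
      by (rule has_integral_cmul)
    moreover have "exp (K * t) *\<^sub>R integral {0..t} (G w t) = Z t - S t z0"
      unfolding Z_def fix_eq[OF t] J_def by (simp add: scaleR_add_right exp_minus)
    ultimately have I: "((\<lambda>s. exp (K * t) *\<^sub>R G w t s) has_integral (Z t - S t z0)) {0..t}"
      by (simp only:)
    have e: "exp (K * t) *\<^sub>R G w t s = S (t - s) (B s (Z s) + \<rho> s)" if s: "s \<in> {0..t}" for s
    proof -
      have ls: "linear (S (t - s))" "linear (B s)" using SD(1) BD(1) s by auto
      have "B s (w s) + exp (- K * s) *\<^sub>R \<rho> s = exp (- K * s) *\<^sub>R (B s (Z s) + \<rho> s)"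
        unfolding wZ linear_cmul[OF ls(2)] by (simp add: scaleR_add_right)
      then have "exp (K * t) *\<^sub>R G w t s = (exp (K * t) * exp (- K * (t - s)) * exp (- K * s)) *\<^sub>R S (t - s) (B s (Z s) + \<rho> s)"
        unfolding G_def by (simp add: linear_cmul[OF ls(1)])
      also have "exp (K * t) * exp (- K * (t - s)) * exp (- K * s) = 1"
        by (simp add: exp_add[symmetric] algebra_simps)
      finally show ?thesis by simp
    qed
    show "((\<lambda>s. S (t - s) (B s (Z s) + \<rho> s)) has_integral (Z t - S t z0)) {0..t}"
      by (rule has_integral_eq[OF e I])
  qed
qed

section \<open>Flows of bounded dissipative operators\<close>

text \<open>The derivative of the square of the norm is 2 B Z \<bullet> Z.\<close>

lemma dissipative_decay:
  fixes Z :: "real \<Rightarrow> 'a::real_inner"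
  assumes Z: "\<And>t. t \<ge> 0 \<Longrightarrow> (Z has_vector_derivative B (Z t)) (at t within {0..})"
    and diss: "\<And>x. B x \<bullet> x \<le> 0" and t: "t \<ge> 0"
  shows "norm (Z t) \<le> norm (Z 0)"
proof -
  have "Z t \<bullet> Z t \<le> Z 0 \<bullet> Z 0"
  proof (rule DERIV_nonpos_imp_decreasing_open[OF t])
    fix s assume s: "0 < s" "s < t"
    have "(Z has_vector_derivative B (Z s)) (at s)"
    proof -
      have "at s within {0..} = at s"
        by (rule at_within_interior) (use s in \<open>simp add: interior_real_atLeast\<close>)
      then show ?thesis using Z[of s] s by simp
    qed
    then have "(Z has_derivative (\<lambda>h. h *\<^sub>R B (Z s))) (at s)" by (simp add: has_vector_derivative_def)
    from has_derivative_inner[OF this this]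
    have "((\<lambda>s. Z s \<bullet> Z s) has_real_derivative 2 * (B (Z s) \<bullet> Z s)) (at s)"
      unfolding has_field_derivative_def
      by (rule has_derivative_eq_rhs) (simp add: fun_eq_iff inner_commute)
    then show "\<exists>y. ((\<lambda>s. Z s \<bullet> Z s) has_real_derivative y) (at s) \<and> y \<le> 0"
      using diss[of "Z s"] by (intro exI[of _ "2 * (B (Z s) \<bullet> Z s)"]) auto
  next
    have "continuous_on {0..} Z"
      using Z by (auto simp: continuous_on_eq_continuous_within intro: has_vector_derivative_continuous)
    then have "continuous_on {0..t} Z" by (rule continuous_on_subset) auto
    then show "continuous_on {0..t} (\<lambda>s. Z s \<bullet> Z s)" by (intro continuous_intros)
  qed
  then show ?thesis by (simp add: norm_eq_sqrt_inner)
qed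

lemma dissipative_unique:
  fixes Z Z' :: "real \<Rightarrow> 'a::real_inner"
  assumes "linear B" "\<And>x. B x \<bullet> x \<le> 0"
    and Z: "\<And>t. t \<ge> 0 \<Longrightarrow> (Z has_vector_derivative B (Z t)) (at t within {0..})"
    and Z': "\<And>t. t \<ge> 0 \<Longrightarrow> (Z' has_vector_derivative B (Z' t)) (at t within {0..})"
    and "Z 0 = Z' 0" "t \<ge> 0"
  shows "Z t = Z' t"
proof -
  have "norm (Z t - Z' t) \<le> norm (Z 0 - Z' 0)"
  proof (rule dissipative_decay[where Z="\<lambda>t. Z t - Z' t" and B=B])
    show "((\<lambda>t. Z t - Z' t) has_vector_derivative B (Z s - Z' s)) (at s within {0..})" if "s \<ge> 0" for s
      using has_vector_derivative_diff[OF Z[OF that] Z'[OF that]] by (simp add: linear_diff[OF assms(1)])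
  qed (use assms in auto)
  then show ?thesis using assms(5) by simp
qed

text \<open>The Volterra equation in which the semigroup is the identity is the integrated form of Z' = B Z.\<close>

lemma dissipative_flow_exists:
  fixes B :: "'a::{real_inner,banach} \<Rightarrow> 'a"
  assumes B: "bounded_linear B"
  shows "\<exists>Z. Z 0 = z0 \<and> (\<forall>t\<ge>0. (Z has_vector_derivative B (Z t)) (at t within {0..}))"
proof -
  obtain M where M: "M \<ge> 0" "\<And>x. norm (B x) \<le> norm x * M"
    using bounded_linear.nonneg_bounded[OF B] by blast
  have l: "linear B" using B by (rule bounded_linear.linear)
  have "strongly_continuous_family 1 (\<lambda>t (x::'a). x)"
    by (simp add: strongly_continuous_family_def linear_ident)
  moreover have "strongly_continuous_family M (\<lambda>t. B)"
    using l M(2) by (simp add: strongly_continuous_family_def mult.commute)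
  ultimately have "\<exists>Z. continuous_on {0..} Z \<and>
      (\<forall>t\<ge>0. ((\<lambda>s. B (Z s) + 0) has_integral (Z t - z0)) {0..t}) \<and>
      (\<forall>t\<ge>0. norm (Z t) \<le> 2 * (norm z0 + 0) * exp ((2 * M + 1) * t))"
    using M(1) by (intro Volterra_solution[of "\<lambda>t x. x" M "\<lambda>t. B" "\<lambda>_. 0" 0 z0]) simp_all
  then obtain Z where ZI: "continuous_on {0..} Z \<and>
      (\<forall>t\<ge>0. ((\<lambda>s. B (Z s) + 0) has_integral (Z t - z0)) {0..t}) \<and>
      (\<forall>t\<ge>0. norm (Z t) \<le> 2 * (norm z0 + 0) * exp ((2 * M + 1) * t))"
    by (rule exE)
  note Z = conjunct1[OF ZI] and I = conjunct1[OF conjunct2[OF ZI]]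
  have Zt: "Z t = z0 + integral {0..t} (\<lambda>s. B (Z s))" if "t \<ge> 0" for t
    using integral_unique[OF I[rule_format, OF that]] by simp
  have "(Z has_vector_derivative B (Z t)) (at t within {0..})" if t: "t \<ge> 0" for t
  proof -
    have "continuous_on {0..t + 1} (\<lambda>s. B (Z s))"
      by (intro bounded_linear.continuous_on[OF B] continuous_on_subset[OF Z]) auto
    then have "((\<lambda>u. integral {0..u} (\<lambda>s. B (Z s))) has_vector_derivative B (Z t)) (at t within {0..t + 1})"
      using t by (intro integral_has_vector_derivative) auto
    then have "((\<lambda>u. z0 + integral {0..u} (\<lambda>s. B (Z s))) has_vector_derivative 0 + B (Z t)) (at t within {0..t + 1})"
      by (intro has_vector_derivative_add has_vector_derivative_const)
    then have "(Z has_vector_derivative 0 + B (Z t)) (at t within {0..t + 1})"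
      by (rule has_vector_derivative_transform[rotated 2]) (use t Zt in auto)
    moreover have "at t within {0..t + 1} = at t within {0..}"
      using t by (intro at_within_nhd[where S="{..<t + 1}"]) auto
    ultimately show ?thesis by simp
  qed
  moreover have "Z 0 = z0" using Zt[of 0] by simp
  ultimately show ?thesis by blast
qed

text \<open>A product rule for a family that is only strongly differentiable. The increment is split into
  U (t - y) (z y - z s) and the increment of U (t - y) (z s): in the first term the uniform bound
  replaces norm continuity, and the second term is differentiated with a fixed argument.\<close>

lemma has_vector_derivative_family_apply:
  fixes U :: "real \<Rightarrow> 'a::real_normed_vector \<Rightarrow> 'a"
  assumes U: "strongly_continuous_family M U"
    and dU: "\<And>t x. t \<ge> 0 \<Longrightarrow> ((\<lambda>t. U t x) has_vector_derivative B (U t x)) (at t within {0..})"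
    and z: "(z has_vector_derivative z') (at s within {0..t})" and s: "s \<in> {0..t}"
  shows "((\<lambda>s. U (t - s) (z s)) has_vector_derivative U (t - s) z' - B (U (t - s) (z s))) (at s within {0..t})"
proof -
  note D = strongly_continuous_familyD[OF U]
  let ?F = "at s within {0..t}"
  have q: "((\<lambda>y. (1 / (y - s)) *\<^sub>R (z y - z s)) \<longlongrightarrow> z') ?F"
  proof -
    have "((\<lambda>y. norm ((z y - z s) - (y - s) *\<^sub>R z') / norm (y - s)) \<longlongrightarrow> 0) ?F"
      using z unfolding has_vector_derivative_def has_derivative_iff_norm by simp
    moreover have "\<forall>\<^sub>F y in ?F. norm ((z y - z s) - (y - s) *\<^sub>R z') / norm (y - s)
        = norm ((1 / (y - s)) *\<^sub>R (z y - z s) - z')"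
    proof (rule eventually_at_filter[THEN iffD2], intro always_eventually allI impI)
      fix y assume "y \<noteq> s"
      then have "(1 / (y - s)) *\<^sub>R (z y - z s) - z' = (1 / (y - s)) *\<^sub>R ((z y - z s) - (y - s) *\<^sub>R z')"
        by (simp add: scaleR_diff_right)
      then show "norm ((z y - z s) - (y - s) *\<^sub>R z') / norm (y - s)
        = norm ((1 / (y - s)) *\<^sub>R (z y - z s) - z')" by simp
    qed
    ultimately have "((\<lambda>y. norm ((1 / (y - s)) *\<^sub>R (z y - z s) - z')) \<longlongrightarrow> 0) ?F"
      by (simp add: tendsto_cong)
    then show ?thesis by (simp add: tendsto_norm_zero_iff Lim_null[of _ z'])
  qed
  have cU: "((\<lambda>y. U (t - y) x) \<longlongrightarrow> U (t - s) x) ?F" for x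
  proof -
    have "continuous_on {0..t} (\<lambda>y. U (t - y) x)"
      by (rule continuous_on_compose2[OF D(3)]) (auto intro!: continuous_intros)
    then show ?thesis using s by (simp add: continuous_on_def)
  qed
  have mem: "\<forall>\<^sub>F y in ?F. y \<in> {0..t}" by (simp add: eventually_at_filter)
  have "((\<lambda>y. U (t - y) ((1 / (y - s)) *\<^sub>R (z y - z s) - z')) \<longlongrightarrow> 0) ?F"
  proof (rule Lim_null_comparison)
    show "\<forall>\<^sub>F y in ?F. norm (U (t - y) ((1 / (y - s)) *\<^sub>R (z y - z s) - z')) \<le> M * norm ((1 / (y - s)) *\<^sub>R (z y - z s) - z')"
      using mem by eventually_elim (auto intro: D(2))
    show "((\<lambda>y. M * norm ((1 / (y - s)) *\<^sub>R (z y - z s) - z')) \<longlongrightarrow> 0) ?F"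
      using q by (intro tendsto_mult_right_zero tendsto_norm_zero) (simp add: Lim_null[symmetric])
  qed
  moreover have "((\<lambda>y. U (t - y) z' - U (t - s) z') \<longlongrightarrow> 0) ?F"
    using cU[of z'] by (simp add: Lim_null[symmetric])
  ultimately have lim: "((\<lambda>y. norm (U (t - y) ((1 / (y - s)) *\<^sub>R (z y - z s) - z') + (U (t - y) z' - U (t - s) z'))) \<longlongrightarrow> 0) ?F"
    by (intro tendsto_norm_zero) (use tendsto_add in fastforce)
  have first: "((\<lambda>y. U (t - y) (z y - z s)) has_vector_derivative U (t - s) z') ?F"
    unfolding has_vector_derivative_def has_derivative_iff_norm
  proof (intro conjI)
    show "bounded_linear (\<lambda>x. x *\<^sub>R U (t - s) z')" by (rule bounded_linear_scaleR_left)
    have l: "linear (U (t - y))" if "y \<in> {0..t}" for y using D(1) that by auto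
    have 0: "U (t - s) (z s - z s) = 0" using l[OF s] by (simp add: linear_0)
    have "\<forall>\<^sub>F y in ?F. norm (U (t - y) ((1 / (y - s)) *\<^sub>R (z y - z s) - z') + (U (t - y) z' - U (t - s) z'))
       = norm (U (t - y) (z y - z s) - U (t - s) (z s - z s) - (y - s) *\<^sub>R U (t - s) z') / norm (y - s)"
      unfolding eventually_at_filter
    proof (intro always_eventually allI impI)
      fix y assume y: "y \<noteq> s" "y \<in> {0..t}"
      have "U (t - y) ((1 / (y - s)) *\<^sub>R (z y - z s) - z') + (U (t - y) z' - U (t - s) z')
        = (1 / (y - s)) *\<^sub>R (U (t - y) (z y - z s) - (y - s) *\<^sub>R U (t - s) z')"
        using y by (simp add: linear_diff[OF l] linear_cmul[OF l] scaleR_diff_right)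
      then show "norm (U (t - y) ((1 / (y - s)) *\<^sub>R (z y - z s) - z') + (U (t - y) z' - U (t - s) z'))
       = norm (U (t - y) (z y - z s) - U (t - s) (z s - z s) - (y - s) *\<^sub>R U (t - s) z') / norm (y - s)"
        unfolding 0 by simp
    qed
    then show "((\<lambda>y. norm (U (t - y) (z y - z s) - U (t - s) (z s - z s) - (y - s) *\<^sub>R U (t - s) z') / norm (y - s)) \<longlongrightarrow> 0) ?F"
      using lim by (simp add: tendsto_cong)
  qed
  have second: "((\<lambda>y. U (t - y) (z s)) has_vector_derivative - B (U (t - s) (z s))) ?F"
  proof -
    have "((\<lambda>y. t - y) has_vector_derivative - 1) ?F"
      by (auto intro!: derivative_eq_intros)
    moreover have "((\<lambda>\<tau>. U \<tau> (z s)) has_vector_derivative B (U (t - s) (z s))) (at (t - s) within (\<lambda>y. t - y) ` {0..t})"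
      by (rule has_vector_derivative_within_subset[OF dU]) (use s in auto)
    ultimately have "(((\<lambda>\<tau>. U \<tau> (z s)) \<circ> (\<lambda>y. t - y)) has_vector_derivative (- 1) *\<^sub>R B (U (t - s) (z s))) ?F"
      by (rule vector_diff_chain_within)
    then show ?thesis by (simp add: o_def)
  qed
  have "((\<lambda>y. U (t - y) (z y - z s) + U (t - y) (z s)) has_vector_derivative U (t - s) z' + - B (U (t - s) (z s))) ?F"
    by (intro has_vector_derivative_add first second)
  then have "((\<lambda>y. U (t - y) (z y - z s) + U (t - y) (z s)) has_vector_derivative U (t - s) z' - B (U (t - s) (z s))) ?F"
    by simp
  then show ?thesis
    by (rule has_vector_derivative_transform[OF s, rotated])
      (use D(1) in \<open>auto simp: linear_diff\<close>)
qed

section \<open>Semigroups from spectral truncations\<close>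

text \<open>P N projects onto finitely many modes and A N is a dissipative operator truncated to them, so A N
  is bounded and commutes with the projections. The unbounded operator that is approximated never
  occurs as a function: its graph is {(x, y). \<forall>N. P N y = A N x}. In this way statements about an
  unbounded operator become statements about a compatible sequence of bounded ones.\<close>

locale spectral_generator =
  fixes P A :: "nat \<Rightarrow> 'a::{real_inner,banach} \<Rightarrow> 'a"
  assumes P_linear: "linear (P N)" and P_le: "norm (P N x) \<le> norm x"
    and P_tendsto: "(\<lambda>N. P N x) \<longlonglongrightarrow> x" and P_P: "P M (P N x) = P (min M N) x"
    and A_linear: "bounded_linear (A N)" and A_dissipative: "A N x \<bullet> x \<le> 0"
    and P_A: "P M (A N x) = A (min M N) x" and A_P: "A N (P M x) = A (min M N) x"
begin

lemma P_bounded_linear: "bounded_linear (P N)"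
  using P_linear P_le by (intro bounded_linear.intro bounded_linear_axioms.intro exI[of _ 1]) auto

lemma A_lin: "linear (A N)" by (rule bounded_linear.linear[OF A_linear])

lemma P_eqI: "(\<And>N. P N x = P N y) \<Longrightarrow> x = y"
  using LIMSEQ_unique[OF P_tendsto[of x]] P_tendsto[of y] by simp

text \<open>The exponential of t A_N, obtained as a solution of the linear equation instead of as a power
  series.\<close>

definition mode_flow :: "nat \<Rightarrow> real \<Rightarrow> 'a \<Rightarrow> 'a" where
  "mode_flow N t x = (SOME Z. Z 0 = x \<and> (\<forall>t\<ge>0. (Z has_vector_derivative A N (Z t)) (at t within {0..}))) t"

lemma mode_flow:
  "mode_flow N 0 x = x"
  "t \<ge> 0 \<Longrightarrow> ((\<lambda>t. mode_flow N t x) has_vector_derivative A N (mode_flow N t x)) (at t within {0..})"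
proof -
  have "\<exists>Z. Z 0 = x \<and> (\<forall>t\<ge>0. (Z has_vector_derivative A N (Z t)) (at t within {0..}))"
    by (rule dissipative_flow_exists[OF A_linear])
  from someI_ex[OF this]
  show "mode_flow N 0 x = x"
    "t \<ge> 0 \<Longrightarrow> ((\<lambda>t. mode_flow N t x) has_vector_derivative A N (mode_flow N t x)) (at t within {0..})"
    unfolding mode_flow_def by (auto simp: eta_contract_eq)
qed

lemma mode_flow_unique:
  assumes "\<And>t. t \<ge> 0 \<Longrightarrow> (Z has_vector_derivative A N (Z t)) (at t within {0..})" "Z 0 = x" "t \<ge> 0"
  shows "mode_flow N t x = Z t"
  by (rule dissipative_unique[OF A_lin A_dissipative mode_flow(2) assms(1)])
    (use assms(2,3) in \<open>auto simp: mode_flow(1)\<close>)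

lemma mode_flow_contraction: "t \<ge> 0 \<Longrightarrow> norm (mode_flow N t x) \<le> norm x"
  using dissipative_decay[where Z="\<lambda>t. mode_flow N t x" and B="A N", OF mode_flow(2) A_dissipative]
  by (simp add: mode_flow(1))

text \<open>L maps solutions of the equation with A N to solutions of the equation with A M, and solutions are
  unique.\<close>

lemma mode_flow_commute:
  assumes L: "bounded_linear L" and c: "\<And>x. L (A N x) = A M (L x)" and t: "t \<ge> 0"
  shows "mode_flow M t (L x) = L (mode_flow N t x)"
proof (rule mode_flow_unique[OF _ _ t])
  fix s :: real assume "s \<ge> 0"
  from bounded_linear.has_vector_derivative[OF L mode_flow(2)[OF this, of N x]]
  show "((\<lambda>t. L (mode_flow N t x)) has_vector_derivative A M (L (mode_flow N s x))) (at s within {0..})"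
    by (simp add: c)
qed (simp add: mode_flow(1))

lemma mode_flow_linear:
  assumes t: "t \<ge> 0"
  shows "linear (mode_flow N t)"
proof (rule linearI)
  show "mode_flow N t (x + y) = mode_flow N t x + mode_flow N t y" for x y
  proof (rule mode_flow_unique[OF _ _ t])
    show "((\<lambda>t. mode_flow N t x + mode_flow N t y) has_vector_derivative A N (mode_flow N s x + mode_flow N s y)) (at s within {0..})"
      if "s \<ge> 0" for s
      unfolding linear_add[OF A_lin] by (intro has_vector_derivative_add mode_flow(2) that)
  qed (simp add: mode_flow(1))
  show "mode_flow N t (c *\<^sub>R x) = c *\<^sub>R mode_flow N t x" for c x
    by (rule mode_flow_commute[OF bounded_linear_scaleR_right _ t]) (simp add: linear_cmul[OF A_lin])
qed

lemma mode_flow_continuous: "continuous_on {0..} (\<lambda>t. mode_flow N t x)"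
  unfolding continuous_on_eq_continuous_within
  using mode_flow(2) by (auto intro: has_vector_derivative_continuous)

lemma mode_flow_family: "strongly_continuous_family 1 (mode_flow N)"
  using mode_flow_linear mode_flow_contraction mode_flow_continuous
  by (simp add: strongly_continuous_family_def)

lemma mode_flow_A: "t \<ge> 0 \<Longrightarrow> mode_flow N t (A N x) = A N (mode_flow N t x)"
  by (rule mode_flow_commute[OF A_linear]) simp_all

lemma mode_flow_P: "t \<ge> 0 \<Longrightarrow> mode_flow N t (P M x) = P M (mode_flow N t x)"
  by (rule mode_flow_commute[OF P_bounded_linear]) (simp_all add: P_A A_P min.commute)

lemma mode_flow_add:
  assumes s: "s \<ge> 0" and t: "t \<ge> 0"
  shows "mode_flow N (s + t) x = mode_flow N s (mode_flow N t x)"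
proof (rule mode_flow_unique[OF _ _ s, symmetric])
  fix r :: real assume r: "r \<ge> 0"
  have "((\<lambda>s. s + t) has_vector_derivative 1) (at r within {0..})"
    by (auto intro!: derivative_eq_intros)
  moreover have "((\<lambda>t. mode_flow N t x) has_vector_derivative A N (mode_flow N (r + t) x)) (at (r + t) within (\<lambda>s. s + t) ` {0..})"
    by (rule has_vector_derivative_within_subset[OF mode_flow(2)]) (use r t in auto)
  ultimately have "(((\<lambda>t. mode_flow N t x) \<circ> (\<lambda>s. s + t)) has_vector_derivative 1 *\<^sub>R A N (mode_flow N (r + t) x)) (at r within {0..})"
    by (rule vector_diff_chain_within)
  then show "((\<lambda>s. mode_flow N (s + t) x) has_vector_derivative A N (mode_flow N (r + t) x)) (at r within {0..})"
    by (simp add: o_def)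
qed simp

text \<open>All truncations of order at least M act alike on the range of P M.\<close>

lemma mode_flow_stable:
  assumes "M \<le> N" and t: "t \<ge> 0"
  shows "mode_flow N t (P M x) = mode_flow M t (P M x)"
proof (rule mode_flow_unique[OF _ _ t])
  fix s :: real assume s: "s \<ge> 0"
  have "A N (mode_flow M s (P M x)) = A M (mode_flow M s (P M x))"
    using assms(1) A_P[of N M] by (simp add: mode_flow_P[OF s] A_P)
  then show "((\<lambda>t. mode_flow M t (P M x)) has_vector_derivative A N (mode_flow M s (P M x))) (at s within {0..})"
    using mode_flow(2)[OF s] by simp
qed (simp add: mode_flow(1))

definition evolution :: "real \<Rightarrow> 'a \<Rightarrow> 'a" where
  "evolution t x = lim (\<lambda>N. mode_flow N t x)"

text \<open>On states with finitely many modes the sequence is eventually constant; such states are dense, and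
  the flows are contractions.\<close>

lemma evolution_tendsto:
  assumes t: "t \<ge> 0"
  shows "(\<lambda>N. mode_flow N t x) \<longlonglongrightarrow> evolution t x"
proof -
  have "Cauchy (\<lambda>N. mode_flow N t x)"
  proof (rule metric_CauchyI)
    fix e :: real assume e: "e > 0"
    then obtain M where "dist (P M x) x < e / 2"
      using P_tendsto[of x] half_gt_zero[OF e] unfolding LIMSEQ_def by blast
    then have M: "norm (x - P M x) < e / 2" by (simp add: dist_norm norm_minus_commute)
    have "dist (mode_flow N t x) (mode_flow K t x) < e" if "N \<ge> M" "K \<ge> M" for N K
    proof -
      have d: "norm (mode_flow N t x - mode_flow M t (P M x)) < e / 2" if "N \<ge> M" for N
      proof -
        have "mode_flow N t x - mode_flow M t (P M x) = mode_flow N t (x - P M x)"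
          using mode_flow_stable[OF that t, of x] by (simp add: linear_diff[OF mode_flow_linear[OF t]])
        then show ?thesis using mode_flow_contraction[OF t, of N "x - P M x"] M by simp
      qed
      show ?thesis
        using norm_triangle_ineq4[of "mode_flow N t x - mode_flow M t (P M x)" "mode_flow K t x - mode_flow M t (P M x)"]
          d[OF that(1)] d[OF that(2)] by (simp add: dist_norm)
    qed
    then show "\<exists>M. \<forall>m\<ge>M. \<forall>n\<ge>M. dist (mode_flow m t x) (mode_flow n t x) < e" by blast
  qed
  then show ?thesis unfolding evolution_def by (simp add: Cauchy_convergent_iff convergent_LIMSEQ_iff)
qed

lemma evolution_P:
  assumes t: "t \<ge> 0"
  shows "evolution t (P N x) = mode_flow N t (P N x)"
proof -
  have "\<forall>\<^sub>F K in sequentially. mode_flow K t (P N x) = mode_flow N t (P N x)"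
    using eventually_ge_at_top[of N] by eventually_elim (rule mode_flow_stable[OF _ t])
  then have "(\<lambda>K. mode_flow K t (P N x)) \<longlonglongrightarrow> mode_flow N t (P N x)" by (rule tendsto_eventually)
  then show ?thesis using evolution_tendsto[OF t] LIMSEQ_unique by blast
qed

lemma P_evolution:
  assumes t: "t \<ge> 0"
  shows "P N (evolution t x) = evolution t (P N x)"
proof -
  have "(\<lambda>K. P N (mode_flow K t x)) \<longlonglongrightarrow> P N (evolution t x)"
    by (rule bounded_linear.tendsto[OF P_bounded_linear evolution_tendsto[OF t]])
  moreover have "(\<lambda>K. P N (mode_flow K t x)) \<longlonglongrightarrow> evolution t (P N x)"
    using evolution_tendsto[OF t, of "P N x"] by (simp add: mode_flow_P[OF t])
  ultimately show ?thesis using LIMSEQ_unique by blast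
qed

lemma evolution_contraction: "t \<ge> 0 \<Longrightarrow> norm (evolution t x) \<le> norm x"
  by (rule LIMSEQ_le_const2[OF tendsto_norm[OF evolution_tendsto]]) (auto intro: mode_flow_contraction)

lemma evolution_linear:
  assumes t: "t \<ge> 0"
  shows "linear (evolution t)"
proof (rule linearI)
  show "evolution t (x + y) = evolution t x + evolution t y" for x y
    using tendsto_add[OF evolution_tendsto[OF t, of x] evolution_tendsto[OF t, of y]]
      evolution_tendsto[OF t, of "x + y"] LIMSEQ_unique
    by (auto simp: linear_add[OF mode_flow_linear[OF t]])
  show "evolution t (c *\<^sub>R x) = c *\<^sub>R evolution t x" for c x
    using tendsto_scaleR[OF tendsto_const evolution_tendsto[OF t, of x], of c]
      evolution_tendsto[OF t, of "c *\<^sub>R x"] LIMSEQ_unique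
    by (auto simp: linear_cmul[OF mode_flow_linear[OF t]])
qed

lemma evolution_0: "evolution 0 x = x"
  using evolution_tendsto[of 0 x] LIMSEQ_unique[OF _ tendsto_const] by (simp add: mode_flow(1))

lemma evolution_add:
  assumes s: "s \<ge> 0" and t: "t \<ge> 0"
  shows "evolution (s + t) x = evolution s (evolution t x)"
proof (rule P_eqI)
  fix N
  have st: "s + t \<ge> 0" using s t by simp
  have "P N (evolution (s + t) x) = mode_flow N (s + t) (P N x)"
    by (simp add: P_evolution[OF st] evolution_P[OF st])
  also have "\<dots> = mode_flow N s (P N (evolution t x))"
    by (simp add: mode_flow_add[OF s t] P_evolution[OF t] evolution_P[OF t])
  also have "\<dots> = P N (evolution s (evolution t x))"
    by (simp add: P_evolution[OF s] evolution_P[OF s])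
  finally show "P N (evolution (s + t) x) = P N (evolution s (evolution t x))" .
qed

lemma evolution_continuous: "continuous_on {0..} (\<lambda>t. evolution t x)"
proof (rule uniform_limit_theorem[where F=sequentially])
  show "\<forall>\<^sub>F N in sequentially. continuous_on {0..} (\<lambda>t. mode_flow N t (P N x))"
    by (simp add: mode_flow_continuous)
  show "uniform_limit {0..} (\<lambda>N t. mode_flow N t (P N x)) (\<lambda>t. evolution t x) sequentially"
  proof (rule uniform_limitI)
    fix e :: real assume e: "e > 0"
    have "\<forall>\<^sub>F N in sequentially. dist (P N x) x < e"
      using P_tendsto[of x] e by (rule tendstoD)
    then show "\<forall>\<^sub>F N in sequentially. \<forall>t\<in>{0..}. dist (mode_flow N t (P N x)) (evolution t x) < e"
    proof eventually_elim
      case (elim N)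
      show ?case
      proof
        fix t :: real assume "t \<in> {0..}"
        then have t: "t \<ge> 0" by simp
        have "mode_flow N t (P N x) - evolution t x = evolution t (P N x - x)"
          by (simp add: linear_diff[OF evolution_linear[OF t]] evolution_P[OF t])
        then show "dist (mode_flow N t (P N x)) (evolution t x) < e"
          using evolution_contraction[OF t, of "P N x - x"] elim by (simp add: dist_norm)
      qed
    qed
  qed
qed simp

lemma evolution_family: "strongly_continuous_family 1 evolution"
  using evolution_linear evolution_contraction evolution_continuous
  by (simp add: strongly_continuous_family_def)

lemma contraction_semigroup_evolution: "contraction_semigroup evolution"
  unfolding contraction_semigroup_def
proof (intro conjI allI impI)
  show "((\<lambda>t. evolution t x) \<longlongrightarrow> x) (at_right 0)" for x
  proof -
    have "((\<lambda>t. evolution t x) \<longlongrightarrow> evolution 0 x) (at 0 within {0..})"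
      using evolution_continuous by (simp add: continuous_on_def)
    then have "((\<lambda>t. evolution t x) \<longlongrightarrow> evolution 0 x) (at_right 0)"
      by (rule tendsto_within_subset) auto
    then show ?thesis by (simp add: evolution_0)
  qed
qed (auto simp: evolution_linear evolution_contraction evolution_0 evolution_add fun_eq_iff)

lemma mode_flow_difference_quotient:
  "((\<lambda>h. (mode_flow N h x - x) /\<^sub>R h) \<longlongrightarrow> A N x) (at_right 0)"
proof -
  have "((\<lambda>t. mode_flow N t x) has_vector_derivative A N x) (at 0 within {0..})"
    using mode_flow(2)[of 0 N x] by (simp add: mode_flow(1))
  then have "((\<lambda>t. mode_flow N t x) has_vector_derivative A N x) (at_right 0)"
    by (rule has_vector_derivative_within_subset) auto
  then have l: "((\<lambda>h. norm (mode_flow N h x - x - h *\<^sub>R A N x) / norm h) \<longlongrightarrow> 0) (at_right 0)"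
    unfolding has_vector_derivative_def has_derivative_iff_norm by (simp add: mode_flow(1))
  have "\<forall>\<^sub>F h in at_right 0. norm (mode_flow N h x - x - h *\<^sub>R A N x) / norm h
      = norm ((mode_flow N h x - x) /\<^sub>R h - A N x)"
    using eventually_at_right_less
  proof eventually_elim
    case (elim h)
    then have "(mode_flow N h x - x) /\<^sub>R h - A N x = (mode_flow N h x - x - h *\<^sub>R A N x) /\<^sub>R h"
      by (simp add: scaleR_diff_right)
    then show ?case using elim by (simp add: divide_inverse)
  qed
  then have "((\<lambda>h. norm ((mode_flow N h x - x) /\<^sub>R h - A N x)) \<longlongrightarrow> 0) (at_right 0)"
    using l by (simp add: tendsto_cong)
  then show ?thesis by (simp add: tendsto_norm_zero_iff Lim_null[of _ "A N x"])
qed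

text \<open>If the difference quotients converge, then so do their projections, and these are difference
  quotients of the mode flow. Conversely, if P N y = A N x for all N, then the projected orbit of x has
  as derivative the projected orbit of y. Hence its deviation from the linear approximation is bounded
  by the oscillation of the orbit of y near time 0; the bound is the same for all N and survives the
  limit.\<close>

theorem generator_evolution: "generator evolution = {(x, y). \<forall>N. P N y = A N x}"
proof (intro set_eqI iffI; clarify)
  fix x y N
  assume "(x, y) \<in> generator evolution"
  then have "((\<lambda>h. (evolution h x - x) /\<^sub>R h) \<longlongrightarrow> y) (at_right 0)" by (simp add: generator_def)
  then have "((\<lambda>h. P N ((evolution h x - x) /\<^sub>R h)) \<longlongrightarrow> P N y) (at_right 0)"
    by (rule bounded_linear.tendsto[OF P_bounded_linear])
  moreover have "\<forall>\<^sub>F h in at_right 0. P N ((evolution h x - x) /\<^sub>R h) = (mode_flow N h (P N x) - P N x) /\<^sub>R h"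
    using eventually_at_right_less
    by eventually_elim (simp add: linear_cmul[OF P_linear] linear_diff[OF P_linear] P_evolution evolution_P)
  ultimately have "((\<lambda>h. (mode_flow N h (P N x) - P N x) /\<^sub>R h) \<longlongrightarrow> P N y) (at_right 0)"
    by (simp add: tendsto_cong)
  then have "P N y = A N (P N x)"
    by (rule tendsto_unique[OF _ _ mode_flow_difference_quotient, rotated]) simp
  then show "P N y = A N x" by (simp add: A_P)
next
  fix x y
  assume xy: "\<forall>N. P N y = A N x"
  have est: "norm (evolution h x - x - h *\<^sub>R y) \<le> h * e"
    if h: "h \<ge> 0" and e: "\<And>s. s \<in> {0..h} \<Longrightarrow> norm (evolution s y - y) \<le> e" for h e
  proof (rule LIMSEQ_le_const2)
    show "(\<lambda>N. norm (P N (evolution h x - x - h *\<^sub>R y))) \<longlonglongrightarrow> norm (evolution h x - x - h *\<^sub>R y)"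
      by (intro tendsto_norm P_tendsto)
    have "norm (P N (evolution h x - x - h *\<^sub>R y)) \<le> h * e" for N
    proof -
      have dy: "mode_flow N s (P N y) = P N (evolution s y)" if "s \<ge> 0" for s
        using that by (simp add: P_evolution evolution_P)
      have "norm (mode_flow N h (P N x) - mode_flow N 0 (P N x) - (h - 0) *\<^sub>R mode_flow N 0 (P N y)) \<le> norm (h - 0) * e"
      proof (rule vector_differentiable_bound_linearization[where S="{0..h}" and f'="\<lambda>s. mode_flow N s (P N y)"])
        show "((\<lambda>s. mode_flow N s (P N x)) has_vector_derivative mode_flow N s (P N y)) (at s within {0..h})"
          if "s \<in> {0..h}" for s
        proof -
          have "A N (mode_flow N s (P N x)) = mode_flow N s (P N y)"
            using that xy by (simp add: mode_flow_A[symmetric] A_P)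
          moreover have "((\<lambda>s. mode_flow N s (P N x)) has_vector_derivative A N (mode_flow N s (P N x))) (at s within {0..h})"
            using that by (intro has_vector_derivative_within_subset[OF mode_flow(2)]) auto
          ultimately show ?thesis by simp
        qed
        show "closed_segment 0 h \<subseteq> {0..h}" using h by (simp add: closed_segment_eq_real_ivl)
        show "norm (mode_flow N s (P N y) - mode_flow N 0 (P N y)) \<le> e" if "s \<in> {0..h}" for s
        proof -
          have "mode_flow N s (P N y) - mode_flow N 0 (P N y) = P N (evolution s y - y)"
            using that by (simp add: dy linear_diff[OF P_linear] evolution_0)
          then show ?thesis using P_le[of N "evolution s y - y"] e[OF that] by simp
        qed
        show "0 \<in> {0..h}" using h by simp
      qed
      then show ?thesis
        using h by (simp add: linear_diff[OF P_linear] linear_cmul[OF P_linear] P_evolution evolution_P mode_flow(1))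
    qed
    then show "\<exists>N. \<forall>n\<ge>N. norm (P n (evolution h x - x - h *\<^sub>R y)) \<le> h * e" by blast
  qed
  have "((\<lambda>h. (evolution h x - x) /\<^sub>R h) \<longlongrightarrow> y) (at_right 0)"
  proof (rule tendstoI)
    fix e :: real assume e: "e > 0"
    have "((\<lambda>t. evolution t y) \<longlongrightarrow> evolution 0 y) (at 0 within {0..})"
      using evolution_continuous by (simp add: continuous_on_def)
    from tendstoD[OF this half_gt_zero[OF e]]
    obtain d where d: "d > 0" "\<And>s. s \<in> {0..} \<Longrightarrow> s \<noteq> 0 \<Longrightarrow> dist s 0 < d \<Longrightarrow> dist (evolution s y) (evolution 0 y) < e / 2"
      unfolding eventually_at by blast
    show "\<forall>\<^sub>F h in at_right 0. dist ((evolution h x - x) /\<^sub>R h) y < e"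
      unfolding eventually_at_right_field
    proof (intro exI[of _ d] conjI allI impI d(1))
      fix h assume h: "0 < h" "h < d"
      have "norm (evolution s y - y) \<le> e / 2" if "s \<in> {0..h}" for s
        using d(2)[of s] that h e by (cases "s = 0") (auto simp: evolution_0 dist_norm)
      then have "norm (evolution h x - x - h *\<^sub>R y) \<le> h * (e / 2)"
        using h by (intro est) auto
      moreover have "(evolution h x - x) /\<^sub>R h - y = (evolution h x - x - h *\<^sub>R y) /\<^sub>R h"
        using h by (simp add: scaleR_diff_right)
      moreover have "inverse h * norm (evolution h x - x - h *\<^sub>R y) \<le> inverse h * (h * (e / 2))"
        using calculation(1) h by (intro mult_left_mono) auto
      moreover have "inverse h * (h * (e / 2)) = e / 2" using h by simp
      moreover have "norm ((evolution h x - x - h *\<^sub>R y) /\<^sub>R h) = inverse h * norm (evolution h x - x - h *\<^sub>R y)"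
        using h by simp
      ultimately have "norm ((evolution h x - x) /\<^sub>R h - y) \<le> e / 2"
        by (simp only:)
      then show "dist ((evolution h x - x) /\<^sub>R h) y < e" using e by (simp add: dist_norm)
    qed
  qed
  then show "(x, y) \<in> generator evolution" by (simp add: generator_def)
qed

text \<open>The premise on a says that a t is the value of the generator at Y t. Each projection of the
  integrand is the derivative of s \<mapsto> mode_flow N (t - s) (P N (Y s)), so the formula is the fundamental
  theorem of calculus mode by mode.\<close>

theorem Duhamel_formula:
  fixes Y :: "real \<Rightarrow> 'a"
  assumes Y: "\<And>t. t \<in> {0..T} \<Longrightarrow> (Y has_vector_derivative Y' t) (at t within {0..T})"
    and a: "\<And>t N. t \<in> {0..T} \<Longrightarrow> P N (a t) = A N (Y t)"
    and r: "continuous_on {0..T} (\<lambda>t. Y' t - a t)" and t: "t \<in> {0..T}"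
  shows "((\<lambda>s. evolution (t - s) (Y' s - a s)) has_integral (Y t - evolution t (Y 0))) {0..t}"
proof -
  have t0: "t \<ge> 0" using t by simp
  have "continuous_on {0..t} (\<lambda>s. evolution (t - s) (Y' s - a s))"
    by (rule continuous_on_family_apply[OF evolution_family])
      (use t in \<open>auto intro!: continuous_intros continuous_on_subset[OF r]\<close>)
  then have int: "((\<lambda>s. evolution (t - s) (Y' s - a s)) has_integral
      integral {0..t} (\<lambda>s. evolution (t - s) (Y' s - a s))) {0..t}" (is "(_ has_integral ?I) _")
    by (intro integrable_integral integrable_continuous_interval)
  have "?I = Y t - evolution t (Y 0)"
  proof (rule P_eqI)
    fix N
    have "((\<lambda>s. mode_flow N (t - s) (P N (Y' s)) - A N (mode_flow N (t - s) (P N (Y s)))) has_integral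
       (mode_flow N (t - t) (P N (Y t)) - mode_flow N (t - 0) (P N (Y 0)))) {0..t}"
    proof (rule fundamental_theorem_of_calculus[OF t0])
      fix s assume s: "s \<in> {0..t}"
      have "(Y has_vector_derivative Y' s) (at s within {0..t})"
        by (rule has_vector_derivative_within_subset[OF Y]) (use s t in auto)
      note dPY = bounded_linear.has_vector_derivative[OF P_bounded_linear[of N] this]
      show "((\<lambda>s. mode_flow N (t - s) (P N (Y s))) has_vector_derivative
          mode_flow N (t - s) (P N (Y' s)) - A N (mode_flow N (t - s) (P N (Y s)))) (at s within {0..t})"
        by (rule has_vector_derivative_family_apply[where U="mode_flow N" and B="A N", OF mode_flow_family _ dPY s])
          (rule mode_flow(2))
    qed
    then have "((\<lambda>s. P N (evolution (t - s) (Y' s - a s))) has_integral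
       (mode_flow N (t - t) (P N (Y t)) - mode_flow N (t - 0) (P N (Y 0)))) {0..t}"
    proof (rule has_integral_eq[rotated])
      fix s assume s: "s \<in> {0..t}"
      then have ts: "t - s \<ge> 0" by simp
      have "A N (mode_flow N (t - s) (P N (Y s))) = mode_flow N (t - s) (P N (a s))"
        using a[of s N] s t by (simp add: mode_flow_A[OF ts, symmetric] A_P)
      then show "mode_flow N (t - s) (P N (Y' s)) - A N (mode_flow N (t - s) (P N (Y s)))
          = P N (evolution (t - s) (Y' s - a s))"
        by (simp add: P_evolution[OF ts] evolution_P[OF ts] linear_diff[OF P_linear] linear_diff[OF evolution_linear[OF ts]])
    qed
    moreover have "((\<lambda>s. P N (evolution (t - s) (Y' s - a s))) has_integral P N ?I) {0..t}"
      using has_integral_linear[OF int P_bounded_linear] by (simp add: o_def)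
    ultimately have "P N ?I = mode_flow N (t - t) (P N (Y t)) - mode_flow N (t - 0) (P N (Y 0))"
      by (rule has_integral_unique[rotated])
    then show "P N ?I = P N (Y t - evolution t (Y 0))"
      by (simp add: mode_flow(1) linear_diff[OF P_linear] P_evolution[OF t0] evolution_P[OF t0])
  qed
  then show ?thesis using int by simp
qed

end

section \<open>Truncation in the Hartley basis\<close>

definition freqs :: "nat \<Rightarrow> (int \<times> int) set" where
  "freqs N = {- int N..int N} \<times> {- int N..int N}"

lemma finite_freqs [simp]: "finite (freqs N)" by (simp add: freqs_def)

lemma uminus_freqs_iff [simp]: "- k \<in> freqs N \<longleftrightarrow> k \<in> freqs N"
  by (cases k) (auto simp: freqs_def)

lemma freqs_min: "k \<in> freqs (min M N) \<longleftrightarrow> k \<in> freqs M \<and> k \<in> freqs N"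
  by (cases k) (auto simp: freqs_def)

lemma freqs_mono: "M \<le> N \<Longrightarrow> freqs M \<subseteq> freqs N"
  by (auto simp: freqs_def)

lemma ex_freqs: "\<exists>N. k \<in> freqs N"
  by (rule exI[of _ "nat (max \<bar>fst k\<bar> \<bar>snd k\<bar>)"], cases k) (auto simp: freqs_def)

definition hproj :: "nat \<Rightarrow> real l2 \<Rightarrow> real l2" where
  "hproj N x = (\<Sum>k\<in>freqs N. (x \<bullet> hbasis k) *\<^sub>R hbasis k)"

text \<open>The truncated partial derivative. Its coefficients are those that integration by parts prescribes,
  since the derivative of the k-th Hartley function is freq i k times the (- k)-th.\<close>

definition hderiv :: "2 \<Rightarrow> nat \<Rightarrow> real l2 \<Rightarrow> real l2" where
  "hderiv i N x = (\<Sum>k\<in>freqs N. (- freq i k * (x \<bullet> hbasis (- k))) *\<^sub>R hbasis k)"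

lemma sum_hbasis_coeff:
  "(\<Sum>k\<in>freqs N. c k *\<^sub>R hbasis k) \<bullet> hbasis l = (if l \<in> freqs N then c l else 0)"
  by (simp add: inner_sum_left hbasis_orthonormal if_distrib cong: if_cong)

lemma hproj_coeff: "hproj N x \<bullet> hbasis l = (if l \<in> freqs N then x \<bullet> hbasis l else 0)"
  unfolding hproj_def by (rule sum_hbasis_coeff)

lemma hderiv_coeff: "hderiv i N x \<bullet> hbasis l = (if l \<in> freqs N then - freq i l * (x \<bullet> hbasis (- l)) else 0)"
  unfolding hderiv_def by (rule sum_hbasis_coeff)

lemma hbasis_coeff_eqI: "(\<And>k. x \<bullet> hbasis k = y \<bullet> hbasis k) \<Longrightarrow> x = y"
  using hbasis_complete[of "x - y"] by (simp add: inner_diff_left)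

lemma hproj_bounded_linear: "bounded_linear (hproj N)"
  unfolding hproj_def
  by (intro bounded_linear_sum bounded_linear_scaleR_const bounded_linear_inner_left)

lemma hderiv_bounded_linear: "bounded_linear (hderiv i N)"
  unfolding hderiv_def
  by (intro bounded_linear_sum bounded_linear_scaleR_const bounded_linear_const_mult bounded_linear_inner_left)

lemma hproj_hproj: "hproj M (hproj N x) = hproj (min M N) x"
  by (rule hbasis_coeff_eqI) (simp add: hproj_coeff freqs_min)

lemma hproj_hderiv: "hproj M (hderiv i N x) = hderiv i (min M N) x"
  by (rule hbasis_coeff_eqI) (simp add: hproj_coeff hderiv_coeff freqs_min)

lemma hderiv_hproj: "hderiv i N (hproj M x) = hderiv i (min M N) x"
  by (rule hbasis_coeff_eqI) (simp add: hproj_coeff hderiv_coeff freqs_min)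

lemma hproj_inner: "hproj N x \<bullet> y = (\<Sum>k\<in>freqs N. (x \<bullet> hbasis k) * (y \<bullet> hbasis k))"
  unfolding hproj_def inner_sum_left inner_scaleR_left by (simp add: inner_commute)

lemma hproj_symmetric: "hproj N x \<bullet> y = x \<bullet> hproj N y"
  by (simp add: hproj_inner inner_commute[of x] mult.commute)

lemma hproj_inner_self: "hproj N x \<bullet> x = (norm (hproj N x))\<^sup>2"
  by (metis hproj_hproj hproj_symmetric min.idem power2_norm_eq_inner)

lemma sum_freqs_reflect: "(\<Sum>k\<in>freqs N. f (- k)) = (\<Sum>k\<in>freqs N. f k)"
  by (rule sum.reindex_bij_witness[where i=uminus and j=uminus]) auto

text \<open>The reflection k \<mapsto> - k exchanges the two coefficients and changes the sign of the frequency.\<close>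

lemma hderiv_antisymmetric: "hderiv i N x \<bullet> y = - (hderiv i N y \<bullet> x)"
proof -
  have "hderiv i N x \<bullet> y = (\<Sum>k\<in>freqs N. - freq i k * (x \<bullet> hbasis (- k)) * (y \<bullet> hbasis k))" for x y
    unfolding hderiv_def inner_sum_left inner_scaleR_left by (simp add: inner_commute)
  note e = this
  have "hderiv i N x \<bullet> y = (\<Sum>k\<in>freqs N. (\<lambda>k. freq i k * (x \<bullet> hbasis k) * (y \<bullet> hbasis (- k))) (- k))"
    unfolding e by (simp add: freq_uminus)
  also have "\<dots> = (\<Sum>k\<in>freqs N. freq i k * (x \<bullet> hbasis k) * (y \<bullet> hbasis (- k)))"
    by (rule sum_freqs_reflect)
  also have "\<dots> = - (hderiv i N y \<bullet> x)"
    unfolding e by (simp add: sum_negf[symmetric] mult_ac)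
  finally show ?thesis .
qed

lemma hproj_le: "norm (hproj N x) \<le> norm x"
proof (cases "norm (hproj N x) = 0")
  case False
  have "(norm (hproj N x))\<^sup>2 \<le> norm (hproj N x) * norm x"
    using norm_cauchy_schwarz[of "hproj N x" x] by (simp add: hproj_inner_self)
  then have "norm (hproj N x) * norm (hproj N x) \<le> norm (hproj N x) * norm x"
    by (simp add: power2_eq_square)
  then show ?thesis using False by (subst (asm) mult_le_cancel_left_pos) auto
qed simp

text \<open>Bessel's inequality makes the projections a Cauchy sequence. The coefficients of the limit are
  those of x, so completeness identifies the limit with x.\<close>

lemma hproj_tendsto: "(\<lambda>N. hproj N x) \<longlonglongrightarrow> x"
proof -
  define s where "s N = (\<Sum>k\<in>freqs N. (x \<bullet> hbasis k)\<^sup>2)" for N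
  have ns: "(norm (hproj N x))\<^sup>2 = s N" for N
    unfolding hproj_inner_self[symmetric] hproj_inner s_def by (simp add: power2_eq_square)
  have "incseq s"
    unfolding s_def by (intro incseq_SucI sum_mono2 freqs_mono) auto
  moreover have "s N \<le> (norm x)\<^sup>2" for N
    using hproj_le[of N x] by (simp add: ns[symmetric] power_mono)
  ultimately have "Cauchy s"
    using incseq_convergent[of s "(norm x)\<^sup>2"] by (blast intro: LIMSEQ_imp_Cauchy)
  have diff: "(norm (hproj M x - hproj N x))\<^sup>2 = s M - s N" if "N \<le> M" for M N
  proof -
    have "hproj M x \<bullet> hproj N x = s N"
      using that by (simp add: hproj_symmetric hproj_hproj hproj_inner_self[symmetric] ns[symmetric] min.absorb2)
    then show ?thesis
      by (simp add: power2_norm_eq_inner inner_diff_left inner_diff_right inner_commute[of "hproj N x"]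
          ns[unfolded power2_norm_eq_inner])
  qed
  have "Cauchy (\<lambda>N. hproj N x)"
  proof (rule metric_CauchyI)
    fix e :: real assume "e > 0"
    then obtain M where M: "\<And>m n. m \<ge> M \<Longrightarrow> n \<ge> M \<Longrightarrow> dist (s m) (s n) < e\<^sup>2"
      using \<open>Cauchy s\<close> unfolding Cauchy_def by (metis zero_less_power)
    have "dist (hproj m x) (hproj n x) < e" if "m \<ge> M" "n \<ge> M" for m n
    proof -
      have "(dist (hproj m x) (hproj n x))\<^sup>2 \<le> \<bar>s m - s n\<bar>"
        using diff[of n m] diff[of m n] by (cases "n \<le> m") (auto simp: dist_norm norm_minus_commute)
      also have "\<dots> < e\<^sup>2" using M[OF that] by (simp add: dist_real_def)
      finally show ?thesis using \<open>e > 0\<close> by (simp add: power2_less_imp_less)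
    qed
    then show "\<exists>M. \<forall>m\<ge>M. \<forall>n\<ge>M. dist (hproj m x) (hproj n x) < e" by blast
  qed
  then obtain y where y: "(\<lambda>N. hproj N x) \<longlonglongrightarrow> y" using Cauchy_convergent convergent_def by blast
  have "y \<bullet> hbasis k = x \<bullet> hbasis k" for k
  proof -
    obtain N0 where "k \<in> freqs N0" using ex_freqs by blast
    have "\<forall>\<^sub>F N in sequentially. hproj N x \<bullet> hbasis k = x \<bullet> hbasis k"
      using eventually_ge_at_top[of N0]
      by eventually_elim (use \<open>k \<in> freqs N0\<close> freqs_mono in \<open>auto simp: hproj_coeff\<close>)
    then have "(\<lambda>N. hproj N x \<bullet> hbasis k) \<longlonglongrightarrow> x \<bullet> hbasis k" by (rule tendsto_eventually)
    moreover have "(\<lambda>N. hproj N x \<bullet> hbasis k) \<longlonglongrightarrow> y \<bullet> hbasis k" by (intro tendsto_intros y)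
    ultimately show ?thesis using LIMSEQ_unique by blast
  qed
  then have "y = x" by (rule hbasis_coeff_eqI)
  then show ?thesis using y by simp
qed

section \<open>Distributional derivatives and Hartley coefficients\<close>

lemma inner_abs_l2_right:
  "square_integrable \<psi> \<Longrightarrow> F \<bullet> abs_l2 \<psi> = (LINT x|torus. rep_l2 F x \<bullet> \<psi> x)"
  using inner_abs_l2[OF rep_l2_square_integrable, of \<psi> F] by (simp add: abs_rep_l2)

lemma test_function_square_integrable:
  "test_function \<phi> \<Longrightarrow> square_integrable \<phi>" "test_function \<phi> \<Longrightarrow> square_integrable (pd i \<phi>)"
  by (auto intro: square_integrable_continuous test_function_derivative)

lemma pd_hartley: "pd i (\<lambda>x. c * hartley k x) = (\<lambda>x. (c * freq i k) * hartley (- k) x)"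
proof
  fix x
  have "((\<lambda>x. c * hartley k x) has_derivative
     (\<lambda>h. c * ((cos (phase k x) - sin (phase k x)) * (of_int (fst k) * h $ 1 + of_int (snd k) * h $ 2) / (2 * pi)))) (at x)"
    unfolding hartley_def cas_def phase_def
    by (auto intro!: derivative_eq_intros bounded_linear.has_derivative[OF bounded_linear_vec_nth]
        simp: fun_eq_iff algebra_simps add_divide_distrib diff_divide_distrib)
  from pd_eqI[OF this, of i]
  show "pd i (\<lambda>x. c * hartley k x) x = (c * freq i k) * hartley (- k) x"
    using exhaust_2[of i] by (auto simp: axis_def freq_def hartley_def cas_def phase_uminus)
qed

lemma differentiable_hartley: "(\<lambda>x. c * hartley k x) differentiable_on UNIV"
  unfolding hartley_def cas_def phase_def differentiable_on_def differentiable_def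
  by (auto intro!: derivative_eq_intros exI bounded_linear.has_derivative[OF bounded_linear_vec_nth])

lemma test_function_hartley: "test_function (hartley k)"
proof -
  have "times_differentiable m (\<lambda>x. c * hartley k x)" for m c k
  proof (induction m arbitrary: c k)
    case 0
    show ?case by (auto intro!: continuous_intros continuous_on_hartley)
  next
    case (Suc m)
    show ?case using differentiable_hartley Suc by (auto simp: pd_hartley)
  qed
  from this[of _ 1 k] have "times_differentiable m (hartley k)" for m by simp
  moreover have "periodic (hartley k)" by (simp add: periodic_def hartley_def cas_def phase_periodic)
  ultimately show ?thesis by (simp add: test_function_def)
qed

lemma pd_coeff:
  assumes "test_function \<phi>"
  shows "abs_l2 (pd i \<phi>) \<bullet> hbasis k = - freq i k * (abs_l2 \<phi> \<bullet> hbasis (- k))"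
proof -
  have "abs_l2 (pd i \<phi>) \<bullet> hbasis k = (LINT x|torus. hartley k x * pd i \<phi> x)"
    using assms by (simp add: hbasis_def inner_abs_l2 test_function_square_integrable square_integrable_hartley mult.commute)
  also have "\<dots> = - (LINT x|torus. (freq i k * hartley (- k) x) * \<phi> x)"
  proof (rule torus_integration_by_parts[OF assms])
    show "periodic (hartley k)" using test_function_hartley by (simp add: test_function_def)
    show "((\<lambda>s. hartley k (x + s *\<^sub>R axis i 1)) has_real_derivative freq i k * hartley (- k) x) (at 0)" for x
      using test_function_derivative(1)[OF test_function_hartley, of k x i] pd_hartley[of i 1 k] by simp
  qed (auto intro!: continuous_intros continuous_on_hartley)
  also have "\<dots> = - freq i k * (LINT x|torus. hartley (- k) x * \<phi> x)"
    by (simp add: mult.assoc)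
  also have "(LINT x|torus. hartley (- k) x * \<phi> x) = abs_l2 \<phi> \<bullet> hbasis (- k)"
    using assms by (simp add: hbasis_def inner_abs_l2 test_function_square_integrable square_integrable_hartley mult.commute)
  finally show ?thesis .
qed

lemma hproj_pd: "test_function \<phi> \<Longrightarrow> hproj N (abs_l2 (pd i \<phi>)) = hderiv i N (abs_l2 \<phi>)"
  by (rule hbasis_coeff_eqI) (simp add: hproj_coeff hderiv_coeff pd_coeff)

text \<open>The distributional divergence of a pair of scalar classes contains both operators of the system:
  the two components of a gradient are the divergences of (b, 0) and (0, b), and the curl of E is the
  divergence of (E_2, - E_1).\<close>

definition weak_div :: "real l2 \<Rightarrow> real l2 \<Rightarrow> real l2 \<Rightarrow> bool" where
  "weak_div x1 x2 c \<longleftrightarrow> (\<forall>\<phi>. test_function \<phi> \<longrightarrow>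
     x1 \<bullet> abs_l2 (pd 1 \<phi>) + x2 \<bullet> abs_l2 (pd 2 \<phi>) = - (c \<bullet> abs_l2 \<phi>))"

text \<open>Testing with Hartley functions yields the identities. Conversely, they amount to the weak
  formulation for the truncations of an arbitrary test function, whose derivatives converge in L^2.\<close>

lemma weak_div_iff: "weak_div x1 x2 c \<longleftrightarrow> (\<forall>N. hproj N c = hderiv 1 N x1 + hderiv 2 N x2)"
proof (intro iffI allI)
  assume w: "weak_div x1 x2 c"
  fix N
  have p: "abs_l2 (pd i (hartley k)) = freq i k *\<^sub>R hbasis (- k)" for i k
    using pd_hartley[of i 1 k] by (simp add: hbasis_def abs_l2_scaleR square_integrable_hartley)
  show "hproj N c = hderiv 1 N x1 + hderiv 2 N x2"
  proof (rule hbasis_coeff_eqI)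
    fix k
    have "x1 \<bullet> abs_l2 (pd 1 (hartley k)) + x2 \<bullet> abs_l2 (pd 2 (hartley k)) = - (c \<bullet> abs_l2 (hartley k))"
      using w[unfolded weak_div_def, rule_format, OF test_function_hartley[of k]] .
    then show "hproj N c \<bullet> hbasis k = (hderiv 1 N x1 + hderiv 2 N x2) \<bullet> hbasis k"
      by (simp add: p hbasis_def[symmetric] hproj_coeff hderiv_coeff inner_add_left)
  qed
next
  assume h: "\<forall>N. hproj N c = hderiv 1 N x1 + hderiv 2 N x2"
  show "weak_div x1 x2 c"
    unfolding weak_div_def
  proof (intro allI impI)
    fix \<phi> assume \<phi>: "test_function \<phi>"
    have p: "x \<bullet> hproj N (abs_l2 (pd i \<phi>)) = - (hderiv i N x \<bullet> abs_l2 \<phi>)" for i N x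
      using hderiv_antisymmetric[of i N "abs_l2 \<phi>" x] by (simp add: hproj_pd[OF \<phi>] inner_commute)
    have "x1 \<bullet> hproj N (abs_l2 (pd 1 \<phi>)) + x2 \<bullet> hproj N (abs_l2 (pd 2 \<phi>)) = - (hproj N c \<bullet> abs_l2 \<phi>)" for N
      using h by (simp add: p inner_add_left)
    moreover have "(\<lambda>N. x1 \<bullet> hproj N (abs_l2 (pd 1 \<phi>)) + x2 \<bullet> hproj N (abs_l2 (pd 2 \<phi>)))
        \<longlonglongrightarrow> x1 \<bullet> abs_l2 (pd 1 \<phi>) + x2 \<bullet> abs_l2 (pd 2 \<phi>)"
      by (intro tendsto_intros hproj_tendsto)
    moreover have "(\<lambda>N. - (hproj N c \<bullet> abs_l2 \<phi>)) \<longlonglongrightarrow> - (c \<bullet> abs_l2 \<phi>)"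
      by (intro tendsto_intros hproj_tendsto)
    ultimately show "x1 \<bullet> abs_l2 (pd 1 \<phi>) + x2 \<bullet> abs_l2 (pd 2 \<phi>) = - (c \<bullet> abs_l2 \<phi>)"
      using LIMSEQ_unique by fastforce
  qed
qed

section \<open>Components of square integrable vector fields\<close>

text \<open>The Hartley basis is scalar, so vector fields are handled through their two components.\<close>

definition component :: "2 \<Rightarrow> (real^2) l2 \<Rightarrow> real l2" where
  "component i E = abs_l2 (\<lambda>x. rep_l2 E x $ i)"

definition embed :: "2 \<Rightarrow> real l2 \<Rightarrow> (real^2) l2" where
  "embed i a = abs_l2 (\<lambda>x. rep_l2 a x *\<^sub>R axis i 1)"

lemma square_integrable_bound:
  fixes f :: "real^2 \<Rightarrow> 'b::euclidean_space" and g :: "real^2 \<Rightarrow> 'c::euclidean_space"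
  assumes "f \<in> borel_measurable torus" "square_integrable g" "\<And>x. norm (f x) \<le> norm (g x)"
  shows "square_integrable f"
  unfolding square_integrable_def
proof (intro conjI assms(1))
  show "integrable torus (\<lambda>x. (norm (f x))\<^sup>2)"
    by (rule Bochner_Integration.integrable_bound[of _ "\<lambda>x. (norm (g x))\<^sup>2"])
      (use assms in \<open>auto simp: square_integrable_def intro!: power_mono borel_measurable_power borel_measurable_norm\<close>)
qed

lemma vec_nth_measurable [measurable (raw)]:
  fixes f :: "'a \<Rightarrow> real^2"
  shows "f \<in> borel_measurable M \<Longrightarrow> (\<lambda>x. f x $ i) \<in> borel_measurable M"
  by (rule measurable_compose[of f M borel]) (auto intro!: borel_measurable_continuous_onI continuous_intros)

lemma square_integrable_component: "square_integrable f \<Longrightarrow> square_integrable (\<lambda>x. (f x :: real^2) $ i)"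
  by (rule square_integrable_bound[of _ f])
    (auto simp: component_le_norm_cart square_integrable_measurable intro: vec_nth_measurable)

lemma square_integrable_embed:
  "square_integrable f \<Longrightarrow> square_integrable (\<lambda>x. (f x :: real) *\<^sub>R (axis i 1 :: real^2))"
  by (rule square_integrable_bound[of _ f])
    (auto simp: square_integrable_measurable intro: borel_measurable_scaleR)

text \<open>Both operations act on classes; the lemmas of this kind replace the representative chosen in the
  definition by any other one.\<close>

lemma embed_abs_l2: "square_integrable f \<Longrightarrow> embed i (abs_l2 f) = abs_l2 (\<lambda>x. f x *\<^sub>R axis i 1)"
  unfolding embed_def using rep_abs_l2[of f]
  by (intro abs_l2_eqI square_integrable_embed rep_l2_square_integrable) auto

lemma component_abs_l2: "square_integrable f \<Longrightarrow> component i (abs_l2 f) = abs_l2 (\<lambda>x. f x $ i)"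
  unfolding component_def using rep_abs_l2[of f]
  by (intro abs_l2_eqI square_integrable_component rep_l2_square_integrable) auto

lemma component_embed: "component i (embed j a) = (if i = j then a else 0)"
proof -
  have "component i (embed j a) = abs_l2 (\<lambda>x. (rep_l2 a x *\<^sub>R (axis j 1 :: real^2)) $ i)"
    unfolding embed_def by (rule component_abs_l2[OF square_integrable_embed[OF rep_l2_square_integrable]])
  also have "\<dots> = (if i = j then abs_l2 (rep_l2 a) else abs_l2 (\<lambda>_. 0))" by (simp add: axis_def)
  finally show ?thesis by (simp add: abs_rep_l2 abs_l2_zero)
qed

lemma embed_add: "embed i (a + b) = embed i a + embed i b"
proof -
  have "embed i a + embed i b = abs_l2 (\<lambda>x. rep_l2 a x *\<^sub>R axis i 1 + rep_l2 b x *\<^sub>R axis i 1)"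
    unfolding embed_def by (intro abs_l2_add square_integrable_embed rep_l2_square_integrable)
  also have "\<dots> = embed i (abs_l2 (\<lambda>x. rep_l2 a x + rep_l2 b x))"
    by (simp add: embed_abs_l2 square_integrable_add rep_l2_square_integrable scaleR_add_left)
  finally show ?thesis by (simp add: abs_l2_add[symmetric] rep_l2_square_integrable abs_rep_l2)
qed

lemma component_add: "component i (a + b) = component i a + component i b"
proof -
  have "component i a + component i b = abs_l2 (\<lambda>x. rep_l2 a x $ i + rep_l2 b x $ i)"
    unfolding component_def by (intro abs_l2_add square_integrable_component rep_l2_square_integrable)
  also have "\<dots> = component i (abs_l2 (\<lambda>x. rep_l2 a x + rep_l2 b x))"
    by (simp add: component_abs_l2 square_integrable_add rep_l2_square_integrable)
  finally show ?thesis by (simp add: abs_l2_add[symmetric] rep_l2_square_integrable abs_rep_l2)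
qed

lemma embed_scaleR: "embed i (c *\<^sub>R a) = c *\<^sub>R embed i a"
proof -
  have "c *\<^sub>R embed i a = embed i (abs_l2 (\<lambda>x. c *\<^sub>R rep_l2 a x))"
    unfolding embed_def[of i a]
    by (simp add: abs_l2_scaleR square_integrable_embed rep_l2_square_integrable embed_abs_l2 square_integrable_scaleR[of "rep_l2 a" c, simplified])
  then show ?thesis using abs_l2_scaleR[OF rep_l2_square_integrable[of a], of c] by (simp add: abs_rep_l2)
qed

lemma component_scaleR: "component i (c *\<^sub>R a) = c *\<^sub>R component i a"
proof -
  have "c *\<^sub>R component i a = component i (abs_l2 (\<lambda>x. c *\<^sub>R rep_l2 a x))"
    unfolding component_def[of i a]
    by (simp add: abs_l2_scaleR square_integrable_component rep_l2_square_integrable component_abs_l2 square_integrable_scaleR)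
  then show ?thesis by (simp add: abs_l2_scaleR[symmetric] rep_l2_square_integrable abs_rep_l2)
qed

lemma embed_component: "embed 1 (component 1 E) + embed 2 (component 2 E) = E"
proof -
  have "embed 1 (component 1 E) + embed 2 (component 2 E)
     = abs_l2 (\<lambda>x. (rep_l2 E x $ 1) *\<^sub>R axis 1 1 + (rep_l2 E x $ 2) *\<^sub>R axis 2 1)"
    unfolding component_def
    by (simp add: embed_abs_l2 abs_l2_add square_integrable_embed square_integrable_component rep_l2_square_integrable)
  also have "(\<lambda>x. (rep_l2 E x $ 1) *\<^sub>R axis 1 1 + (rep_l2 E x $ 2) *\<^sub>R axis 2 1) = rep_l2 E"
    by (simp add: fun_eq_iff vec2_def[symmetric] vec2_eta)
  finally show ?thesis by (simp add: abs_rep_l2)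
qed

lemma inner_embed_right: "E \<bullet> embed i a = component i E \<bullet> a"
proof -
  have "E \<bullet> embed i a = (LINT x|torus. rep_l2 E x \<bullet> (rep_l2 a x *\<^sub>R axis i 1))"
    unfolding embed_def by (rule inner_abs_l2_right[OF square_integrable_embed[OF rep_l2_square_integrable]])
  also have "\<dots> = (LINT x|torus. rep_l2 E x $ i \<bullet> rep_l2 a x)"
    by (simp add: inner_axis mult.commute)
  also have "\<dots> = component i E \<bullet> a"
    unfolding component_def using inner_abs_l2[OF square_integrable_component[OF rep_l2_square_integrable] rep_l2_square_integrable, of E i a]
    by (simp add: abs_rep_l2)
  finally show ?thesis .
qed

lemma inner_component: "E \<bullet> F = component 1 E \<bullet> component 1 F + component 2 E \<bullet> component 2 F"
proof -
  have "E \<bullet> F = E \<bullet> (embed 1 (component 1 F) + embed 2 (component 2 F))" by (simp only: embed_component)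
  then show ?thesis by (simp only: inner_add_right inner_embed_right)
qed

lemma norm_component: "(norm E)\<^sup>2 = (norm (component 1 E))\<^sup>2 + (norm (component 2 E))\<^sup>2"
  unfolding power2_norm_eq_inner by (rule inner_component)

lemma component_eqI:
  assumes "component 1 E = component 1 F" "component 2 E = component 2 F"
  shows "E = F"
proof -
  have "E = embed 1 (component 1 E) + embed 2 (component 2 E)" by (rule embed_component[symmetric])
  also have "\<dots> = F" unfolding assms by (rule embed_component)
  finally show ?thesis .
qed

lemma norm_embed: "norm (embed i a) = norm a"
proof -
  have "(norm (embed i a))\<^sup>2 = (norm a)\<^sup>2"
    using exhaust_2[of i] by (auto simp: norm_component[of "embed i a"] component_embed)
  then show ?thesis by (simp add: power2_eq_iff_nonneg)
qed

lemma norm_component_le: "norm (component i E) \<le> norm E"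
proof -
  have "(norm (component i E))\<^sup>2 \<le> (norm E)\<^sup>2"
    unfolding norm_component[of E] using exhaust_2[of i] by auto
  then show ?thesis by (rule power2_le_imp_le) simp
qed

lemma embed_bounded_linear: "bounded_linear (embed i)"
  by (rule bounded_linear_intro[where K=1]) (simp_all add: embed_add embed_scaleR norm_embed)

lemma component_bounded_linear: "bounded_linear (component i)"
  by (rule bounded_linear_intro[where K=1]) (simp_all add: component_add component_scaleR norm_component_le)

lemmas embed_linear = bounded_linear.linear[OF embed_bounded_linear]
lemmas component_linear = bounded_linear.linear[OF component_bounded_linear]
lemmas hproj_linear = bounded_linear.linear[OF hproj_bounded_linear]
lemmas hderiv_linear = bounded_linear.linear[OF hderiv_bounded_linear]

section \<open>The Maxwell--Ohm operator\<close>

definition mode_proj :: "nat \<Rightarrow> state \<Rightarrow> state" where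
  "mode_proj N X = (embed 1 (hproj N (component 1 (fst X))) + embed 2 (hproj N (component 2 (fst X))), hproj N (snd X))"

text \<open>The operator (E, b) \<mapsto> (R grad b - \<sigma> E, - curl E) with truncated derivatives.\<close>

definition mode_op :: "real \<Rightarrow> nat \<Rightarrow> state \<Rightarrow> state" where
  "mode_op \<sigma> N X =
    (embed 1 (hderiv 2 N (snd X) - \<sigma> *\<^sub>R hproj N (component 1 (fst X))) +
     embed 2 (- hderiv 1 N (snd X) - \<sigma> *\<^sub>R hproj N (component 2 (fst X))),
     hderiv 2 N (component 1 (fst X)) - hderiv 1 N (component 2 (fst X)))"

lemma state_eq_iff:
  "X = Y \<longleftrightarrow> component 1 (fst X) = component 1 (fst Y) \<and> component 2 (fst X) = component 2 (fst Y) \<and> snd X = snd Y"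
  for X Y :: state
  using component_eqI[of "fst X" "fst Y"] by (auto simp: prod_eq_iff)

lemmas component_simps = linear_add[OF component_linear] linear_diff[OF component_linear] linear_cmul[OF component_linear]
  linear_neg[OF component_linear] component_embed

lemma component_mode_proj [simp]:
  "component 1 (fst (mode_proj N X)) = hproj N (component 1 (fst X))"
  "component 2 (fst (mode_proj N X)) = hproj N (component 2 (fst X))"
  "snd (mode_proj N X) = hproj N (snd X)"
  by (simp_all add: mode_proj_def component_simps)

lemma component_mode_op [simp]:
  "component 1 (fst (mode_op \<sigma> N X)) = hderiv 2 N (snd X) - \<sigma> *\<^sub>R hproj N (component 1 (fst X))"
  "component 2 (fst (mode_op \<sigma> N X)) = - hderiv 1 N (snd X) - \<sigma> *\<^sub>R hproj N (component 2 (fst X))"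
  "snd (mode_op \<sigma> N X) = hderiv 2 N (component 1 (fst X)) - hderiv 1 N (component 2 (fst X))"
  by (simp_all add: mode_op_def component_simps)

lemma state_inner: "X \<bullet> Y = component 1 (fst X) \<bullet> component 1 (fst Y) + component 2 (fst X) \<bullet> component 2 (fst Y) + snd X \<bullet> snd Y"
  for X Y :: state
  by (simp add: inner_prod_def inner_component[of "fst X"])

text \<open>Dissipativity is the energy identity: the terms with derivatives cancel by antisymmetry and only
  the Ohmic loss - \<sigma> |P_N E|^2 remains.\<close>

lemma spectral_generator_mode_op:
  assumes "\<sigma> \<ge> 0"
  shows "spectral_generator mode_proj (mode_op \<sigma>)"
proof (rule spectral_generator.intro)
  note bl = bounded_linear_Pair bounded_linear_add bounded_linear_sub bounded_linear_minus
    bounded_linear_compose[OF embed_bounded_linear] bounded_linear_compose[OF component_bounded_linear]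
    bounded_linear_compose[OF hproj_bounded_linear] bounded_linear_compose[OF hderiv_bounded_linear]
    bounded_linear_const_scaleR bounded_linear_fst bounded_linear_snd
  have "bounded_linear (\<lambda>X. mode_proj N X)" for N
    unfolding mode_proj_def by (rule bl)+
  then show "linear (mode_proj N)" for N by (intro bounded_linear.linear) simp
  have "bounded_linear (\<lambda>X. mode_op \<sigma> N X)" for N
    unfolding mode_op_def by (rule bl)+
  then show "bounded_linear (mode_op \<sigma> N)" for N by simp
  show "norm (mode_proj N x) \<le> norm x" for N x
  proof -
    have "mode_proj N x \<bullet> mode_proj N x \<le> x \<bullet> x"
      unfolding state_inner component_mode_proj power2_norm_eq_inner[symmetric]
      by (intro add_mono power_mono hproj_le norm_ge_zero)
    then show ?thesis by (simp add: norm_eq_sqrt_inner)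
  qed
  show "(\<lambda>N. mode_proj N x) \<longlonglongrightarrow> x" for x
  proof -
    have "(\<lambda>N. mode_proj N x) \<longlonglongrightarrow> (embed 1 (component 1 (fst x)) + embed 2 (component 2 (fst x)), snd x)"
      unfolding mode_proj_def
      by (intro tendsto_intros bounded_linear.tendsto[OF embed_bounded_linear] hproj_tendsto)
    then show ?thesis by (simp add: embed_component)
  qed
  show "mode_proj M (mode_proj N x) = mode_proj (min M N) x" for M N x
    by (simp add: state_eq_iff hproj_hproj)
  show "mode_proj M (mode_op \<sigma> N x) = mode_op \<sigma> (min M N) x" for M N x
    by (simp add: state_eq_iff hproj_hproj hproj_hderiv linear_diff[OF hproj_linear] linear_neg[OF hproj_linear] linear_cmul[OF hproj_linear])
  show "mode_op \<sigma> N (mode_proj M x) = mode_op \<sigma> (min M N) x" for M N x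
    by (simp add: state_eq_iff hproj_hproj hderiv_hproj min.commute)
  show "mode_op \<sigma> N x \<bullet> x \<le> 0" for N x
  proof -
    have "mode_op \<sigma> N x \<bullet> x = - \<sigma> * ((norm (hproj N (component 1 (fst x))))\<^sup>2 + (norm (hproj N (component 2 (fst x))))\<^sup>2)"
      using hderiv_antisymmetric[of 2 N "snd x" "component 1 (fst x)"] hderiv_antisymmetric[of 1 N "snd x" "component 2 (fst x)"]
      by (simp add: state_inner inner_diff_left hproj_inner_self algebra_simps)
    then show ?thesis using assms by (simp add: mult_nonneg_nonneg)
  qed
qed

lemma weak_grad_iff: "weak_grad b G \<longleftrightarrow> weak_div b 0 (component 1 G) \<and> weak_div 0 b (component 2 G)"
proof -
  have c: "component i G \<bullet> abs_l2 \<phi> = (LINT x|torus. rep_l2 G x $ i * \<phi> x)" if "test_function \<phi>" for i \<phi>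
    unfolding component_def using that
    by (simp add: inner_abs_l2 square_integrable_component rep_l2_square_integrable test_function_square_integrable)
  have b: "b \<bullet> abs_l2 (pd i \<phi>) = (LINT x|torus. rep_l2 b x * pd i \<phi> x)" if "test_function \<phi>" for i \<phi>
    using that by (simp add: inner_abs_l2_right test_function_square_integrable)
  show ?thesis unfolding weak_grad_def weak_div_def forall_2
    by (auto simp: c b)
qed

lemma weak_curl_iff: "weak_curl E c \<longleftrightarrow> weak_div (component 2 E) (- component 1 E) c"
proof -
  have e: "component 2 E \<bullet> abs_l2 (pd 1 \<phi>) - component 1 E \<bullet> abs_l2 (pd 2 \<phi>)
      = (LINT x|torus. rep_l2 E x $ 2 * pd 1 \<phi> x - rep_l2 E x $ 1 * pd 2 \<phi> x)"
    if t: "test_function \<phi>" for \<phi>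
  proof -
    have "integrable torus (\<lambda>x. rep_l2 E x $ i * pd j \<phi> x)" for i j
      using integrable_inner_l2[OF square_integrable_component[OF rep_l2_square_integrable] test_function_square_integrable(2)[OF t]]
      by simp
    then show ?thesis
      unfolding component_def using t
      by (simp add: inner_abs_l2 square_integrable_component rep_l2_square_integrable test_function_square_integrable)
  qed
  have "c \<bullet> abs_l2 \<phi> = (LINT x|torus. rep_l2 c x * \<phi> x)" if "test_function \<phi>" for \<phi>
    using that by (simp add: inner_abs_l2_right test_function_square_integrable)
  then show ?thesis unfolding weak_curl_def weak_div_def
    by (auto simp: e)
qed

lemma square_integrable_rot: "square_integrable f \<Longrightarrow> square_integrable (\<lambda>x. rot (f x))"
proof -
  have "rot z = z $ 2 *\<^sub>R axis 1 1 + (- (z $ 1)) *\<^sub>R axis 2 1" for z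
    by (simp add: rot_def vec_eq_iff forall_2 axis_def)
  then show "square_integrable f \<Longrightarrow> square_integrable (\<lambda>x. rot (f x))"
    by (simp only:) (intro square_integrable_add square_integrable_embed square_integrable_uminus square_integrable_component)
qed

lemma rot_nth [simp]: "rot z $ 1 = z $ 2" "rot z $ 2 = - (z $ 1)"
  by (simp_all add: rot_def)

lemma component_rot:
  "component 1 (abs_l2 (\<lambda>x. rot (rep_l2 G x))) = component 2 G"
  "component 2 (abs_l2 (\<lambda>x. rot (rep_l2 G x))) = - component 1 G"
proof -
  have u: "- abs_l2 f = abs_l2 (\<lambda>x. - f x)" if "square_integrable f" for f :: "real^2 \<Rightarrow> real"
    using abs_l2_scaleR[OF that, of "-1"] by simp
  show "component 1 (abs_l2 (\<lambda>x. rot (rep_l2 G x))) = component 2 G"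
    "component 2 (abs_l2 (\<lambda>x. rot (rep_l2 G x))) = - component 1 G"
    unfolding component_abs_l2[OF square_integrable_rot[OF rep_l2_square_integrable]] component_def[of _ G]
    by (simp_all add: u square_integrable_component rep_l2_square_integrable)
qed

text \<open>Membership in the maximal domain only means that the distributional R grad b and curl E have
  square summable coefficients, which is what the right-hand side expresses. If the image is (F, d),
  then the gradient of b must be - R (F + \<sigma> E) and the curl of E must be - d.\<close>

theorem maxwell_ohm_operator_spectral:
  "maxwell_ohm_operator \<sigma> = {(X, Y). \<forall>N. mode_proj N Y = mode_op \<sigma> N X}"
proof (intro set_eqI iffI; clarify)
  fix E F :: "(real^2) l2" and b d :: "real l2" and N
  assume "((E, b), (F, d)) \<in> maxwell_ohm_operator \<sigma>"
  then obtain G c where FG: "F = abs_l2 (\<lambda>x. rot (rep_l2 G x)) - \<sigma> *\<^sub>R E" "d = - c"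
    and w: "weak_grad b G" "weak_curl E c"
    unfolding maxwell_ohm_operator_def by blast
  have z: "hderiv i N 0 = 0" for i N by (rule linear_0[OF hderiv_linear])
  have "hproj N (component 1 G) = hderiv 1 N b" "hproj N (component 2 G) = hderiv 2 N b"
    using w(1) by (auto simp: weak_grad_iff weak_div_iff z)
  moreover have "hproj N c = hderiv 1 N (component 2 E) - hderiv 2 N (component 1 E)"
    using w(2) by (auto simp: weak_curl_iff weak_div_iff linear_neg[OF hderiv_linear])
  ultimately show "mode_proj N (F, d) = mode_op \<sigma> N (E, b)"
    by (simp add: state_eq_iff FG component_simps component_rot linear_diff[OF hproj_linear] linear_neg[OF hproj_linear] linear_cmul[OF hproj_linear])
next
  fix E F :: "(real^2) l2" and b d :: "real l2"
  assume "\<forall>N. mode_proj N (F, d) = mode_op \<sigma> N (E, b)"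
  then have h: "hproj N (component 1 F) = hderiv 2 N b - \<sigma> *\<^sub>R hproj N (component 1 E)"
    "hproj N (component 2 F) = - hderiv 1 N b - \<sigma> *\<^sub>R hproj N (component 2 E)"
    "hproj N d = hderiv 2 N (component 1 E) - hderiv 1 N (component 2 E)" for N
    by (auto simp: state_eq_iff)
  define G where "G = embed 1 (- (component 2 F + \<sigma> *\<^sub>R component 2 E)) + embed 2 (component 1 F + \<sigma> *\<^sub>R component 1 E)"
  have z: "hderiv i N 0 = 0" for i N by (rule linear_0[OF hderiv_linear])
  have "weak_grad b G"
    unfolding weak_grad_iff weak_div_iff G_def
    by (simp add: component_simps h z linear_diff[OF hproj_linear] linear_add[OF hproj_linear] linear_neg[OF hproj_linear] linear_cmul[OF hproj_linear])
  moreover have "weak_curl E (- d)"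
    unfolding weak_curl_iff weak_div_iff
    by (simp add: h linear_neg[OF hproj_linear] linear_neg[OF hderiv_linear])
  moreover have "F = abs_l2 (\<lambda>x. rot (rep_l2 G x)) - \<sigma> *\<^sub>R E"
    by (rule component_eqI) (simp_all add: component_simps component_rot G_def)
  ultimately show "((E, b), (F, d)) \<in> maxwell_ohm_operator \<sigma>"
    unfolding maxwell_ohm_operator_def by (auto intro!: exI[of _ G] exI[of _ "- d"])
qed

section \<open>Representatives in the fundamental cell\<close>

lemma wrap_in_cell: "wrap x \<in> torus_cell"
proof -
  have "- pi \<le> x $ i - 2 * pi * of_int \<lfloor>(x $ i + pi) / (2 * pi)\<rfloor> \<and>
      x $ i - 2 * pi * of_int \<lfloor>(x $ i + pi) / (2 * pi)\<rfloor> < pi" for i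
  proof -
    define k :: real where "k = of_int \<lfloor>(x $ i + pi) / (2 * pi)\<rfloor>"
    have "k \<le> (x $ i + pi) / (2 * pi)" "(x $ i + pi) / (2 * pi) < k + 1"
      unfolding k_def by linarith+
    then have "k * (2 * pi) \<le> x $ i + pi" "x $ i + pi < (k + 1) * (2 * pi)"
      by (simp_all only: pos_le_divide_eq pos_divide_less_eq pi_gt_zero zero_less_mult_iff zero_less_numeral simp_thms)
    then have "- pi \<le> x $ i - 2 * pi * k \<and> x $ i - 2 * pi * k < pi"
      by (simp add: algebra_simps)
    then show ?thesis by (simp add: k_def)
  qed
  then show ?thesis by (simp add: torus_cell_def wrap_def)
qed

lemma cos_wrap: "cos (wrap x $ i) = cos (x $ i)"
  and sin_wrap: "sin (wrap x $ i) = sin (x $ i)"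
  by (simp_all add: wrap_def cos_diff sin_diff)

text \<open>Although the representative jumps at the boundary of the cell, its distance to the origin in each
  coordinate is a continuous function of the point: the distance to 2 pi Z.\<close>

lemma abs_wrap: "\<bar>wrap x $ i\<bar> = arccos (cos (x $ i))"
proof -
  have "- pi \<le> wrap x $ i" "wrap x $ i < pi" using wrap_in_cell[of x] by (auto simp: torus_cell_def)
  then have "arccos (cos \<bar>wrap x $ i\<bar>) = \<bar>wrap x $ i\<bar>" by (intro arccos_cos) auto
  then show ?thesis by (simp add: cos_wrap)
qed

text \<open>The half-angle formula expresses the representative by periodic functions that are continuous away
  from the boundary of the cell.\<close>

lemma wrap_arctan:
  assumes "cos (x $ i) > - 1"
  shows "wrap x $ i = 2 * arctan (sin (x $ i) / (cos (x $ i) + 1))"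
proof -
  have b: "- pi \<le> wrap x $ i" "wrap x $ i < pi" using wrap_in_cell[of x] by (auto simp: torus_cell_def)
  have "wrap x $ i \<noteq> - pi" using assms cos_wrap[of x i] by auto
  then have "arctan (tan (wrap x $ i / 2)) = wrap x $ i / 2" using b by (intro arctan_tan) auto
  moreover have "tan (wrap x $ i / 2) = sin (x $ i) / (cos (x $ i) + 1)"
    using tan_half[of "wrap x $ i / 2"] by (simp add: cos_wrap sin_wrap)
  ultimately show ?thesis by simp
qed

lemma norm_wrap_sq: "(norm (wrap x))\<^sup>2 = (arccos (cos (x $ 1)))\<^sup>2 + (arccos (cos (x $ 2)))\<^sup>2"
  unfolding power2_norm_eq_inner
  by (simp add: inner_vec_def sum_2 abs_wrap[symmetric] power2_eq_square[symmetric])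

lemma norm_wrap_eq: "norm (wrap x) = sqrt ((arccos (cos (x $ 1)))\<^sup>2 + (arccos (cos (x $ 2)))\<^sup>2)"
  by (simp add: norm_wrap_sq[symmetric])

lemma continuous_on_norm_wrap: "continuous_on A (\<lambda>x. norm (wrap x))"
  unfolding norm_wrap_eq by (intro continuous_intros continuous_on_arccos) auto

lemma periodic_int_shift:
  assumes "periodic f"
  shows "f (x + axis i (2 * pi * of_int k)) = f x"
proof -
  have nat: "f (x + axis i (2 * pi * real m)) = f x" for m x
  proof (induction m)
    case (Suc m)
    have "x + axis i (2 * pi * real (Suc m)) = (x + axis i (2 * pi * real m)) + axis i (2 * pi)"
      by (simp add: vec_eq_iff axis_def algebra_simps)
    then show ?case using assms Suc by (simp only: periodic_def)
  qed (simp add: axis_def vec_eq_iff[symmetric] zero_vec_def[symmetric])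
  show ?thesis
  proof (cases "k \<ge> 0")
    case True
    then show ?thesis using nat[of x "nat k"] by simp
  next
    case False
    have e: "(x + axis i (2 * pi * of_int k)) + axis i (2 * pi * real (nat (- k))) = x"
      using False by (simp add: vec_eq_iff axis_def)
    show ?thesis using nat[of "x + axis i (2 * pi * of_int k)" "nat (- k)"] unfolding e by simp
  qed
qed

lemma periodic_wrap:
  assumes "periodic f"
  shows "f (c + wrap (x - c)) = f x"
proof -
  define k where "k i = \<lfloor>((x - c) $ i + pi) / (2 * pi)\<rfloor>" for i
  have "(c + wrap (x - c)) + axis 1 (2 * pi * of_int (k 1)) + axis 2 (2 * pi * of_int (k 2)) = x"
    by (simp add: vec_eq_iff forall_2 wrap_def axis_def k_def)
  then show ?thesis
    using periodic_int_shift[OF assms, of "c + wrap (x - c)" 1 "k 1"]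
      periodic_int_shift[OF assms, of "(c + wrap (x - c)) + axis 1 (2 * pi * of_int (k 1))" 2 "k 2"] by simp
qed

text \<open>The composition could only be discontinuous where the representative jumps, which happens at points
  of norm at least pi; there V vanishes. Accordingly the torus is covered by the two open sets where
  the half-angle formula applies and where the norm of the representative exceeds r.\<close>

lemma continuous_on_compose_wrap:
  fixes V :: "'a::t2_space \<Rightarrow> real^2 \<Rightarrow> 'b::real_normed_vector"
  assumes V: "continuous_on (S \<times> UNIV) (\<lambda>(s, y). V s y)" and S: "open S"
    and zero: "\<And>s y. s \<in> S \<Longrightarrow> norm y \<ge> r \<Longrightarrow> V s y = 0" and r: "r < pi"
  shows "continuous_on (S \<times> UNIV) (\<lambda>(s, x). V s (wrap x))"
proof -
  define O1 where "O1 = {x::real^2. - 1 < cos (x $ 1) \<and> - 1 < cos (x $ 2)}"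
  define O2 where "O2 = {x. r < norm (wrap x)}"
  have "open O1" unfolding O1_def
    by (intro open_Collect_conj open_Collect_less continuous_intros)
  then have o1: "open (S \<times> O1)" using S by (rule open_Times[rotated])
  have "open O2" unfolding O2_def by (intro open_Collect_less continuous_intros continuous_on_norm_wrap)
  then have o2: "open (S \<times> O2)" using S by (rule open_Times[rotated])
  have "x \<in> O1 \<or> x \<in> O2" for x
  proof (rule disjCI)
    assume "x \<notin> O2"
    then have n: "norm (wrap x) < pi" using r by (simp add: O2_def)
    have "- 1 < cos (x $ i)" for i
    proof -
      have "\<bar>wrap x $ i\<bar> < pi" using component_le_norm_cart[of "wrap x" i] n by simp
      then have "arccos (cos (x $ i)) \<noteq> pi" by (simp add: abs_wrap)
      then have "cos (x $ i) \<noteq> - 1" by auto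
      then show ?thesis using cos_ge_minus_one[of "x $ i"] by linarith
    qed
    then show "x \<in> O1" by (simp add: O1_def)
  qed
  then have U: "S \<times> UNIV = S \<times> O1 \<union> S \<times> O2" by auto
  have c1: "continuous_on (S \<times> O1) (\<lambda>(s, x). V s (wrap x))"
  proof -
    have "continuous_on (S \<times> O1) (\<lambda>z. (\<lambda>(s, y). V s y) (fst z, \<chi> i. 2 * arctan (sin (snd z $ i) / (cos (snd z $ i) + 1))))"
    proof (rule continuous_on_compose2[OF V])
      have "cos (snd z $ i) + 1 \<noteq> 0" if "z \<in> S \<times> O1" for z i
        using that exhaust_2[of i] by (auto simp: O1_def)
      then show "continuous_on (S \<times> O1) (\<lambda>z. (fst z, \<chi> i. 2 * arctan (sin (snd z $ i) / (cos (snd z $ i) + 1))))"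
        by (auto intro!: continuous_intros)
    qed auto
    then show ?thesis
    proof (rule continuous_on_eq)
      fix z assume z: "z \<in> S \<times> O1"
      have "wrap (snd z) = (\<chi> i. 2 * arctan (sin (snd z $ i) / (cos (snd z $ i) + 1)))"
        unfolding vec_eq_iff
      proof
        fix i show "wrap (snd z) $ i = (\<chi> i. 2 * arctan (sin (snd z $ i) / (cos (snd z $ i) + 1))) $ i"
          using wrap_arctan[of "snd z" i] z exhaust_2[of i] by (auto simp: O1_def)
      qed
      then show "(\<lambda>(s, y). V s y) (fst z, \<chi> i. 2 * arctan (sin (snd z $ i) / (cos (snd z $ i) + 1))) = (\<lambda>(s, x). V s (wrap x)) z"
        by (simp add: case_prod_beta)
    qed
  qed
  have "continuous_on (S \<times> O2) (\<lambda>(s, x). 0 :: 'b)" by (simp add: case_prod_beta)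
  then have c2: "continuous_on (S \<times> O2) (\<lambda>(s, x). V s (wrap x))"
    by (rule continuous_on_eq) (auto simp: O2_def zero)
  show ?thesis unfolding U by (rule continuous_on_open_Un[OF o1 o2 c1 c2])
qed

section \<open>The coefficients\<close>

lemma grad_eqI:
  assumes "(f has_derivative (\<lambda>h. g \<bullet> h)) (at x)"
  shows "grad f x = g"
  unfolding grad_def vec_eq_iff using pd_eqI[OF assms] by (simp add: inner_axis)

lemma norm_rot: "norm (rot z) = norm z"
  by (simp add: norm_vec_def L2_set_def sum_2 add.commute)

lemma norm_e_dir: "norm e_dir = 1" by (simp add: e_dir_def)

lemma A_coeff_bounds:
  assumes "\<sigma> > 0" "t \<ge> 0"
  shows "1 \<le> A_coeff \<sigma> n t" "A_coeff \<sigma> n t \<le> A_coeff \<sigma> n 0"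
proof -
  show "1 \<le> A_coeff \<sigma> n t" using assms by (simp add: A_coeff_def)
  have "2 / (\<sigma> * (t + exp (- real n))) \<le> 2 / (\<sigma> * (0 + exp (- real n)))"
    using assms by (intro divide_left_mono mult_left_mono mult_pos_pos) (auto intro: add_nonneg_pos)
  then show "A_coeff \<sigma> n t \<le> A_coeff \<sigma> n 0" by (simp add: A_coeff_def)
qed

lemma L_coeff_bounds:
  assumes "\<sigma> > 0" "t \<ge> 0"
  shows "1 \<le> L_coeff \<sigma> n t" "L_coeff \<sigma> n t \<le> L_coeff \<sigma> n 0"
proof -
  have "1 \<le> (A_coeff \<sigma> n t)\<^sup>2" using A_coeff_bounds[OF assms, of n] by simp
  then show "1 \<le> L_coeff \<sigma> n t" unfolding L_coeff_def by linarith
  have "(A_coeff \<sigma> n t)\<^sup>2 \<le> (A_coeff \<sigma> n 0)\<^sup>2"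
    using A_coeff_bounds[OF assms, of n] by (intro power_mono) auto
  then show "L_coeff \<sigma> n t \<le> L_coeff \<sigma> n 0" by (simp add: L_coeff_def)
qed

context
  fixes \<Theta> :: "real \<Rightarrow> real" and r0 :: real
  assumes prof: "cutoff_profile \<Theta>" and r0: "0 < r0" "r0 < pi"
begin

lemma profile_has_derivative: "(\<Theta> has_real_derivative deriv \<Theta> z) (at z)"
  and profile_deriv_continuous: "continuous_on A (deriv \<Theta>)"
proof -
  have d: "((deriv ^^ k) \<Theta>) field_differentiable at z" for k z
    using prof by (simp add: cutoff_profile_def)
  show "(\<Theta> has_real_derivative deriv \<Theta> z) (at z)"
    using d[of 0 z] by (simp add: field_differentiable_derivI)
  have "deriv \<Theta> field_differentiable at z" for z using d[of 1 z] by simp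
  then show "continuous_on A (deriv \<Theta>)"
    by (intro continuous_at_imp_continuous_on ballI field_differentiable_imp_continuous_at)
qed

lemma profile_bounds: "0 \<le> \<Theta> z" "\<Theta> z \<le> 1" "z \<le> 0 \<Longrightarrow> \<Theta> z = 0" "z \<ge> 1 \<Longrightarrow> \<Theta> z = 1"
  using prof by (auto simp: cutoff_profile_def)

text \<open>Where the profile equals 0 or 1 it has an extremum, so its derivative vanishes, also at the
  endpoints of its transition interval.\<close>

lemma profile_deriv_zero:
  assumes "z \<le> 0 \<or> z \<ge> 1"
  shows "deriv \<Theta> z = 0"
  using assms
proof
  assume "z \<le> 0"
  then show ?thesis
    using DERIV_local_min[OF profile_has_derivative[of z], of 1] profile_bounds by simp
next
  assume "z \<ge> 1"
  then show ?thesis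
    using DERIV_local_max[OF profile_has_derivative[of z], of 1] profile_bounds by simp
qed

lemma continuous_on_profile: "continuous_on A \<Theta>"
  by (rule DERIV_continuous_on[OF has_field_derivative_at_within[OF profile_has_derivative]])

text \<open>The gradient of the stream function in closed form. The second term stems from the derivative of
  the cutoff; at the origin the formula is replaced by its value in the core, where the cutoff is 1.\<close>

definition stream_grad :: "real \<Rightarrow> real \<Rightarrow> real^2 \<Rightarrow> real^2" where
  "stream_grad A L y = (if y = 0 then - A *\<^sub>R rot e_dir
     else - A *\<^sub>R (\<Theta> (ln (r0 / norm y) / L) *\<^sub>R rot e_dir
       - (deriv \<Theta> (ln (r0 / norm y) / L) * (rot e_dir \<bullet> y) / (L * (norm y)\<^sup>2)) *\<^sub>R y))"

text \<open>The cutoff is saturated as soon as log (r0 / r) exceeds L: the core has the exponentially small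
  radius r0 exp (- L).\<close>

lemma core_argument:
  assumes "L > 0" "norm y < r0 * exp (- L)" "y \<noteq> 0"
  shows "ln (r0 / norm y) / L \<ge> 1"
proof -
  have "norm y * exp L < r0 * exp (- L) * exp L" using assms by (intro mult_strict_right_mono) auto
  then have "norm y * exp L < r0" by (simp add: mult.assoc exp_add[symmetric])
  then have "exp L < r0 / norm y" using assms by (simp add: pos_less_divide_eq mult.commute)
  moreover have "r0 / norm y > 0" using r0 assms by simp
  ultimately have "ln (exp L) < ln (r0 / norm y)" by (subst ln_less_cancel_iff) auto
  then have "L < ln (r0 / norm y)" by simp
  then show ?thesis using assms by simp
qed

lemma stream_grad_core:
  assumes "L > 0" "norm y < r0 * exp (- L)"
  shows "stream_grad A L y = - A *\<^sub>R rot e_dir"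
proof (cases "y = 0")
  case False
  then show ?thesis using core_argument[OF assms False]
    by (simp add: stream_grad_def profile_bounds profile_deriv_zero)
qed (simp add: stream_grad_def)

lemma outer_argument:
  assumes "L > 0" "norm y \<ge> r0"
  shows "ln (r0 / norm y) / L \<le> 0"
proof -
  have "norm y > 0" using assms r0 by linarith
  then have "r0 / norm y \<le> 1" "r0 / norm y > 0" using assms r0 by auto
  then have "ln (r0 / norm y) \<le> 0" by simp
  then show ?thesis using assms by (simp add: divide_nonpos_pos)
qed

lemma stream_grad_outer:
  assumes "L > 0" "norm y \<ge> r0"
  shows "stream_grad A L y = 0"
proof -
  have "y \<noteq> 0" using assms r0 by auto
  then show ?thesis using outer_argument[OF assms]
    by (simp add: stream_grad_def profile_bounds profile_deriv_zero)
qed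

text \<open>Away from the origin this is the product rule, valid also across |y| = r0 because the profile
  vanishes on the negative axis. Near the origin the logarithm is avoided: there the stream function is linear.\<close>

lemma grad_stream:
  assumes L: "L > 0"
  shows "grad (stream \<Theta> r0 A L) y = stream_grad A L y"
proof (rule grad_eqI)
  show "(stream \<Theta> r0 A L has_derivative (\<lambda>h. stream_grad A L y \<bullet> h)) (at y)"
  proof (cases "y = 0")
    case True
    have "((\<lambda>x. - A * (rot e_dir \<bullet> x)) has_derivative (\<lambda>h. stream_grad A L y \<bullet> h)) (at y)"
      unfolding True stream_grad_def by (auto intro!: derivative_eq_intros)
    then show ?thesis
    proof (rule has_derivative_transform_within_open[where s="ball 0 (r0 * exp (- L))"])
      fix x :: "real^2" assume "x \<in> ball 0 (r0 * exp (- L))"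
      then have x: "norm x < r0 * exp (- L)" by simp
      show "- A * (rot e_dir \<bullet> x) = stream \<Theta> r0 A L x"
      proof (cases "x = 0")
        case False
        have "r0 * exp (- L) \<le> r0" using r0 L by (simp add: mult_left_le)
        then have "norm x < r0" using x by linarith
        then show ?thesis using core_argument[OF L x False] False
          by (simp add: stream_def chi_def profile_bounds)
      qed (simp add: stream_def)
    qed (use True r0 in auto)
  next
    case False
    have z: "((\<lambda>x. ln (r0 / norm x) / L) has_derivative (\<lambda>h. - (y \<bullet> h) / (L * (norm y)\<^sup>2))) (at y)"
    proof -
      have "((\<lambda>x. (ln r0 - ln (norm x)) / L) has_derivative (\<lambda>h. - (y \<bullet> h) / (L * (norm y)\<^sup>2))) (at y)"
        using False L
        by (auto intro!: derivative_eq_intros has_derivative_norm simp: fun_eq_iff sgn_div_norm inner_commute power2_eq_square field_simps)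
      then show ?thesis
      proof (rule has_derivative_transform_within_open[where s="- {0}"])
        show "(ln r0 - ln (norm x)) / L = ln (r0 / norm x) / L" if "x \<in> - {0}" for x :: "real^2"
          using that r0 by (simp add: ln_div)
      qed (use False in auto)
    qed
    have "((\<lambda>x. \<Theta> (ln (r0 / norm x) / L)) has_derivative
        (\<lambda>h. deriv \<Theta> (ln (r0 / norm y) / L) * (- (y \<bullet> h) / (L * (norm y)\<^sup>2)))) (at y)"
      using has_derivative_compose[OF z profile_has_derivative[of "ln (r0 / norm y) / L", unfolded has_field_derivative_def]]
      by simp
    then have "((\<lambda>x. - A * (rot e_dir \<bullet> x) * \<Theta> (ln (r0 / norm x) / L)) has_derivative
        (\<lambda>h. - A * (rot e_dir \<bullet> y) * (deriv \<Theta> (ln (r0 / norm y) / L) * (- (y \<bullet> h) / (L * (norm y)\<^sup>2)))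
           + - A * (rot e_dir \<bullet> h) * \<Theta> (ln (r0 / norm y) / L))) (at y)"
      by (auto intro!: derivative_eq_intros simp: fun_eq_iff)
    moreover have "(\<lambda>h. - A * (rot e_dir \<bullet> y) * (deriv \<Theta> (ln (r0 / norm y) / L) * (- (y \<bullet> h) / (L * (norm y)\<^sup>2)))
           + - A * (rot e_dir \<bullet> h) * \<Theta> (ln (r0 / norm y) / L)) = (\<lambda>h. stream_grad A L y \<bullet> h)"
      using False by (simp add: stream_grad_def fun_eq_iff inner_diff_left algebra_simps)
    ultimately have "((\<lambda>x. - A * (rot e_dir \<bullet> x) * \<Theta> (ln (r0 / norm x) / L)) has_derivative
        (\<lambda>h. stream_grad A L y \<bullet> h)) (at y)" by simp
    then show ?thesis
    proof (rule has_derivative_transform_within_open[where s="- {0}"])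
      fix x :: "real^2" assume "x \<in> - {0}"
      then show "- A * (rot e_dir \<bullet> x) * \<Theta> (ln (r0 / norm x) / L) = stream \<Theta> r0 A L x"
        using outer_argument[OF L, of x] profile_bounds(3) by (auto simp: stream_def chi_def)
    qed (use False in auto)
  qed
qed

text \<open>Joint continuity in the amplitude, the cutoff length and the point is needed because the first two
  depend on time. Near y = 0 the field is constant in y, on a set that is open in
  all three variables.\<close>

lemma continuous_on_stream_grad:
  "continuous_on ((UNIV \<times> {0<..}) \<times> UNIV) (\<lambda>(s, y). stream_grad (fst s) (snd s) y)"
proof -
  define O1 :: "((real \<times> real) \<times> (real^2)) set" where "O1 = (UNIV \<times> {0<..}) \<times> - {0}"
  define O2 :: "((real \<times> real) \<times> (real^2)) set" where
    "O2 = {z. 0 < snd (fst z)} \<inter> {z. norm (snd z) < r0 * exp (- snd (fst z))}"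
  have o1: "open O1" unfolding O1_def by (intro open_Times) auto
  have o2: "open O2" unfolding O2_def by (intro open_Int open_Collect_less continuous_intros)
  have U: "(UNIV \<times> {0<..}) \<times> UNIV = O1 \<union> O2"
    using r0 by (auto simp: O1_def O2_def)
  have z: "snd z \<noteq> 0" "snd (fst z) > 0" if "z \<in> O1" for z using that by (auto simp: O1_def)
  have "continuous_on O1 (\<lambda>z. - fst (fst z) *\<^sub>R (\<Theta> (ln (r0 / norm (snd z)) / snd (fst z)) *\<^sub>R rot e_dir
       - (deriv \<Theta> (ln (r0 / norm (snd z)) / snd (fst z)) * (rot e_dir \<bullet> snd z) / (snd (fst z) * (norm (snd z))\<^sup>2)) *\<^sub>R snd z))"
    using z r0 by (intro continuous_intros continuous_on_compose2[OF continuous_on_profile[of UNIV]]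
        continuous_on_compose2[OF profile_deriv_continuous[of UNIV]]) fastforce+
  then have c1: "continuous_on O1 (\<lambda>(s, y). stream_grad (fst s) (snd s) y)"
    by (rule continuous_on_eq) (use z(1) in \<open>simp add: stream_grad_def case_prod_beta\<close>)
  have "continuous_on O2 (\<lambda>z. - fst (fst z) *\<^sub>R rot e_dir)" by (intro continuous_intros)
  then have c2: "continuous_on O2 (\<lambda>(s, y). stream_grad (fst s) (snd s) y)"
    by (rule continuous_on_eq) (auto simp: O2_def stream_grad_core)
  show ?thesis unfolding U by (rule continuous_on_open_Un[OF o1 o2 c1 c2])
qed

text \<open>The factor |y|^-2 from differentiating the logarithm is compensated by the two factors y.\<close>

lemma stream_grad_bound:
  assumes L: "L \<ge> 1" and C: "\<And>z. \<bar>deriv \<Theta> z\<bar> \<le> C"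
  shows "norm (stream_grad A L y) \<le> \<bar>A\<bar> * (1 + C)"
proof (cases "y = 0")
  case True
  have "C \<ge> 0" using C[of 0] by linarith
  then show ?thesis using True by (simp add: stream_grad_def norm_rot norm_e_dir mult_left_mono[of 1 "1 + C" "\<bar>A\<bar>", simplified])
next
  case False
  let ?z = "ln (r0 / norm y) / L"
  have "\<bar>rot e_dir \<bullet> y\<bar> \<le> norm y"
    using Cauchy_Schwarz_ineq2[of "rot e_dir" y] by (simp add: norm_rot norm_e_dir)
  then have "\<bar>deriv \<Theta> ?z\<bar> * \<bar>rot e_dir \<bullet> y\<bar> \<le> C * norm y"
    using C by (intro mult_mono) (auto intro: order_trans[OF abs_ge_zero])
  then have "\<bar>deriv \<Theta> ?z * (rot e_dir \<bullet> y)\<bar> * norm y \<le> C * norm y * norm y"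
    unfolding abs_mult by (intro mult_right_mono) auto
  also have "\<dots> \<le> C * (L * (norm y)\<^sup>2)"
  proof -
    have "C \<ge> 0" using C[of 0] by linarith
    moreover have "norm y * norm y * 1 \<le> norm y * norm y * L" using L by (intro mult_left_mono) auto
    ultimately show ?thesis
      using mult_left_mono[of "norm y * norm y * 1" "norm y * norm y * L" C] by (simp add: power2_eq_square mult_ac)
  qed
  finally have "norm ((deriv \<Theta> ?z * (rot e_dir \<bullet> y) / (L * (norm y)\<^sup>2)) *\<^sub>R y) \<le> C"
    using False L by (simp add: abs_mult pos_divide_le_eq)
  moreover have "norm (\<Theta> ?z *\<^sub>R rot e_dir) \<le> 1"
    using profile_bounds by (simp add: norm_rot norm_e_dir)
  ultimately have "norm (\<Theta> ?z *\<^sub>R rot e_dir - (deriv \<Theta> ?z * (rot e_dir \<bullet> y) / (L * (norm y)\<^sup>2)) *\<^sub>R y) \<le> 1 + C"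
    by (intro order_trans[OF norm_triangle_ineq4] add_mono)
  then show ?thesis using False by (simp add: stream_grad_def mult_left_mono)
qed

lemma u_coeff_eq:
  assumes "\<sigma> > 0" "t \<ge> 0"
  shows "u_coeff \<Theta> r0 \<sigma> x0 n t x = rot (stream_grad (A_coeff \<sigma> n t) (L_coeff \<sigma> n t) (wrap (x - x_c x0 t)))"
  using L_coeff_bounds(1)[OF assms, of n] by (simp add: u_coeff_def W_field_def grad_stream)

text \<open>The amplitude decreases in time and, because of the delay exp (- n), starts from a finite value.
  The bound grows with n, which is harmless because everything else about the packet is chosen after n.\<close>

lemma u_coeff_bounded:
  assumes \<sigma>: "\<sigma> > 0"
  shows "\<exists>M\<ge>0. \<forall>t\<ge>0. \<forall>x. norm (u_coeff \<Theta> r0 \<sigma> x0 n t x) \<le> M"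
proof -
  obtain C where C0: "\<forall>z. \<bar>deriv \<Theta> z\<bar> + \<bar>deriv (deriv \<Theta>) z\<bar> \<le> C"
    using prof by (auto simp: cutoff_profile_def)
  have C: "\<bar>deriv \<Theta> z\<bar> \<le> C" for z using C0[rule_format, of z] by linarith
  have "C \<ge> 0" using C[of 0] by linarith
  show ?thesis
  proof (intro exI[of _ "A_coeff \<sigma> n 0 * (1 + C)"] conjI allI impI)
    show "0 \<le> A_coeff \<sigma> n 0 * (1 + C)" using A_coeff_bounds(1)[OF \<sigma>, of 0 n] \<open>C \<ge> 0\<close> by simp
    fix t :: real and x assume t: "t \<ge> 0"
    note Ab = A_coeff_bounds[OF \<sigma> t, of n]
    have "norm (u_coeff \<Theta> r0 \<sigma> x0 n t x) \<le> \<bar>A_coeff \<sigma> n t\<bar> * (1 + C)"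
      unfolding u_coeff_eq[OF \<sigma> t] norm_rot by (rule stream_grad_bound[OF L_coeff_bounds(1)[OF \<sigma> t] C])
    also have "\<dots> \<le> A_coeff \<sigma> n 0 * (1 + C)" using Ab \<open>C \<ge> 0\<close> by (intro mult_right_mono) auto
    finally show "norm (u_coeff \<Theta> r0 \<sigma> x0 n t x) \<le> A_coeff \<sigma> n 0 * (1 + C)" .
  qed
qed

text \<open>The core is smallest when the cutoff length is largest, at time 0, so a single radius serves
  all times.\<close>

lemma u_coeff_core:
  assumes \<sigma>: "\<sigma> > 0"
  shows "\<exists>\<rho>>0. \<forall>t\<ge>0. \<forall>x. norm (wrap (x - x_c x0 t)) < \<rho> \<longrightarrow> u_coeff \<Theta> r0 \<sigma> x0 n t x = A_coeff \<sigma> n t *\<^sub>R e_dir"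
proof (intro exI[of _ "r0 * exp (- L_coeff \<sigma> n 0)"] conjI allI impI)
  show "0 < r0 * exp (- L_coeff \<sigma> n 0)" using r0 by simp
  fix t :: real and x assume t: "t \<ge> 0" and x: "norm (wrap (x - x_c x0 t)) < r0 * exp (- L_coeff \<sigma> n 0)"
  have "r0 * exp (- L_coeff \<sigma> n 0) \<le> r0 * exp (- L_coeff \<sigma> n t)"
    using L_coeff_bounds(2)[OF \<sigma> t, of n] r0 by simp
  then have "stream_grad (A_coeff \<sigma> n t) (L_coeff \<sigma> n t) (wrap (x - x_c x0 t)) = - A_coeff \<sigma> n t *\<^sub>R rot e_dir"
    using L_coeff_bounds(1)[OF \<sigma> t, of n] x by (intro stream_grad_core) linarith+
  then show "u_coeff \<Theta> r0 \<sigma> x0 n t x = A_coeff \<sigma> n t *\<^sub>R e_dir"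
    by (simp add: u_coeff_eq[OF \<sigma> t] vec_eq_iff forall_2)
qed

lemma u_coeff_continuous:
  assumes \<sigma>: "\<sigma> > 0"
  shows "continuous_on ({0..} \<times> UNIV) (\<lambda>(t, x). u_coeff \<Theta> r0 \<sigma> x0 n t x)"
proof -
  have c: "continuous_on ((UNIV \<times> {0<..}) \<times> UNIV) (\<lambda>(s, x). stream_grad (fst s) (snd s) (wrap x))"
  proof (rule continuous_on_compose_wrap[OF continuous_on_stream_grad _ _ r0(2)])
    show "open ((UNIV :: real set) \<times> {0::real<..})" by (intro open_Times) simp_all
    show "stream_grad (fst s) (snd s) y = 0" if "s \<in> UNIV \<times> {0<..}" "r0 \<le> norm y" for s y
      using that by (intro stream_grad_outer) auto
  qed
  have tn: "t + exp (- real n) \<noteq> 0" if "t \<ge> 0" for t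
    using that exp_gt_zero[of "- real n"] by linarith
  have "continuous_on ({0..} \<times> UNIV) (\<lambda>z. (\<lambda>(s, x). stream_grad (fst s) (snd s) (wrap x))
     ((A_coeff \<sigma> n (fst z), L_coeff \<sigma> n (fst z)), snd z - x_c x0 (fst z)))"
  proof (rule continuous_on_compose2[OF c])
    show "continuous_on ({0..} \<times> UNIV) (\<lambda>z. ((A_coeff \<sigma> n (fst z), L_coeff \<sigma> n (fst z)), snd z - x_c x0 (fst z)))"
      unfolding A_coeff_def L_coeff_def x_c_def using \<sigma> tn by (intro continuous_intros) auto
    have "0 < L_coeff \<sigma> n t" if "t \<ge> 0" for t using L_coeff_bounds(1)[OF \<sigma> that, of n] by linarith
    then show "(\<lambda>z. ((A_coeff \<sigma> n (fst z), L_coeff \<sigma> n (fst z)), snd z - x_c x0 (fst z))) ` ({0..} \<times> UNIV)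
        \<subseteq> (UNIV \<times> {0<..}) \<times> UNIV" by auto
  qed
  then have "continuous_on ({0..} \<times> UNIV) (\<lambda>z. stream_grad (A_coeff \<sigma> n (fst z)) (L_coeff \<sigma> n (fst z)) (wrap (snd z - x_c x0 (fst z))))"
    by simp
  moreover have "bounded_linear rot"
    by (rule bounded_linear_intro[where K=1]) (auto simp: norm_rot vec_eq_iff forall_2)
  ultimately have "continuous_on ({0..} \<times> UNIV) (\<lambda>z. rot (stream_grad (A_coeff \<sigma> n (fst z)) (L_coeff \<sigma> n (fst z)) (wrap (snd z - x_c x0 (fst z)))))"
    by (rule bounded_linear.continuous_on[rotated])
  then show ?thesis
    by (rule continuous_on_eq) (auto simp: u_coeff_eq[OF \<sigma>])
qed

end

section \<open>Exact solutions near approximate ones\<close>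

text \<open>The difference Z = X - Y has initial value 0 and solves the Volterra equation whose forcing is minus
  the residual of Y. It exists and is small by the weighted fixed point argument, and Duhamel's formula
  for Y shows that Y + Z is a mild solution. Only Y has to be differentiable.\<close>

theorem (in spectral_generator) exact_near_approximate:
  fixes Y :: "real \<Rightarrow> 'a"
  assumes T: "T \<ge> 0"
    and Y: "\<And>t. t \<in> {0..T} \<Longrightarrow> (Y has_vector_derivative Y' t) (at t within {0..T})"
    and a: "\<And>t N. t \<in> {0..T} \<Longrightarrow> P N (a t) = A N (Y t)"
    and B: "strongly_continuous_family M B" and M: "M \<ge> 0"
    and cont: "continuous_on {0..T} (\<lambda>t. Y' t - a t)"
    and R: "\<And>t. t \<in> {0..T} \<Longrightarrow> norm (Y' t - a t - B t (Y t)) \<le> R"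
  shows "\<exists>X. continuous_on {0..T} X \<and> X 0 = Y 0 \<and>
    (\<forall>t\<in>{0..T}. ((\<lambda>s. evolution (t - s) (B s (X s))) has_integral (X t - evolution t (X 0))) {0..t}) \<and>
    (\<forall>t\<in>{0..T}. norm (X t - Y t) \<le> 2 * R * exp ((2 * M + 1) * T))"
proof -
  note BD = strongly_continuous_familyD[OF B]
  define r where "r t = Y' t - a t - B t (Y t)" for t
  have Yc: "continuous_on {0..T} Y"
    unfolding continuous_on_eq_continuous_within using Y by (blast intro: has_vector_derivative_continuous)
  have rc: "continuous_on {0..T} r"
    unfolding r_def by (intro continuous_intros cont continuous_on_family_apply[OF B] Yc) auto
  \<comment> \<open>Freezing the residual after T yields a bounded continuous forcing on the half line.\<close>
  define \<rho> where "\<rho> t = - r (min t T)" for t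
  have \<rho>c: "continuous_on {0..} \<rho>"
    unfolding \<rho>_def by (intro continuous_intros continuous_on_compose2[OF rc]) (use T in auto)
  have \<rho>b: "norm (\<rho> t) \<le> R" if "t \<ge> 0" for t
    unfolding \<rho>_def r_def norm_minus_cancel using that T by (intro R) auto
  have "\<exists>Z. continuous_on {0..} Z \<and>
      (\<forall>t\<ge>0. ((\<lambda>s. evolution (t - s) (B s (Z s) + \<rho> s)) has_integral (Z t - evolution t 0)) {0..t}) \<and>
      (\<forall>t\<ge>0. norm (Z t) \<le> 2 * (norm (0::'a) + R) * exp ((2 * M + 1) * t))"
    by (rule Volterra_solution[OF evolution_family B M \<rho>c \<rho>b])
  then obtain Z where ZQ: "continuous_on {0..} Z \<and>
      (\<forall>t\<ge>0. ((\<lambda>s. evolution (t - s) (B s (Z s) + \<rho> s)) has_integral (Z t - evolution t 0)) {0..t}) \<and>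
      (\<forall>t\<ge>0. norm (Z t) \<le> 2 * (norm (0::'a) + R) * exp ((2 * M + 1) * t))"
    by (rule exE)
  note Z = conjunct1[OF ZQ]
    and ZI = conjunct1[OF conjunct2[OF ZQ], rule_format]
    and Zb = conjunct2[OF conjunct2[OF ZQ], rule_format]
  have Z0: "Z 0 = 0"
    using integral_unique[OF ZI[of 0]] by (simp add: evolution_0)
  have R0: "R \<ge> 0" by (rule order_trans[OF norm_ge_zero R[of 0]]) (use T in simp)
  show ?thesis
  proof (intro exI[of _ "\<lambda>t. Y t + Z t"] conjI ballI)
    show "continuous_on {0..T} (\<lambda>t. Y t + Z t)"
      by (intro continuous_intros Yc continuous_on_subset[OF Z]) auto
    show "Y 0 + Z 0 = Y 0" by (simp add: Z0)
    fix t assume t: "t \<in> {0..T}"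
    then have t0: "t \<ge> 0" by simp
    show "norm (Y t + Z t - Y t) \<le> 2 * R * exp ((2 * M + 1) * T)"
    proof -
      have "norm (Z t) \<le> 2 * R * exp ((2 * M + 1) * t)" using Zb[OF t0] by simp
      also have "\<dots> \<le> 2 * R * exp ((2 * M + 1) * T)"
        using R0 M t by (intro mult_left_mono) (auto intro!: mult_left_mono)
      finally show ?thesis by simp
    qed
    have "((\<lambda>s. evolution (t - s) (Y' s - a s) + evolution (t - s) (B s (Z s) + \<rho> s)) has_integral
        (Y t - evolution t (Y 0)) + (Z t - evolution t 0)) {0..t}"
      by (intro has_integral_add Duhamel_formula[OF Y a cont t] ZI[OF t0])
    moreover have "(Y t - evolution t (Y 0)) + (Z t - evolution t 0) = Y t + Z t - evolution t (Y 0 + Z 0)"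
      by (simp add: Z0 linear_0[OF evolution_linear[OF t0]])
    moreover have "evolution (t - s) (Y' s - a s) + evolution (t - s) (B s (Z s) + \<rho> s) = evolution (t - s) (B s (Y s + Z s))"
      if s: "s \<in> {0..t}" for s
    proof -
      have ts: "t - s \<ge> 0" "s \<ge> 0" using s by auto
      have "(Y' s - a s) + (B s (Z s) + \<rho> s) = B s (Y s + Z s)"
        using s t by (simp add: \<rho>_def r_def linear_add[OF BD(1)[OF ts(2)]] min_def)
      then show ?thesis by (simp only: linear_add[OF evolution_linear[OF ts(1)], symmetric])
    qed
    ultimately show "((\<lambda>s. evolution (t - s) (B s (Y s + Z s))) has_integral
        (Y t + Z t - evolution t (Y 0 + Z 0))) {0..t}"
      using has_integral_eq[of "{0..t}" "\<lambda>s. evolution (t - s) (Y' s - a s) + evolution (t - s) (B s (Z s) + \<rho> s)"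
        "\<lambda>s. evolution (t - s) (B s (Y s + Z s))"] by simp
  qed
qed

section \<open>Periodic bump functions\<close>

lemma DERIV_positive_part_power:
  "((\<lambda>x::real. (max 0 x) ^ Suc (Suc m)) has_real_derivative real (Suc (Suc m)) * (max 0 x) ^ Suc m) (at x)"
proof -
  consider "x > 0" | "x < 0" | "x = 0" by linarith
  then show ?thesis
  proof cases
    case 1
    have "((\<lambda>x::real. x ^ Suc (Suc m)) has_real_derivative real (Suc (Suc m)) * x ^ Suc m) (at x)"
      using DERIV_pow[of "Suc (Suc m)" x] by (simp only: diff_Suc_Suc minus_nat.diff_0)
    then have "((\<lambda>x::real. x ^ Suc (Suc m)) has_real_derivative real (Suc (Suc m)) * (max 0 x) ^ Suc m) (at x)"
      using 1 by (simp add: max_def)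
    then show ?thesis
      by (rule has_field_derivative_transform_within_open[where S="{0<..}"]) (use 1 in \<open>auto simp: max_def\<close>)
  next
    case 2
    have "((\<lambda>x::real. 0) has_real_derivative real (Suc (Suc m)) * (max 0 x) ^ Suc m) (at x)"
      using 2 by simp
    then show ?thesis
      by (rule has_field_derivative_transform_within_open[where S="{..<0}"]) (use 2 in \<open>auto simp: max_def\<close>)
  next
    case 3
    have "((\<lambda>h::real. (max 0 h) ^ Suc m) \<longlongrightarrow> (max 0 0) ^ Suc m) (at 0)"
      by (intro tendsto_intros)
    then have lim: "((\<lambda>h::real. (max 0 h) ^ Suc m) \<longlongrightarrow> 0) (at 0)" by simp
    have "((\<lambda>h::real. (max 0 (0 + h) ^ Suc (Suc m) - max 0 0 ^ Suc (Suc m)) / h) \<longlongrightarrow> 0) (at 0)"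
    proof (rule Lim_null_comparison[OF _ lim])
      have "norm ((max 0 (0 + h) ^ Suc (Suc m) - max 0 0 ^ Suc (Suc m)) / h) \<le> max 0 h ^ Suc m" for h :: real
        by (cases "h > 0") (auto simp: max_def)
      then show "\<forall>\<^sub>F h in at (0::real). norm ((max 0 (0 + h) ^ Suc (Suc m) - max 0 0 ^ Suc (Suc m)) / h) \<le> max 0 h ^ Suc m"
        by simp
    qed
    then show ?thesis unfolding 3 has_field_derivative_def[symmetric] DERIV_def by simp
  qed
qed

definition cap :: "real \<Rightarrow> nat \<Rightarrow> real \<Rightarrow> real" where
  "cap \<kappa> m s = (max 0 (cos s - \<kappa>)) ^ m"

lemma DERIV_cap: "(cap \<kappa> (Suc (Suc m)) has_real_derivative - (real (Suc (Suc m)) * sin s * cap \<kappa> (Suc m) s)) (at s)"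
proof -
  have "((\<lambda>s. cos s - \<kappa>) has_real_derivative - sin s) (at s)"
    by (auto intro!: derivative_eq_intros)
  from DERIV_chain2[OF DERIV_positive_part_power this, of m] show ?thesis
    by (simp add: cap_def[abs_def] mult_ac)
qed

lemma continuous_on_cap [continuous_intros]: "continuous_on A (cap \<kappa> m)"
  unfolding cap_def by (intro continuous_intros)

text \<open>A periodic function p 0 together with its first three derivatives, vanishing outside the arc of
  half-width h around 0. Writing the arc as cos s > cos h makes the condition periodic by itself.\<close>

definition bump :: "real \<Rightarrow> (nat \<Rightarrow> real \<Rightarrow> real) \<Rightarrow> bool" where
  "bump h p \<longleftrightarrow>
     (\<forall>i<3. \<forall>s. (p i has_real_derivative p (Suc i) s) (at s)) \<and>
     (\<forall>i\<le>3. continuous_on UNIV (p i)) \<and>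
     (\<forall>i\<le>3. \<forall>s. p i (s + 2 * pi) = p i s) \<and>
     (\<forall>i\<le>3. \<forall>s. cos s \<le> cos h \<longrightarrow> p i s = 0)"

lemma bumpD:
  assumes "bump h p"
  shows "i < 3 \<Longrightarrow> (p i has_real_derivative p (Suc i) s) (at s)"
    "i \<le> 3 \<Longrightarrow> continuous_on UNIV (p i)" "i \<le> 3 \<Longrightarrow> p i (s + 2 * pi) = p i s"
    "i \<le> 3 \<Longrightarrow> cos s \<le> cos h \<Longrightarrow> p i s = 0"
  using assms by (auto simp: bump_def)

lemma bump_scale: "bump h p \<Longrightarrow> bump h (\<lambda>i s. c * p i s)"
  by (auto simp: bump_def intro!: derivative_eq_intros continuous_intros)

text \<open>The function (cos s - \<kappa>)_+^4 and its derivatives. The fourth power is the smallest one whose third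
  derivative is continuous, and three derivatives of the packet enter the residual.\<close>

definition cap_bump :: "real \<Rightarrow> nat \<Rightarrow> real \<Rightarrow> real" where
  "cap_bump \<kappa> i s =
    (if i = 0 then cap \<kappa> 4 s
     else if i = 1 then - 4 * sin s * cap \<kappa> 3 s
     else if i = 2 then - 4 * cos s * cap \<kappa> 3 s + 12 * (sin s)\<^sup>2 * cap \<kappa> 2 s
     else 4 * sin s * cap \<kappa> 3 s + 36 * sin s * cos s * cap \<kappa> 2 s - 24 * (sin s) ^ 3 * cap \<kappa> 1 s)"

lemma bump_cap_bump: "bump h (cap_bump (cos h))"
  unfolding bump_def
proof (intro conjI allI impI)
  fix s
  have c: "(cap (cos h) 4 has_real_derivative - (4 * sin s * cap (cos h) 3 s)) (at s)"
    "(cap (cos h) 3 has_real_derivative - (3 * sin s * cap (cos h) 2 s)) (at s)"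
    "(cap (cos h) 2 has_real_derivative - (2 * sin s * cap (cos h) 1 s)) (at s)"
    using DERIV_cap[of "cos h" 2 s] DERIV_cap[of "cos h" 1 s] DERIV_cap[of "cos h" 0 s]
    by (simp_all add: numeral_eq_Suc)
  have 0: "(cap_bump (cos h) 0 has_real_derivative cap_bump (cos h) 1 s) (at s)"
    using c(1) by (simp add: cap_bump_def[abs_def])
  have 1: "(cap_bump (cos h) 1 has_real_derivative cap_bump (cos h) 2 s) (at s)"
    unfolding cap_bump_def[abs_def]
    by (auto intro!: derivative_eq_intros c simp: power2_eq_square algebra_simps)
  have 2: "(cap_bump (cos h) 2 has_real_derivative cap_bump (cos h) 3 s) (at s)"
    unfolding cap_bump_def[abs_def]
    by (auto intro!: derivative_eq_intros c simp: power2_eq_square power3_eq_cube algebra_simps)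
  fix i :: nat assume "i < 3"
  then have "i = 0 \<or> i = 1 \<or> i = 2" by auto
  then show "(cap_bump (cos h) i has_real_derivative cap_bump (cos h) (Suc i) s) (at s)"
    using 0 1 2 by (auto simp: numeral_eq_Suc)
next
  fix i :: nat
  show "continuous_on UNIV (cap_bump (cos h) i)"
    unfolding cap_bump_def[abs_def]
    by (cases "i = 0"; cases "i = 1"; cases "i = 2") (auto intro!: continuous_intros)
  fix s
  show "cap_bump (cos h) i (s + 2 * pi) = cap_bump (cos h) i s"
    by (simp add: cap_bump_def cap_def)
  assume "cos s \<le> cos h"
  then show "cap_bump (cos h) i s = 0" by (simp add: cap_bump_def cap_def)
qed

definition energy :: "(real \<Rightarrow> real) \<Rightarrow> real" where
  "energy f = (LINT s|circle. (f s)\<^sup>2)"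

lemma energy_nonneg: "energy f \<ge> 0" by (simp add: energy_def)

lemma energy_scale: "energy (\<lambda>s. c * f s) = c\<^sup>2 * energy f"
  by (simp add: energy_def power_mult_distrib)

lemma cos_le_of_abs_ge:
  assumes "0 \<le> h" "h \<le> \<bar>s\<bar>" "\<bar>s\<bar> \<le> pi"
  shows "cos s \<le> cos h"
  using cos_monotone_0_pi_le[of h "\<bar>s\<bar>"] assms by simp

text \<open>The derivative of s f^2 has integral 0 for f = p i, since f vanishes at the ends of the period.
  Hence the energy of f is the integral of - 2 s f f', and on the support |s| \<le> h Young's
  inequality absorbs half of it.\<close>

lemma Poincare_bump:
  assumes p: "bump h p" and h: "0 < h" "h < pi" and i: "i < 3"
  shows "energy (p i) \<le> 4 * h\<^sup>2 * energy (p (Suc i))"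
proof -
  note B = bumpD[OF p]
  have ci: "continuous_on UNIV (p i)" "continuous_on UNIV (p (Suc i))" using B(2) i by auto
  have z: "p i pi = 0" "p i (- pi) = 0"
    using B(4)[of i pi] B(4)[of i "- pi"] i cos_ge_minus_one[of h] by auto
  have "(LINT s|circle. (p i s)\<^sup>2 + 2 * s * p i s * p (Suc i) s) = pi * (p i pi)\<^sup>2 - (- pi) * (p i (- pi))\<^sup>2"
  proof (rule circle_integral_FTC[where F="\<lambda>s. s * (p i s)\<^sup>2"])
    show "((\<lambda>s. s * (p i s)\<^sup>2) has_real_derivative (p i s)\<^sup>2 + 2 * s * p i s * p (Suc i) s) (at s)" for s
      using B(1)[OF i, of s] by (auto intro!: derivative_eq_intros)
    show "continuous_on UNIV (\<lambda>s. (p i s)\<^sup>2 + 2 * s * p i s * p (Suc i) s)"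
      by (intro continuous_intros ci)
  qed
  then have e: "(LINT s|circle. (p i s)\<^sup>2 + 2 * s * p i s * p (Suc i) s) = 0" by (simp add: z)
  have I: "integrable circle (\<lambda>s. (p i s)\<^sup>2)" "integrable circle (\<lambda>s. (p (Suc i) s)\<^sup>2)"
    "integrable circle (\<lambda>s. 2 * s * p i s * p (Suc i) s)"
    by (intro integrable_circle_continuous continuous_intros ci)+
  have "energy (p i) = (LINT s|circle. - (2 * s * p i s * p (Suc i) s))"
    using e I by (simp add: energy_def)
  also have "\<dots> \<le> (LINT s|circle. (p i s)\<^sup>2 / 2 + 2 * h\<^sup>2 * (p (Suc i) s)\<^sup>2)"
  proof (rule integral_mono)
    fix s assume "s \<in> space circle"
    then have s: "\<bar>s\<bar> \<le> pi" by auto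
    show "- (2 * s * p i s * p (Suc i) s) \<le> (p i s)\<^sup>2 / 2 + 2 * h\<^sup>2 * (p (Suc i) s)\<^sup>2"
    proof (cases "\<bar>s\<bar> \<le> h")
      case True
      have "0 \<le> (p i s + 2 * s * p (Suc i) s)\<^sup>2" by simp
      then have "- (2 * s * p i s * p (Suc i) s) \<le> (p i s)\<^sup>2 / 2 + 2 * s\<^sup>2 * (p (Suc i) s)\<^sup>2"
        by (simp add: power2_eq_square algebra_simps)
      moreover have "s\<^sup>2 \<le> h\<^sup>2" using True h by (metis abs_le_square_iff abs_of_pos)
      then have "s\<^sup>2 * (p (Suc i) s)\<^sup>2 \<le> h\<^sup>2 * (p (Suc i) s)\<^sup>2" by (intro mult_right_mono) auto
      ultimately show ?thesis by linarith
    next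
      case False
      then have "p i s = 0" using B(4)[of i s] cos_le_of_abs_ge[of h s] s h i by auto
      then show ?thesis by simp
    qed
  qed (use I in auto)
  also have "\<dots> = energy (p i) / 2 + 2 * h\<^sup>2 * energy (p (Suc i))"
    using I by (simp add: energy_def)
  finally show ?thesis by simp
qed

lemma energy_cap_bump_pos:
  assumes h: "0 < h" "h < pi"
  shows "energy (cap_bump (cos h) 0) > 0"
proof (rule ccontr)
  assume "\<not> ?thesis"
  then have "energy (cap_bump (cos h) 0) = 0"
    using energy_nonneg[of "cap_bump (cos h) 0"] by linarith
  then have e0: "(LINT s|circle. (cap (cos h) 4 s)\<^sup>2) = 0"
    by (simp add: energy_def cap_bump_def)
  have "integrable circle (\<lambda>s. (cap (cos h) 4 s)\<^sup>2)"
    by (intro integrable_circle_continuous continuous_intros)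
  then have "AE s in circle. (cap (cos h) 4 s)\<^sup>2 = 0"
    using e0 integral_nonneg_eq_0_iff_AE[of circle "\<lambda>s. (cap (cos h) 4 s)\<^sup>2"] by simp
  then have "AE s in lborel. s \<in> {-pi..<pi} \<longrightarrow> (cap (cos h) 4 s)\<^sup>2 = 0"
    unfolding circle_def by (subst (asm) AE_restrict_space_iff) auto
  then have "AE s in lborel. s \<notin> {- h<..<h}"
  proof (rule eventually_mono)
    fix s assume s: "s \<in> {-pi..<pi} \<longrightarrow> (cap (cos h) 4 s)\<^sup>2 = 0"
    show "s \<notin> {- h<..<h}"
    proof
      assume sh: "s \<in> {- h<..<h}"
      then have "cos h < cos \<bar>s\<bar>" using h by (intro cos_monotone_0_pi) auto
      then have "cos h < cos s" by simp
      then have "cap (cos h) 4 s > 0" by (simp add: cap_def)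
      then show False using s sh h by auto
    qed
  qed
  then have "emeasure lborel {- h<..<h} = 0" by (subst (asm) AE_iff_measurable[of "{- h<..<h}"]) auto
  then show False using h by simp
qed

text \<open>A bump does not vanish identically, and by the Poincare inequality neither do its derivatives, so
  any one of them can be normalised.\<close>

lemma normalized_bump_exists:
  assumes h: "0 < h" "h < pi" and k: "k \<le> 3"
  shows "\<exists>p. bump h p \<and> energy (p k) = 1"
proof -
  let ?q = "cap_bump (cos h)"
  have "energy (?q j) > 0" if "j \<le> 3" for j
    using that
  proof (induction j)
    case 0
    show ?case by (rule energy_cap_bump_pos[OF h])
  next
    case (Suc j)
    then have "0 < 4 * h\<^sup>2 * energy (?q (Suc j))"
      using Poincare_bump[OF bump_cap_bump h, of j] by auto
    then show ?case by (simp add: zero_less_mult_iff)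
  qed
  then have pos: "energy (?q k) > 0" using k .
  show ?thesis
  proof (intro exI conjI)
    show "bump h (\<lambda>i s. (1 / sqrt (energy (?q k))) * ?q i s)" by (rule bump_scale[OF bump_cap_bump])
    show "energy (\<lambda>s. (1 / sqrt (energy (?q k))) * ?q k s) = 1"
      unfolding energy_scale using pos by (simp add: power_divide)
  qed
qed

lemma abs_le_weighted_square:
  fixes r x :: real
  assumes "r > 0"
  shows "\<bar>x\<bar> \<le> r / 2 * x\<^sup>2 + 1 / (2 * r)"
proof -
  have "0 \<le> (r * \<bar>x\<bar> - 1)\<^sup>2 / (2 * r)" using assms by simp
  also have "\<dots> = r / 2 * x\<^sup>2 + 1 / (2 * r) - \<bar>x\<bar>"
    using assms by (simp add: power2_diff power_mult_distrib field_simps power2_eq_square)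
  finally show ?thesis by simp
qed

text \<open>The Cauchy-Schwarz inequality on a support of length 2 h, in the additive form
  |x| \<le> (sqrt h / 2) x^2 + 1 / (2 sqrt h).\<close>

lemma bump_L1:
  assumes p: "bump h p" and h: "0 < h" "h < pi" and i: "i \<le> 3"
  shows "(LINT s|circle. \<bar>p i s\<bar>) \<le> sqrt h * (energy (p i) / 2 + 1)"
proof -
  note B = bumpD[OF p]
  have ci: "continuous_on UNIV (p i)" using B(2) i by auto
  have I: "integrable circle (\<lambda>s. (p i s)\<^sup>2)" "integrable circle (\<lambda>s. \<bar>p i s\<bar>)"
    by (intro integrable_circle_continuous continuous_intros ci)+
  have Iind: "integrable circle (indicator {- h..h} :: real \<Rightarrow> real)"
    by (rule circle.integrable_const_bound[where B=1])
      (simp_all add: indicator_def[abs_def] circle_def measurable_restrict_space1)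
  have "(LINT s|circle. (indicator {- h..h} s :: real)) = (LINT s|lborel. indicator {-pi..<pi} s *\<^sub>R (indicator {- h..h} s :: real))"
    unfolding circle_def by (rule integral_restrict_space) simp
  also have "\<dots> = (LINT s|lborel. indicator {- h..h} s)"
    using h by (intro Bochner_Integration.integral_cong) (auto simp: indicator_def)
  also have "\<dots> = 2 * h" using h by simp
  finally have m: "(LINT s|circle. (indicator {- h..h} s :: real)) = 2 * h" .
  have sh: "sqrt h > 0" "sqrt h * sqrt h = h" using h by auto
  have "(LINT s|circle. \<bar>p i s\<bar>) \<le> (LINT s|circle. sqrt h / 2 * (p i s)\<^sup>2 + 1 / (2 * sqrt h) * indicator {- h..h} s)"
  proof (rule integral_mono)
    fix s assume "s \<in> space circle"
    then have s: "\<bar>s\<bar> \<le> pi" by auto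
    show "\<bar>p i s\<bar> \<le> sqrt h / 2 * (p i s)\<^sup>2 + 1 / (2 * sqrt h) * indicator {- h..h} s"
    proof (cases "s \<in> {- h..h}")
      case True
      then show ?thesis using abs_le_weighted_square[OF sh(1), of "p i s"] by simp
    next
      case False
      then have "p i s = 0" using B(4)[of i s] cos_le_of_abs_ge[of h s] s h i by auto
      then show ?thesis using False by simp
    qed
  qed (use I Iind in auto)
  also have "\<dots> = sqrt h / 2 * energy (p i) + 1 / (2 * sqrt h) * (2 * h)"
    using I Iind by (simp add: energy_def m[simplified])
  also have "1 / (2 * sqrt h) * (2 * h) = sqrt h" using sh by (simp add: real_div_sqrt)
  finally show ?thesis by (simp add: algebra_simps)
qed

section \<open>Travelling products\<close>

text \<open>A product of two profiles centred at x_c(t): it travels with unit speed in the first direction,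
  so its time derivative is a derivative of the first profile.\<close>

definition wave :: "real^2 \<Rightarrow> (real \<Rightarrow> real) \<Rightarrow> (real \<Rightarrow> real) \<Rightarrow> real \<Rightarrow> real^2 \<Rightarrow> real" where
  "wave x0 f g t x = f (x $ 1 - x0 $ 1 - t) * g (x $ 2 - x0 $ 2)"

definition wave_l2 :: "real^2 \<Rightarrow> (real \<Rightarrow> real) \<Rightarrow> (real \<Rightarrow> real) \<Rightarrow> real \<Rightarrow> real l2" where
  "wave_l2 x0 f g t = abs_l2 (wave x0 f g t)"

definition periodic_continuous :: "(real \<Rightarrow> real) \<Rightarrow> bool" where
  "periodic_continuous f \<longleftrightarrow> continuous_on UNIV f \<and> (\<forall>s. f (s + 2 * pi) = f s)"

lemma periodic_continuousD: "periodic_continuous f \<Longrightarrow> continuous_on A f" "periodic_continuous f \<Longrightarrow> f (s + 2 * pi) = f s"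
  by (auto simp: periodic_continuous_def intro: continuous_on_subset)

lemma continuous_on_wave: "periodic_continuous f \<Longrightarrow> periodic_continuous g \<Longrightarrow> continuous_on A (wave x0 f g t)"
  unfolding wave_def
  by (intro continuous_intros continuous_on_compose2[OF periodic_continuousD(1)[of f UNIV]] continuous_on_compose2[OF periodic_continuousD(1)[of g UNIV]]) auto

lemma square_integrable_wave: "periodic_continuous f \<Longrightarrow> periodic_continuous g \<Longrightarrow> square_integrable (wave x0 f g t)"
  by (intro square_integrable_continuous continuous_on_wave)

lemma circle_integral_shift2:
  assumes "continuous_on UNIV f" "\<And>s::real. f (s + 2 * pi) = f s"
  shows "(LINT s|circle. f (s - c - t) :: real) = (LINT s|circle. f s)"
  using circle_integral_shift[OF assms, of "c + t"] by (simp add: diff_diff_eq)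

lemma norm_wave_l2:
  assumes f: "periodic_continuous f" and g: "periodic_continuous g"
  shows "(norm (wave_l2 x0 f g t))\<^sup>2 = energy f * energy g"
proof -
  have "(norm (wave_l2 x0 f g t))\<^sup>2 = (LINT x|torus. (\<lambda>s. (f (s - x0 $ 1 - t))\<^sup>2) (x $ 1) * (\<lambda>s. (g (s - x0 $ 2))\<^sup>2) (x $ 2))"
    unfolding wave_l2_def norm_abs_l2[OF square_integrable_wave[OF f g]] by (simp add: wave_def power_mult_distrib)
  also have "\<dots> = (LINT s|circle. (f (s - x0 $ 1 - t))\<^sup>2) * (LINT s|circle. (g (s - x0 $ 2))\<^sup>2)"
    by (intro torus_integral_product continuous_intros continuous_on_compose2[OF periodic_continuousD(1)[OF f, of UNIV]]
      continuous_on_compose2[OF periodic_continuousD(1)[OF g, of UNIV]]) auto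
  also have "(LINT s|circle. (f (s - x0 $ 1 - t))\<^sup>2) = energy f"
    unfolding energy_def using f by (intro circle_integral_shift2[where f="\<lambda>s. (f s)\<^sup>2"] continuous_intros) (auto simp: periodic_continuous_def)
  also have "(LINT s|circle. (g (s - x0 $ 2))\<^sup>2) = energy g"
    unfolding energy_def using g by (intro circle_integral_shift[where f="\<lambda>s. (g s)\<^sup>2"] continuous_intros) (auto simp: periodic_continuous_def)
  finally show ?thesis .
qed

lemma wave_L1:
  assumes f: "periodic_continuous f" and g: "periodic_continuous g"
  shows "(LINT x|torus. \<bar>wave x0 f g t x\<bar>) = (LINT s|circle. \<bar>f s\<bar>) * (LINT s|circle. \<bar>g s\<bar>)"
proof -
  have "(LINT x|torus. \<bar>wave x0 f g t x\<bar>) = (LINT x|torus. (\<lambda>s. \<bar>f (s - x0 $ 1 - t)\<bar>) (x $ 1) * (\<lambda>s. \<bar>g (s - x0 $ 2)\<bar>) (x $ 2))"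
    by (simp add: wave_def abs_mult)
  also have "\<dots> = (LINT s|circle. \<bar>f (s - x0 $ 1 - t)\<bar>) * (LINT s|circle. \<bar>g (s - x0 $ 2)\<bar>)"
    by (intro torus_integral_product continuous_intros continuous_on_compose2[OF periodic_continuousD(1)[OF f, of UNIV]]
      continuous_on_compose2[OF periodic_continuousD(1)[OF g, of UNIV]]) auto
  also have "(LINT s|circle. \<bar>f (s - x0 $ 1 - t)\<bar>) = (LINT s|circle. \<bar>f s\<bar>)"
    using f by (intro circle_integral_shift2[where f="\<lambda>s. \<bar>f s\<bar>"] continuous_intros) (auto simp: periodic_continuous_def)
  also have "(LINT s|circle. \<bar>g (s - x0 $ 2)\<bar>) = (LINT s|circle. \<bar>g s\<bar>)"
    using g by (intro circle_integral_shift[where f="\<lambda>s. \<bar>g s\<bar>"] continuous_intros) (auto simp: periodic_continuous_def)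
  finally show ?thesis .
qed

lemma energy_le_const:
  assumes "continuous_on UNIV f" "\<And>s. s \<in> {-pi..<pi} \<Longrightarrow> \<bar>f s\<bar> \<le> c"
  shows "energy f \<le> 2 * pi * c\<^sup>2"
proof -
  have "energy f \<le> (LINT s|circle. c\<^sup>2)"
    unfolding energy_def
  proof (rule integral_mono)
    show "integrable circle (\<lambda>s. (f s)\<^sup>2)" by (intro integrable_circle_continuous continuous_intros assms)
    show "(f s)\<^sup>2 \<le> c\<^sup>2" if "s \<in> space circle" for s
      using assms(2)[of s] that by (simp add: abs_le_square_iff[symmetric])
  qed simp
  also have "\<dots> = c\<^sup>2 * pi - c\<^sup>2 * (- pi)"
    by (rule circle_integral_FTC) (auto intro!: derivative_eq_intros)
  also have "\<dots> = 2 * pi * c\<^sup>2" by simp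
  finally show ?thesis .
qed

text \<open>The derivative is uniformly continuous on a slightly enlarged period, so the remainder of
  translations is small uniformly in the point.\<close>

lemma translation_remainder:
  assumes f: "\<And>s. (f has_real_derivative f' s) (at s)" and c: "continuous_on UNIV f'" and e: "e > 0"
  shows "\<exists>d>0. \<forall>h. \<bar>h\<bar> < d \<longrightarrow> (\<forall>s\<in>{-pi - c0..pi - c0}. \<bar>f (s - h) - f s + h * f' s\<bar> \<le> e * \<bar>h\<bar>)"
proof -
  let ?K = "{- pi - c0 - 1..pi - c0 + 1}"
  have "uniformly_continuous_on ?K f'"
    using c by (intro compact_uniformly_continuous continuous_on_subset[OF c]) auto
  then obtain d where d: "d > 0" "\<And>s r. s \<in> ?K \<Longrightarrow> r \<in> ?K \<Longrightarrow> dist r s < d \<Longrightarrow> dist (f' r) (f' s) < e"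
    using e unfolding uniformly_continuous_on_def by metis
  show ?thesis
  proof (intro exI[of _ "min d 1"] conjI allI impI ballI)
    show "min d 1 > 0" using d by simp
    fix h s assume h: "\<bar>h\<bar> < min d 1" and s: "s \<in> {-pi - c0..pi - c0}"
    have seg: "r \<in> ?K \<and> dist r s < d" if "r \<in> closed_segment s (s - h)" for r
      using that h s by (auto simp: closed_segment_eq_real_ivl dist_real_def split: if_splits)
    have "norm (f (s - h) - f s - (s - h - s) *\<^sub>R f' s) \<le> norm (s - h - s) * e"
    proof (rule vector_differentiable_bound_linearization[where S="closed_segment s (s - h)" and f'=f'])
      show "(f has_vector_derivative f' r) (at r within closed_segment s (s - h))" for r
        using f[of r] by (auto simp: has_real_derivative_iff_has_vector_derivative intro: has_vector_derivative_at_within)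
      show "norm (f' r - f' s) \<le> e" if "r \<in> closed_segment s (s - h)" for r
      proof -
        have "s \<in> ?K" using seg[of s] by simp
        then have "dist (f' r) (f' s) < e" using d(2)[of s r] seg[OF that] by blast
        then show ?thesis by (simp add: dist_norm)
      qed
    qed simp_all
    then show "\<bar>f (s - h) - f s + h * f' s\<bar> \<le> e * \<bar>h\<bar>" by (simp add: mult.commute)
  qed
qed

text \<open>The remainder of the difference quotient is again a travelling product, with the remainder of the
  first profile in place of the profile, so its norm is known exactly.\<close>

lemma wave_l2_has_vector_derivative:
  assumes f: "periodic_continuous f" and f': "periodic_continuous f'" and g: "periodic_continuous g"
    and d: "\<And>s. (f has_real_derivative f' s) (at s)"
  shows "((\<lambda>t. wave_l2 x0 f g t) has_vector_derivative - wave_l2 x0 f' g t) (at t within S)"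
proof (rule has_vector_derivative_at_within)
  define G where "G = sqrt (2 * pi * energy g)"
  have G: "G \<ge> 0" by (simp add: G_def energy_nonneg)
  have rem: "\<exists>d>0. \<forall>h. \<bar>h\<bar> < d \<longrightarrow> norm (wave_l2 x0 f g (t + h) - wave_l2 x0 f g t + h *\<^sub>R wave_l2 x0 f' g t) \<le> e * \<bar>h\<bar> * G" if e: "e > 0" for e
  proof -
    obtain d0 where d0: "d0 > 0" "\<And>h s. \<bar>h\<bar> < d0 \<Longrightarrow> s \<in> {-pi - 0..pi - 0} \<Longrightarrow> \<bar>f (s - h) - f s + h * f' s\<bar> \<le> e * \<bar>h\<bar>"
      using translation_remainder[OF d periodic_continuousD(1)[OF f'] e, of 0] by blast
    show ?thesis
    proof (intro exI[of _ d0] conjI d0(1) allI impI)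
      fix h :: real assume h: "\<bar>h\<bar> < d0"
      define R where "R s = f (s - h) - f s + h * f' s" for s
      have R: "periodic_continuous R"
        unfolding periodic_continuous_def R_def using f f' periodic_continuousD(2)[OF f, of "_ - h"]
        by (auto intro!: continuous_intros continuous_on_compose2[OF periodic_continuousD(1)[OF f, of UNIV]] simp: periodic_continuous_def algebra_simps)
      have eR: "energy R \<le> 2 * pi * (e * \<bar>h\<bar>)\<^sup>2"
        using d0(2)[OF h] by (intro energy_le_const periodic_continuousD(1)[OF R]) (auto simp: R_def)
      have dec: "wave x0 R g t = (\<lambda>x. (wave x0 f g (t + h) x - wave x0 f g t x) + h *\<^sub>R wave x0 f' g t x)"
        by (simp add: fun_eq_iff wave_def R_def algebra_simps)
      have "wave_l2 x0 R g t = abs_l2 (\<lambda>x. wave x0 f g (t + h) x - wave x0 f g t x) + abs_l2 (\<lambda>x. h *\<^sub>R wave x0 f' g t x)"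
        unfolding wave_l2_def dec
        by (rule abs_l2_add[symmetric])
          (intro square_integrable_diff square_integrable_scaleR square_integrable_wave f f' g)+
      then have "wave_l2 x0 f g (t + h) - wave_l2 x0 f g t + h *\<^sub>R wave_l2 x0 f' g t = wave_l2 x0 R g t"
        by (simp only: wave_l2_def abs_l2_diff abs_l2_scaleR square_integrable_wave f f' g)
      then have "(norm (wave_l2 x0 f g (t + h) - wave_l2 x0 f g t + h *\<^sub>R wave_l2 x0 f' g t))\<^sup>2 = energy R * energy g"
        using norm_wave_l2[OF R g] by simp
      also have "\<dots> \<le> 2 * pi * (e * \<bar>h\<bar>)\<^sup>2 * energy g"
        by (intro mult_right_mono eR energy_nonneg)
      also have "\<dots> = (e * \<bar>h\<bar> * G)\<^sup>2"
        by (simp add: G_def power_mult_distrib energy_nonneg)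
      finally show "norm (wave_l2 x0 f g (t + h) - wave_l2 x0 f g t + h *\<^sub>R wave_l2 x0 f' g t) \<le> e * \<bar>h\<bar> * G"
        by (rule power2_le_imp_le) (use e G in simp)
    qed
  qed
  show "((\<lambda>t. wave_l2 x0 f g t) has_vector_derivative - wave_l2 x0 f' g t) (at t)"
    unfolding has_vector_derivative_def has_derivative_at_alt
  proof (intro conjI allI impI)
    show "bounded_linear (\<lambda>x. x *\<^sub>R - wave_l2 x0 f' g t)" by (rule bounded_linear_scaleR_left)
    fix e :: real assume e: "e > 0"
    then have "e / (G + 1) > 0" using G by simp
    then obtain d0 where d0: "d0 > 0"
      "\<And>h. \<bar>h\<bar> < d0 \<Longrightarrow> norm (wave_l2 x0 f g (t + h) - wave_l2 x0 f g t + h *\<^sub>R wave_l2 x0 f' g t) \<le> e / (G + 1) * \<bar>h\<bar> * G"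
      using rem by blast
    show "\<exists>d>0. \<forall>y. norm (y - t) < d \<longrightarrow> norm (wave_l2 x0 f g y - wave_l2 x0 f g t - (y - t) *\<^sub>R - wave_l2 x0 f' g t) \<le> e * norm (y - t)"
    proof (intro exI[of _ d0] conjI d0(1) allI impI)
      fix y assume y: "norm (y - t) < d0"
      have "e / (G + 1) * \<bar>y - t\<bar> * G = e * \<bar>y - t\<bar> * (G / (G + 1))" by simp
      also have "\<dots> \<le> e * \<bar>y - t\<bar> * 1"
        using e G by (intro mult_left_mono) auto
      finally show "norm (wave_l2 x0 f g y - wave_l2 x0 f g t - (y - t) *\<^sub>R - wave_l2 x0 f' g t) \<le> e * norm (y - t)"
        using d0(2)[of "y - t"] y by simp
    qed
  qed
qed

text \<open>A single weak partial derivative, the form in which derivatives of travelling products are fed into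
  the truncated operators.\<close>

definition weak_pd :: "2 \<Rightarrow> real l2 \<Rightarrow> real l2 \<Rightarrow> bool" where
  "weak_pd i a c \<longleftrightarrow> (\<forall>\<phi>. test_function \<phi> \<longrightarrow> a \<bullet> abs_l2 (pd i \<phi>) = - (c \<bullet> abs_l2 \<phi>))"

lemma weak_pd_add: "weak_pd i a c \<Longrightarrow> weak_pd i a' c' \<Longrightarrow> weak_pd i (a + a') (c + c')"
  and weak_pd_diff: "weak_pd i a c \<Longrightarrow> weak_pd i a' c' \<Longrightarrow> weak_pd i (a - a') (c - c')"
  and weak_pd_scaleR: "weak_pd i a c \<Longrightarrow> weak_pd i (r *\<^sub>R a) (r *\<^sub>R c)"
  by (simp_all add: weak_pd_def inner_add_left inner_diff_left)

lemma weak_pd_hproj: "weak_pd i a c \<Longrightarrow> hproj N c = hderiv i N a"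
proof -
  assume w: "weak_pd i a c"
  have z: "hderiv j N 0 = 0" for j by (rule linear_0[OF hderiv_linear])
  show ?thesis
  proof (cases "i = 1")
    case True
    then have "weak_div a 0 c" using w by (simp add: weak_div_def weak_pd_def)
    then show ?thesis using True by (simp add: weak_div_iff z)
  next
    case False
    then have "i = 2" using exhaust_2[of i] by simp
    then have "weak_div 0 a c" using w by (simp add: weak_div_def weak_pd_def)
    then show ?thesis using \<open>i = 2\<close> by (simp add: weak_div_iff z)
  qed
qed

lemma weak_pd_abs:
  assumes per: "periodic f" and cont: "continuous_on UNIV f" "continuous_on UNIV f'"
    and der: "\<And>x. ((\<lambda>s. f (x + s *\<^sub>R axis i 1)) has_real_derivative f' x) (at 0)"
  shows "weak_pd i (abs_l2 f) (abs_l2 f')"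
  unfolding weak_pd_def
proof (intro allI impI)
  fix \<phi> assume \<phi>: "test_function \<phi>"
  have sq: "square_integrable f" "square_integrable f'" "square_integrable \<phi>" "square_integrable (pd i \<phi>)"
    using cont \<phi> by (auto intro: square_integrable_continuous test_function_square_integrable)
  show "abs_l2 f \<bullet> abs_l2 (pd i \<phi>) = - (abs_l2 f' \<bullet> abs_l2 \<phi>)"
    using torus_integration_by_parts[OF \<phi> per der cont] by (simp add: inner_abs_l2 sq)
qed

lemma periodic_wave:
  assumes f: "periodic_continuous f" and g: "periodic_continuous g"
  shows "periodic (wave x0 f g t)"
  unfolding periodic_def
proof (intro allI)
  fix x :: "real^2" and i :: 2
  show "wave x0 f g t (x + axis i (2 * pi)) = wave x0 f g t x"
    using exhaust_2[of i] periodic_continuousD(2)[OF f, of "x $ 1 - x0 $ 1 - t"] periodic_continuousD(2)[OF g, of "x $ 2 - x0 $ 2"]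
    by (auto simp: wave_def axis_def algebra_simps)
qed

lemma weak_pd_wave_l2_1:
  assumes "periodic_continuous f" "periodic_continuous f'" "periodic_continuous g" "\<And>s. (f has_real_derivative f' s) (at s)"
  shows "weak_pd 1 (wave_l2 x0 f g t) (wave_l2 x0 f' g t)"
  unfolding wave_l2_def
proof (rule weak_pd_abs)
  fix x :: "real^2"
  have "((\<lambda>s. f (x $ 1 - x0 $ 1 - t + s)) has_real_derivative f' (x $ 1 - x0 $ 1 - t)) (at 0)"
    using assms(4)[of "x $ 1 - x0 $ 1 - t"] DERIV_shift[of f _ 0 "x $ 1 - x0 $ 1 - t"] by (simp add: add.commute)
  then have "((\<lambda>s. f (x $ 1 - x0 $ 1 - t + s) * g (x $ 2 - x0 $ 2)) has_real_derivative f' (x $ 1 - x0 $ 1 - t) * g (x $ 2 - x0 $ 2)) (at 0)"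
    by (rule DERIV_cmult_right)
  then show "((\<lambda>s. wave x0 f g t (x + s *\<^sub>R axis 1 1)) has_real_derivative wave x0 f' g t x) (at 0)"
    by (simp add: wave_def axis_def algebra_simps)
qed (use assms in \<open>auto intro: continuous_on_wave periodic_wave\<close>)

lemma weak_pd_wave_l2_2:
  assumes "periodic_continuous f" "periodic_continuous g" "periodic_continuous g'" "\<And>s. (g has_real_derivative g' s) (at s)"
  shows "weak_pd 2 (wave_l2 x0 f g t) (wave_l2 x0 f g' t)"
  unfolding wave_l2_def
proof (rule weak_pd_abs)
  fix x :: "real^2"
  have "((\<lambda>s. g (x $ 2 - x0 $ 2 + s)) has_real_derivative g' (x $ 2 - x0 $ 2)) (at 0)"
    using assms(4)[of "x $ 2 - x0 $ 2"] DERIV_shift[of g _ 0 "x $ 2 - x0 $ 2"] by (simp add: add.commute)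
  then have "((\<lambda>s. f (x $ 1 - x0 $ 1 - t) * g (x $ 2 - x0 $ 2 + s)) has_real_derivative f (x $ 1 - x0 $ 1 - t) * g' (x $ 2 - x0 $ 2)) (at 0)"
    by (rule DERIV_cmult)
  then show "((\<lambda>s. wave x0 f g t (x + s *\<^sub>R axis 2 1)) has_real_derivative wave x0 f g' t x) (at 0)"
    by (simp add: wave_def axis_def algebra_simps)
qed (use assms in \<open>auto intro: continuous_on_wave periodic_wave\<close>)

section \<open>Multiplication by the coefficient\<close>

lemma square_integrable_magnetic:
  fixes f :: "real^2 \<Rightarrow> real"
  assumes f: "square_integrable f" and v: "v \<in> borel_measurable torus" and M: "\<And>x. norm (v x) \<le> M"
  shows "square_integrable (\<lambda>x. f x *\<^sub>R rot (v x))"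
proof (rule square_integrable_bound[where g="\<lambda>x. M *\<^sub>R f x"])
  have "bounded_linear rot"
    by (rule bounded_linear_intro[where K=1]) (auto simp: norm_rot vec_eq_iff forall_2)
  then have "continuous_on UNIV rot" by (rule linear_continuous_on)
  then have "rot \<in> borel_measurable borel" by (rule borel_measurable_continuous_onI)
  then have "(\<lambda>x. rot (v x)) \<in> borel_measurable torus" using v by (rule measurable_compose[rotated])
  then show "(\<lambda>x. f x *\<^sub>R rot (v x)) \<in> borel_measurable torus"
    using square_integrable_measurable[OF f] by (intro borel_measurable_scaleR)
  show "square_integrable (\<lambda>x. M *\<^sub>R f x)" by (rule square_integrable_scaleR[OF f])
  show "norm (f x *\<^sub>R rot (v x)) \<le> norm (M *\<^sub>R f x)" for x
  proof -
    have "norm (v x) \<le> \<bar>M\<bar>" using M[of x] by linarith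
    then show ?thesis
      using mult_left_mono[of "norm (v x)" "\<bar>M\<bar>" "\<bar>f x\<bar>"] by (simp add: norm_rot abs_mult mult.commute)
  qed
qed

lemma magnetic_term_abs:
  assumes f: "square_integrable f" and v: "v \<in> borel_measurable torus" and M: "\<And>x. norm (v x) \<le> M"
  shows "magnetic_term v (abs_l2 f) = abs_l2 (\<lambda>x. f x *\<^sub>R rot (v x))"
  unfolding magnetic_term_def using rep_abs_l2[OF f]
  by (intro abs_l2_eqI square_integrable_magnetic[OF _ v M] rep_l2_square_integrable f) auto

lemma magnetic_term_linear:
  assumes v: "v \<in> borel_measurable torus" and M: "\<And>x. norm (v x) \<le> M"
  shows "linear (magnetic_term v)"
proof (rule linearI)
  show "magnetic_term v (b + c) = magnetic_term v b + magnetic_term v c" for b c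
  proof -
    have "magnetic_term v (abs_l2 (\<lambda>x. rep_l2 b x + rep_l2 c x)) = magnetic_term v b + magnetic_term v c"
      unfolding magnetic_term_def[of v b] magnetic_term_def[of v c]
      by (simp add: magnetic_term_abs[OF _ v M] abs_l2_add square_integrable_add rep_l2_square_integrable
          square_integrable_magnetic[OF _ v M] scaleR_add_left)
    then show ?thesis by (simp add: abs_l2_add[symmetric] rep_l2_square_integrable abs_rep_l2)
  qed
  show "magnetic_term v (r *\<^sub>R b) = r *\<^sub>R magnetic_term v b" for r b
  proof -
    have "magnetic_term v (abs_l2 (\<lambda>x. r *\<^sub>R rep_l2 b x)) = r *\<^sub>R magnetic_term v b"
      unfolding magnetic_term_def[of v b]
      unfolding magnetic_term_abs[OF square_integrable_scaleR[OF rep_l2_square_integrable] v M]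
        abs_l2_scaleR[OF square_integrable_magnetic[OF rep_l2_square_integrable v M]] by simp
    then show ?thesis by (simp only: abs_l2_scaleR[symmetric] rep_l2_square_integrable abs_rep_l2)
  qed
qed

lemma magnetic_term_norm:
  assumes v: "v \<in> borel_measurable torus" and M: "\<And>x. norm (v x) \<le> M"
  shows "norm (magnetic_term v b) \<le> M * norm b"
proof -
  have M0: "M \<ge> 0" using M[of 0] norm_ge_zero order_trans by blast
  have i: "integrable torus (\<lambda>x. (norm (rep_l2 b x))\<^sup>2)"
    using rep_l2_square_integrable[of b] by (simp add: square_integrable_def)
  have "(norm (magnetic_term v b))\<^sup>2 = (LINT x|torus. (norm (rep_l2 b x *\<^sub>R rot (v x)))\<^sup>2)"
    unfolding magnetic_term_def by (rule norm_abs_l2[OF square_integrable_magnetic[OF rep_l2_square_integrable v M]])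
  also have "\<dots> \<le> (LINT x|torus. M\<^sup>2 * (norm (rep_l2 b x))\<^sup>2)"
  proof (rule integral_mono)
    show "integrable torus (\<lambda>x. (norm (rep_l2 b x *\<^sub>R rot (v x)))\<^sup>2)"
      using square_integrable_magnetic[OF rep_l2_square_integrable v M] by (simp only: square_integrable_def)
    show "integrable torus (\<lambda>x. M\<^sup>2 * (norm (rep_l2 b x))\<^sup>2)" using i by simp
    show "(norm (rep_l2 b x *\<^sub>R rot (v x)))\<^sup>2 \<le> M\<^sup>2 * (norm (rep_l2 b x))\<^sup>2" for x
      using power_mono[OF M[of x], of 2] by (simp add: norm_rot power_mult_distrib mult.commute[of "M\<^sup>2"] mult_left_mono)
  qed
  also have "\<dots> = (M * norm b)\<^sup>2" by (simp add: norm_rep_l2 power_mult_distrib)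
  finally show ?thesis by (rule power2_le_imp_le) (use M0 in simp)
qed

text \<open>R maps e_1 to - e_2, so where the coefficient is c e_1 the induced field b R v is - c b e_2.\<close>

lemma magnetic_term_constant_on_support:
  assumes f: "square_integrable f" and v: "v \<in> borel_measurable torus" and M: "\<And>x. norm (v x) \<le> M"
    and c: "\<And>x. f x \<noteq> 0 \<Longrightarrow> v x = c *\<^sub>R e_dir"
  shows "magnetic_term v (abs_l2 f) = - c *\<^sub>R embed 2 (abs_l2 f)"
proof -
  have "magnetic_term v (abs_l2 f) = abs_l2 (\<lambda>x. f x *\<^sub>R rot (v x))"
    by (rule magnetic_term_abs[OF f v M])
  also have "(\<lambda>x. f x *\<^sub>R rot (v x)) = (\<lambda>x. (- c) *\<^sub>R (f x *\<^sub>R (axis 2 1 :: real^2)))"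
  proof
    fix x show "f x *\<^sub>R rot (v x) = (- c) *\<^sub>R (f x *\<^sub>R axis 2 1)"
      using c[of x] by (cases "f x = 0") (auto simp: vec_eq_iff forall_2 e_dir_def axis_def)
  qed
  also have "abs_l2 (\<lambda>x. (- c) *\<^sub>R (f x *\<^sub>R (axis 2 1 :: real^2))) = (- c) *\<^sub>R abs_l2 (\<lambda>x. f x *\<^sub>R (axis 2 1 :: real^2))"
    by (rule abs_l2_scaleR[OF square_integrable_embed[OF f], symmetric])
  finally show ?thesis by (simp add: embed_abs_l2[OF f])
qed

lemma continuous_slice_measurable:
  fixes u :: "real \<Rightarrow> real^2 \<Rightarrow> real^2"
  assumes u: "continuous_on ({0..} \<times> UNIV) (\<lambda>(t, x). u t x)" and t: "t \<ge> 0"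
  shows "u t \<in> borel_measurable torus"
proof -
  have "continuous_on UNIV (\<lambda>x. (\<lambda>(t, x). u t x) (t, x))"
    by (rule continuous_on_compose2[OF u]) (use t in \<open>auto intro!: continuous_intros\<close>)
  then show ?thesis by (intro measurable_torus borel_measurable_continuous_onI) simp
qed

text \<open>Dominated convergence: for a fixed square integrable b, pointwise convergence of bounded
  coefficients suffices.\<close>

lemma magnetic_term_continuous:
  fixes u :: "real \<Rightarrow> real^2 \<Rightarrow> real^2"
  assumes u: "continuous_on ({0..} \<times> UNIV) (\<lambda>(t, x). u t x)" and M: "\<And>t x. t \<ge> 0 \<Longrightarrow> norm (u t x) \<le> M"
  shows "continuous_on {0..} (\<lambda>t. magnetic_term (u t) b)"
  unfolding continuous_on_sequentially
proof (intro allI ballI impI)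
  fix s :: "nat \<Rightarrow> real" and t assume t: "t \<in> {0..}" and st: "(\<forall>n. s n \<in> {0..}) \<and> s \<longlonglongrightarrow> t"
  have sn: "s n \<ge> 0" for n using st by auto
  have t0: "t \<ge> 0" using t by simp
  let ?D = "\<lambda>n x. rep_l2 b x *\<^sub>R rot (u (s n) x) - rep_l2 b x *\<^sub>R rot (u t x)"
  have sq: "square_integrable (\<lambda>x. rep_l2 b x *\<^sub>R rot (u r x))" if "r \<ge> 0" for r
    by (rule square_integrable_magnetic[OF rep_l2_square_integrable continuous_slice_measurable[OF u] M]) (use that in auto)
  have n: "(norm (magnetic_term (u (s n)) b - magnetic_term (u t) b))\<^sup>2 = (LINT x|torus. (norm (?D n x))\<^sup>2)" for n
    unfolding magnetic_term_def abs_l2_diff[OF sq[OF sn] sq[OF t0]]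
    by (rule norm_abs_l2[OF square_integrable_diff[OF sq[OF sn] sq[OF t0]]])
  have De: "norm (?D n x) = \<bar>rep_l2 b x\<bar> * norm (u (s n) x - u t x)" for n x
  proof -
    have "?D n x = rep_l2 b x *\<^sub>R rot (u (s n) x - u t x)"
      by (simp add: vec_eq_iff forall_2 algebra_simps)
    then show ?thesis by (simp add: norm_rot)
  qed
  have "(\<lambda>n. LINT x|torus. (norm (?D n x))\<^sup>2) \<longlonglongrightarrow> (LINT x|torus. 0)"
  proof (rule integral_dominated_convergence[where w="\<lambda>x. (2 * M)\<^sup>2 * (norm (rep_l2 b x))\<^sup>2"])
    show "(\<lambda>x. (norm (?D n x))\<^sup>2) \<in> borel_measurable torus" for n
      using square_integrable_diff[OF sq[OF sn[of n]] sq[OF t0]] by (auto simp: square_integrable_def)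
    show "integrable torus (\<lambda>x. (2 * M)\<^sup>2 * (norm (rep_l2 b x))\<^sup>2)"
      using rep_l2_square_integrable[of b] by (simp add: square_integrable_def)
    show "AE x in torus. (\<lambda>n. (norm (?D n x))\<^sup>2) \<longlonglongrightarrow> 0"
    proof (rule AE_I2)
      fix x
      have "continuous_on {0..} (\<lambda>r. (\<lambda>(t, x). u t x) (r, x))"
        by (rule continuous_on_compose2[OF u]) (auto intro!: continuous_intros)
      then have "(\<lambda>n. u (s n) x) \<longlonglongrightarrow> u t x"
        using continuous_on_sequentially[of "{0..}" "\<lambda>r. u r x"] st t by (auto simp: o_def)
      then have "(\<lambda>n. (\<bar>rep_l2 b x\<bar> * norm (u (s n) x - u t x))\<^sup>2) \<longlonglongrightarrow> (\<bar>rep_l2 b x\<bar> * norm (u t x - u t x))\<^sup>2"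
        by (intro tendsto_intros)
      then show "(\<lambda>n. (norm (?D n x))\<^sup>2) \<longlonglongrightarrow> 0" by (simp add: De)
    qed
    show "AE x in torus. norm ((norm (?D n x))\<^sup>2) \<le> (2 * M)\<^sup>2 * (norm (rep_l2 b x))\<^sup>2" for n
    proof (rule AE_I2)
      fix x
      have "norm (u (s n) x - u t x) \<le> 2 * M"
        using norm_triangle_ineq4[of "u (s n) x" "u t x"] M[OF sn[of n], of x] M[OF t0, of x] by linarith
      then have "(norm (u (s n) x - u t x))\<^sup>2 \<le> (2 * M)\<^sup>2" by (intro power_mono) auto
      then show "norm ((norm (?D n x))\<^sup>2) \<le> (2 * M)\<^sup>2 * (norm (rep_l2 b x))\<^sup>2"
        unfolding De by (simp add: power_mult_distrib mult.commute[of "(rep_l2 b x)\<^sup>2"] mult_right_mono)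
    qed
  qed simp_all
  then have "(\<lambda>n. sqrt ((norm (magnetic_term (u (s n)) b - magnetic_term (u t) b))\<^sup>2)) \<longlonglongrightarrow> sqrt 0"
    unfolding n by (intro tendsto_intros) simp
  then have "(\<lambda>n. norm (magnetic_term (u (s n)) b - magnetic_term (u t) b)) \<longlonglongrightarrow> 0" by simp
  then show "((\<lambda>t. magnetic_term (u t) b) \<circ> s) \<longlonglongrightarrow> magnetic_term (u t) b"
    unfolding o_def by (simp add: tendsto_norm_zero_iff LIM_zero_iff)
qed

lemma magnetic_term_family:
  fixes u :: "real \<Rightarrow> real^2 \<Rightarrow> real^2"
  assumes u: "continuous_on ({0..} \<times> UNIV) (\<lambda>(t, x). u t x)" and M: "\<And>t x. t \<ge> 0 \<Longrightarrow> norm (u t x) \<le> M"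
  shows "strongly_continuous_family M (\<lambda>t. magnetic_term (u t))"
  unfolding strongly_continuous_family_def
  using magnetic_term_linear[OF continuous_slice_measurable[OF u] M] magnetic_term_norm[OF continuous_slice_measurable[OF u] M]
    magnetic_term_continuous[OF u M] by blast

section \<open>An amplified wave packet\<close>

lemma bump_periodic_continuous: "bump h p \<Longrightarrow> i \<le> 3 \<Longrightarrow> periodic_continuous (p i)"
  using bumpD(2,3)[of h p i] by (simp add: periodic_continuous_def)

text \<open>The cosines in the support condition of the two profiles measure the distance to the centre on the
  torus, that is, the norm of the representative in the cell.\<close>

lemma wave_support:
  assumes p: "bump h p" and q: "bump h' q" and h: "0 < h" "h < pi" "0 < h'" "h' < pi" and ij: "i \<le> 3" "j \<le> 3"
    and nz: "wave x0 (p i) (q j) t x \<noteq> 0"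
  shows "norm (wrap (x - x_c x0 t)) < h + h'"
proof -
  let ?y = "x - x_c x0 t"
  have y: "?y $ 1 = x $ 1 - x0 $ 1 - t" "?y $ 2 = x $ 2 - x0 $ 2"
    by (simp_all add: x_c_def e_dir_def axis_def)
  have "p i (?y $ 1) \<noteq> 0" "q j (?y $ 2) \<noteq> 0"
    using nz unfolding wave_def y by auto
  then have "cos h < cos (?y $ 1)" "cos h' < cos (?y $ 2)"
    using bumpD(4)[OF p ij(1), of "?y $ 1"] bumpD(4)[OF q ij(2), of "?y $ 2"] by (meson not_le)+
  then have "arccos (cos (?y $ 1)) < arccos (cos h)" "arccos (cos (?y $ 2)) < arccos (cos h')"
    by (auto intro!: arccos_less_arccos)
  then have a: "arccos (cos (?y $ 1)) < h" "arccos (cos (?y $ 2)) < h'"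
    using h by (simp_all add: arccos_cos)
  have "norm (wrap ?y) \<le> arccos (cos (?y $ 1)) + arccos (cos (?y $ 2))"
    unfolding norm_wrap_eq by (rule sqrt_sum_squares_le_sum) (auto intro: arccos_lbound)
  then show ?thesis using a by linarith
qed

lemma norm_state_le: "norm (embed 1 a + embed 2 b, c) \<le> norm a + norm b + norm c"
proof -
  have "norm (embed 1 a + embed 2 b, c) \<le> norm (embed 1 a + embed 2 b) + norm c"
    unfolding norm_Pair by (rule sqrt_sum_squares_le_sum) auto
  then show ?thesis using norm_triangle_ineq[of "embed 1 a" "embed 2 b"] by (simp add: norm_embed)
qed

lemmas l2_linear_simps = linear_add[OF hproj_linear] linear_diff[OF hproj_linear] linear_neg[OF hproj_linear] linear_cmul[OF hproj_linear]

text \<open>The profile p is used in the direction of motion and q transversally. They are normalised so that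
  p'' and q have unit energy, because the term p'' q is the one that is amplified. The support of the
  packet lies in the core, where the coefficient is the constant A e_1. The bound Q on the derivatives
  of q is fixed before the width h of p is sent to 0.\<close>

locale wave_packet =
  fixes \<Theta> :: "real \<Rightarrow> real" and r0 \<sigma> T :: real and x0 E :: "real^2" and n :: nat
    and h h' M Q :: real and p q :: "nat \<Rightarrow> real \<Rightarrow> real"
  assumes T: "T > 0" and \<sigma>: "\<sigma> > 0" and r0: "0 < r0" "r0 < pi" and prof: "cutoff_profile \<Theta>"
    and p: "bump h p" and p2: "energy (p 2) = 1" and q: "bump h' q" and q0: "energy (q 0) = 1"
    and h: "0 < h" "h \<le> 1 / 2" and h': "0 < h'" "h' \<le> 1 / 2"
    and core: "\<And>t x. t \<ge> 0 \<Longrightarrow> norm (wrap (x - x_c x0 t)) < h + h' \<Longrightarrow>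
      u_coeff \<Theta> r0 \<sigma> x0 n t x = A_coeff \<sigma> n t *\<^sub>R e_dir"
    and M: "M \<ge> 0" "\<And>t x. t \<ge> 0 \<Longrightarrow> norm (u_coeff \<Theta> r0 \<sigma> x0 n t x) \<le> M"
    and Q: "Q \<ge> 0" "\<And>j. j \<le> 3 \<Longrightarrow> energy (q j) \<le> Q\<^sup>2"
begin

abbreviation "u \<equiv> u_coeff \<Theta> r0 \<sigma> x0 n"
abbreviation "A \<equiv> A_coeff \<sigma> n"

lemma pi_bounds: "h < pi" "h' < pi"
  using h h' pi_gt3 by linarith+

definition \<delta> :: real where "\<delta> = exp (- real n)"
text \<open>The linear amplitude solves a' / a = 1 / (t + \<delta>), the growth rate that the coefficient was
  designed to produce.\<close>

definition amp :: "real \<Rightarrow> real" where "amp t = (t + \<delta>) / (2 * T)"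
definition amp' :: real where "amp' = 1 / (2 * T)"
definition amp_max :: real where "amp_max = (T + \<delta>) / (2 * T)"

text \<open>With g = p \<otimes> q this is the derivative of order i in the direction of motion and of order j
  transversally of the moving profile g(x - x_c(t)).\<close>

definition K :: "nat \<Rightarrow> nat \<Rightarrow> real \<Rightarrow> real l2" where
  "K i j t = wave_l2 x0 (p i) (q j) t"

definition background :: "(real^2) l2" where "background = abs_l2 (\<lambda>_. E)"

text \<open>E1, E2 and b are the fields of the potential \<gamma>(t, x) = amp(t) g(x - x_c(t)), namely
  E = R grad \<partial>_t \<gamma> and b = \<Delta> \<gamma>. For every potential these satisfy Faraday's law
  \<partial>_t b + curl E = 0, because curl (R grad f) = - \<Delta> f, so only Ampere's law leaves a residual.\<close>

definition E1 :: "real \<Rightarrow> real l2" where "E1 t = amp' *\<^sub>R K 0 1 t - amp t *\<^sub>R K 1 1 t"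
definition E2 :: "real \<Rightarrow> real l2" where "E2 t = amp t *\<^sub>R K 2 0 t - amp' *\<^sub>R K 1 0 t"
definition b :: "real \<Rightarrow> real l2" where "b t = amp t *\<^sub>R (K 2 0 t + K 0 2 t)"

definition Y :: "real \<Rightarrow> state" where
  "Y t = (exp (- \<sigma> * t) *\<^sub>R background + (embed 1 (E1 t) + embed 2 (E2 t)), b t)"

text \<open>The time derivative of Y: each time derivative of a moving profile trades for - \<partial>_1, and the
  amplitude is linear, so amp' is constant.\<close>

definition Y' :: "real \<Rightarrow> state" where
  "Y' t = ((- \<sigma> * exp (- \<sigma> * t)) *\<^sub>R background
      + (embed 1 (amp t *\<^sub>R K 2 1 t - (2 * amp') *\<^sub>R K 1 1 t) + embed 2 ((2 * amp') *\<^sub>R K 2 0 t - amp t *\<^sub>R K 3 0 t)),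
    amp' *\<^sub>R (K 2 0 t + K 0 2 t) - amp t *\<^sub>R (K 3 0 t + K 1 2 t))"

text \<open>The value at Y of the generator; its second component coincides with that of the time derivative,
  which is Faraday's law.\<close>

definition AY :: "real \<Rightarrow> state" where
  "AY t = ((- \<sigma> * exp (- \<sigma> * t)) *\<^sub>R background
      + (embed 1 (amp t *\<^sub>R (K 2 1 t + K 0 3 t) - \<sigma> *\<^sub>R E1 t) + embed 2 (- (amp t *\<^sub>R (K 3 0 t + K 1 2 t)) - \<sigma> *\<^sub>R E2 t)),
    amp' *\<^sub>R (K 2 0 t + K 0 2 t) - amp t *\<^sub>R (K 3 0 t + K 1 2 t))"

definition magB :: "real \<Rightarrow> state \<Rightarrow> state" where
  "magB t X = (- (\<sigma> *\<^sub>R magnetic_term (u t) (snd X)), 0)"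

lemma delta_pos: "\<delta> > 0" by (simp add: \<delta>_def)

lemma amp_bounds:
  assumes "t \<in> {0..T}"
  shows "0 \<le> amp t" "amp t \<le> amp_max"
  using assms delta_pos T by (auto simp: amp_def amp_max_def divide_right_mono)

lemma amp'_pos: "amp' > 0" using T by (simp add: amp'_def)

text \<open>This is \<sigma> (A - 1) a = 2 a': the terms p'' q in Ampere's law, from \<partial>_t^2 \<gamma>, from damping and from the
  motion of the conductor, cancel.\<close>

lemma growth_balance: "t \<ge> 0 \<Longrightarrow> \<sigma> * A t * amp t = 2 * amp' + \<sigma> * amp t"
proof -
  assume t: "t \<ge> 0"
  have td: "t + \<delta> \<noteq> 0" using t delta_pos by simp
  have "\<sigma> * A t = \<sigma> + 2 / (t + \<delta>)"
  proof -
    have "\<sigma> * (2 / (\<sigma> * (t + \<delta>))) = 2 / (t + \<delta>)" using \<sigma> by simp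
    then show ?thesis by (simp only: A_coeff_def \<delta>_def[symmetric] distrib_left mult_1_right)
  qed
  then have "\<sigma> * A t * amp t = \<sigma> * amp t + 2 / (t + \<delta>) * amp t" by (simp add: distrib_right)
  also have "2 / (t + \<delta>) * amp t = 2 * amp'"
  proof -
    have "2 / d * (d / (2 * T)) = 2 * (1 / (2 * T))" if "d \<noteq> 0" for d using that T by (simp add: field_simps)
    from this[OF td] show ?thesis by (simp only: amp_def amp'_def)
  qed
  finally show ?thesis by simp
qed

lemma K_derivative:
  assumes "i \<le> 2" "j \<le> 3"
  shows "(K i j has_vector_derivative - K (Suc i) j t) (at t within S)"
  unfolding K_def using assms
  by (intro wave_l2_has_vector_derivative bump_periodic_continuous[OF p] bump_periodic_continuous[OF q] bumpD(1)[OF p]) auto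

lemma weak_pd_K1: "i \<le> 2 \<Longrightarrow> j \<le> 3 \<Longrightarrow> weak_pd 1 (K i j t) (K (Suc i) j t)"
  unfolding K_def
  by (intro weak_pd_wave_l2_1 bump_periodic_continuous[OF p] bump_periodic_continuous[OF q] bumpD(1)[OF p]) auto

lemma weak_pd_K2: "i \<le> 3 \<Longrightarrow> j \<le> 2 \<Longrightarrow> weak_pd 2 (K i j t) (K i (Suc j) t)"
  unfolding K_def
  by (intro weak_pd_wave_l2_2 bump_periodic_continuous[OF p] bump_periodic_continuous[OF q] bumpD(1)[OF q]) auto

lemma norm_K: "i \<le> 3 \<Longrightarrow> j \<le> 3 \<Longrightarrow> (norm (K i j t))\<^sup>2 = energy (p i) * energy (q j)"
  unfolding K_def by (intro norm_wave_l2 bump_periodic_continuous[OF p] bump_periodic_continuous[OF q]) auto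

text \<open>Compared with the unit energy of p'', the Poincare inequality gains a factor of order h for p' and,
  since 4 h^2 \<le> 1, at least the same for p.\<close>

lemma norm_K_small:
  assumes "i \<le> 1" "j \<le> 3"
  shows "norm (K i j t) \<le> 2 * h * Q"
proof -
  have 1: "energy (p 1) \<le> 4 * h\<^sup>2"
    using Poincare_bump[OF p h(1) pi_bounds(1), of 1] p2 by (simp add: numeral_2_eq_2)
  have "energy (p 0) \<le> 4 * h\<^sup>2 * energy (p 1)"
    using Poincare_bump[OF p h(1) pi_bounds(1), of 0] by simp
  also have "\<dots> \<le> 1 * energy (p 1)"
  proof (rule mult_right_mono[OF _ energy_nonneg])
    have "h\<^sup>2 \<le> (1 / 2)\<^sup>2" using h by (intro power_mono) auto
    then show "4 * h\<^sup>2 \<le> 1" by (simp add: power2_eq_square)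
  qed
  finally have 0: "energy (p 0) \<le> 4 * h\<^sup>2" using 1 by simp
  have "i = 0 \<or> i = 1" using assms by auto
  then have "energy (p i) \<le> 4 * h\<^sup>2" using 0 1 by auto
  then have "energy (p i) * energy (q j) \<le> 4 * h\<^sup>2 * Q\<^sup>2"
    using Q assms by (intro mult_mono energy_nonneg) auto
  then have "(norm (K i j t))\<^sup>2 \<le> (2 * h * Q)\<^sup>2"
    using assms by (simp add: norm_K power_mult_distrib)
  then show ?thesis by (rule power2_le_imp_le) (use h Q in simp)
qed

lemma Y_derivative: "(Y has_vector_derivative Y' t) (at t within S)"
proof -
  have ohm: "((\<lambda>t. exp (- \<sigma> * t) *\<^sub>R background) has_vector_derivative (- \<sigma> * exp (- \<sigma> * t)) *\<^sub>R background) (at t within S)"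
  proof -
    have "((\<lambda>t. exp (- \<sigma> * t)) has_real_derivative - \<sigma> * exp (- \<sigma> * t)) (at t within S)"
      by (auto intro!: derivative_eq_intros)
    from has_vector_derivative_scaleR[OF this has_vector_derivative_const, of background] show ?thesis by simp
  qed
  have amp: "(amp has_real_derivative amp') (at t within S)"
    unfolding amp_def[abs_def] amp'_def using T by (auto intro!: derivative_eq_intros)
  have const: "((\<lambda>t. amp' *\<^sub>R f t) has_vector_derivative amp' *\<^sub>R f') (at t within S)"
    if "(f has_vector_derivative f') (at t within S)" for f and f' :: "real l2"
    by (rule bounded_linear.has_vector_derivative[OF bounded_linear_scaleR_right that])
  have dK: "(K 0 1 has_vector_derivative - K 1 1 t) (at t within S)"
    "(K 1 1 has_vector_derivative - K 2 1 t) (at t within S)"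
    "(K 2 0 has_vector_derivative - K 3 0 t) (at t within S)"
    "(K 1 0 has_vector_derivative - K 2 0 t) (at t within S)"
    "(K 0 2 has_vector_derivative - K 1 2 t) (at t within S)"
    using K_derivative[of 0 1 t S] K_derivative[of 1 1 t S] K_derivative[of 2 0 t S]
      K_derivative[of 1 0 t S] K_derivative[of 0 2 t S]
    by (simp_all add: numeral_eq_Suc)
  have e1: "(E1 has_vector_derivative (amp t *\<^sub>R K 2 1 t - (2 * amp') *\<^sub>R K 1 1 t)) (at t within S)"
  proof -
    have "amp t *\<^sub>R K 2 1 t - (2 * amp') *\<^sub>R K 1 1 t
        = amp' *\<^sub>R - K 1 1 t - (amp t *\<^sub>R - K 2 1 t + amp' *\<^sub>R K 1 1 t)"
      unfolding mult_2 scaleR_add_left by (simp add: algebra_simps)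
    then show ?thesis
      unfolding E1_def[abs_def]
      using has_vector_derivative_diff[OF const[OF dK(1)] has_vector_derivative_scaleR[OF amp dK(2)]] by (simp only:)
  qed
  have e2: "(E2 has_vector_derivative ((2 * amp') *\<^sub>R K 2 0 t - amp t *\<^sub>R K 3 0 t)) (at t within S)"
  proof -
    have "(2 * amp') *\<^sub>R K 2 0 t - amp t *\<^sub>R K 3 0 t
        = (amp t *\<^sub>R - K 3 0 t + amp' *\<^sub>R K 2 0 t) - amp' *\<^sub>R - K 2 0 t"
      unfolding mult_2 scaleR_add_left by (simp add: algebra_simps)
    then show ?thesis
      unfolding E2_def[abs_def]
      using has_vector_derivative_diff[OF has_vector_derivative_scaleR[OF amp dK(3)] const[OF dK(4)]] by (simp only:)
  qed
  have bb: "(b has_vector_derivative (amp' *\<^sub>R (K 2 0 t + K 0 2 t) - amp t *\<^sub>R (K 3 0 t + K 1 2 t))) (at t within S)"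
  proof -
    have "amp' *\<^sub>R (K 2 0 t + K 0 2 t) - amp t *\<^sub>R (K 3 0 t + K 1 2 t)
        = amp t *\<^sub>R (- K 3 0 t + - K 1 2 t) + amp' *\<^sub>R (K 2 0 t + K 0 2 t)"
      by (simp add: algebra_simps)
    then show ?thesis
      unfolding b_def[abs_def]
      using has_vector_derivative_scaleR[OF amp has_vector_derivative_add[OF dK(3) dK(5)]] by (simp only:)
  qed
  show ?thesis
    unfolding Y_def[abs_def] Y'_def
    by (intro has_vector_derivative_Pair has_vector_derivative_add ohm bb
        bounded_linear.has_vector_derivative[OF embed_bounded_linear e1]
        bounded_linear.has_vector_derivative[OF embed_bounded_linear e2])
qed

lemma weak_pd_const: "weak_pd j (r *\<^sub>R component i background) 0"
proof -
  have "component i background = abs_l2 (\<lambda>_. E $ i)"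
    unfolding background_def by (rule component_abs_l2) (rule square_integrable_continuous, simp)
  moreover have "weak_pd j (abs_l2 (\<lambda>_. E $ i)) (abs_l2 (\<lambda>_. 0))"
    by (rule weak_pd_abs) (auto simp: periodic_def)
  ultimately have "weak_pd j (component i background) 0" by (simp add: abs_l2_zero)
  from weak_pd_scaleR[OF this, of r] show ?thesis by simp
qed

text \<open>All entries of AY are weak derivatives of entries of Y, and weak derivatives have the coefficients
  of the truncated derivatives.\<close>

lemma mode_op_Y: "mode_proj N (AY t) = mode_op \<sigma> N (Y t)"
proof -
  let ?c = "exp (- (\<sigma> * t))"
  have "weak_pd 2 (b t) (amp t *\<^sub>R (K 2 1 t + K 0 3 t))"
    unfolding b_def using weak_pd_K2[of 2 0 t] weak_pd_K2[of 0 2 t]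
    by (intro weak_pd_scaleR weak_pd_add) (simp_all add: numeral_eq_Suc)
  note d2 = weak_pd_hproj[OF this, of N]
  have "weak_pd 1 (b t) (amp t *\<^sub>R (K 3 0 t + K 1 2 t))"
    unfolding b_def using weak_pd_K1[of 2 0 t] weak_pd_K1[of 0 2 t]
    by (intro weak_pd_scaleR weak_pd_add) (simp_all add: numeral_eq_Suc)
  note d1 = weak_pd_hproj[OF this, of N]
  have "weak_pd 2 (?c *\<^sub>R component 1 background + E1 t) (0 + (amp' *\<^sub>R K 0 2 t - amp t *\<^sub>R K 1 2 t))"
    unfolding E1_def using weak_pd_K2[of 0 1 t] weak_pd_K2[of 1 1 t]
    by (intro weak_pd_add weak_pd_const weak_pd_diff weak_pd_scaleR) (simp_all add: numeral_eq_Suc)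
  note dE1 = weak_pd_hproj[OF this, of N]
  have "weak_pd 1 (?c *\<^sub>R component 2 background + E2 t) (0 + (amp t *\<^sub>R K 3 0 t - amp' *\<^sub>R K 2 0 t))"
    unfolding E2_def using weak_pd_K1[of 2 0 t] weak_pd_K1[of 1 0 t]
    by (intro weak_pd_add weak_pd_const weak_pd_diff weak_pd_scaleR) (simp_all add: numeral_eq_Suc)
  note dE2 = weak_pd_hproj[OF this, of N]
  show ?thesis
    unfolding state_eq_iff component_mode_proj component_mode_op
    by (simp add: Y_def AY_def component_simps d1[symmetric] d2[symmetric] dE1[symmetric] dE2[symmetric] l2_linear_simps
        scaleR_add_right scaleR_diff_right)
qed

lemmas u_measurable = continuous_slice_measurable[OF u_coeff_continuous[OF prof r0 \<sigma>]]

lemma magB_family: "strongly_continuous_family (\<sigma> * M) magB"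
  unfolding strongly_continuous_family_def
proof (intro conjI allI impI)
  fix t :: real assume t: "t \<ge> 0"
  have l: "linear (magnetic_term (u t))" by (rule magnetic_term_linear[OF u_measurable[OF t] M(2)[OF t]])
  show "linear (magB t)"
    by (rule linearI) (simp_all add: magB_def linear_add[OF l] linear_cmul[OF l] scaleR_add_right)
  show "norm (magB t X) \<le> \<sigma> * M * norm X" for X
  proof -
    have "norm (magB t X) = \<sigma> * norm (magnetic_term (u t) (snd X))"
      using \<sigma> by (simp add: magB_def norm_Pair)
    also have "\<dots> \<le> \<sigma> * (M * norm (snd X))"
      using magnetic_term_norm[OF u_measurable[OF t] M(2)[OF t], of "snd X"] \<sigma> by (intro mult_left_mono) auto
    also have "\<dots> \<le> \<sigma> * (M * norm X)"
      using \<sigma> M norm_snd_le[where x="fst X" and y="snd X"] by (intro mult_left_mono) simp_all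
    finally show ?thesis by (simp add: mult.assoc)
  qed
next
  show "continuous_on {0..} (\<lambda>t. magB t X)" for X
    unfolding magB_def
    by (intro continuous_intros magnetic_term_continuous[OF u_coeff_continuous[OF prof r0 \<sigma>] M(2)])
qed

lemma magnetic_term_K:
  assumes t: "t \<ge> 0" and ij: "i \<le> 3" "j \<le> 3"
  shows "magnetic_term (u t) (K i j t) = - A t *\<^sub>R embed 2 (K i j t)"
  unfolding K_def wave_l2_def
proof (rule magnetic_term_constant_on_support[OF _ u_measurable[OF t] M(2)[OF t]])
  show "square_integrable (wave x0 (p i) (q j) t)"
    using ij by (intro square_integrable_wave bump_periodic_continuous[OF p] bump_periodic_continuous[OF q]) auto
  show "u t x = A t *\<^sub>R e_dir" if "wave x0 (p i) (q j) t x \<noteq> 0" for x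
    by (rule core[OF t wave_support[OF p q h(1) pi_bounds(1) h'(1) pi_bounds(2) ij that]])
qed

lemma magnetic_term_b:
  assumes t: "t \<ge> 0"
  shows "magnetic_term (u t) (b t) = - (A t * amp t) *\<^sub>R embed 2 (K 2 0 t + K 0 2 t)"
proof -
  have l: "linear (magnetic_term (u t))" by (rule magnetic_term_linear[OF u_measurable[OF t] M(2)[OF t]])
  show ?thesis
    unfolding b_def linear_cmul[OF l] linear_add[OF l] linear_add[OF embed_linear]
    by (simp add: magnetic_term_K[OF t] algebra_simps)
qed

text \<open>What is left of Ampere's law. Every term has at most one derivative in the direction of motion.\<close>

definition residual :: "real \<Rightarrow> state" where
  "residual t = (embed 1 (\<sigma> *\<^sub>R E1 t - (2 * amp') *\<^sub>R K 1 1 t - amp t *\<^sub>R K 0 3 t) +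
     embed 2 (amp t *\<^sub>R K 1 2 t - (\<sigma> * amp') *\<^sub>R K 1 0 t - (2 * amp' + \<sigma> * amp t) *\<^sub>R K 0 2 t), 0)"

text \<open>Travelling at unit speed, the packet satisfies (\<partial>_t^2 - \<partial>_1^2) g = 0, so the terms with three
  derivatives in the direction of motion cancel. Those with two such derivatives cancel by the growth
  balance.\<close>

lemma residual_eq:
  assumes t: "t \<ge> 0"
  shows "Y' t - AY t - magB t (Y t) = residual t"
proof -
  have g: "\<sigma> * (A t * amp t) = 2 * amp' + \<sigma> * amp t"
    using growth_balance[OF t] by (simp add: mult.assoc)
  have m: "\<sigma> *\<^sub>R magnetic_term (u t) (b t) = - ((2 * amp' + \<sigma> * amp t) *\<^sub>R embed 2 (K 2 0 t + K 0 2 t))"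
    unfolding magnetic_term_b[OF t] by (simp add: g[symmetric])
  show ?thesis
    unfolding state_eq_iff
    by (simp add: Y'_def AY_def magB_def Y_def residual_def m component_simps E2_def algebra_simps)
qed

definition small :: real where "small = 2 * h * Q"

lemma small_nonneg: "small \<ge> 0" using h Q by (simp add: small_def)

lemma E1_small:
  assumes t: "t \<in> {0..T}"
  shows "norm (E1 t) \<le> (amp' + amp_max) * small"
proof -
  have "norm (E1 t) \<le> amp' * norm (K 0 1 t) + amp t * norm (K 1 1 t)"
    unfolding E1_def using norm_triangle_ineq4[of "amp' *\<^sub>R K 0 1 t" "amp t *\<^sub>R K 1 1 t"] amp'_pos amp_bounds[OF t] by simp
  also have "\<dots> \<le> amp' * small + amp_max * small"
    unfolding small_def using norm_K_small[of 0 1 t] norm_K_small[of 1 1 t] amp'_pos amp_bounds[OF t]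
    by (intro add_mono mult_mono) auto
  finally show ?thesis by (simp add: distrib_right)
qed

definition Cres :: real where
  "Cres = \<sigma> * (amp' + amp_max) + 2 * amp' + amp_max + amp_max + \<sigma> * amp' + (2 * amp' + \<sigma> * amp_max)"

lemma Cres_nonneg: "Cres \<ge> 0"
  using \<sigma> amp'_pos amp_bounds[of 0] T by (simp add: Cres_def)

lemma residual_small:
  assumes t: "t \<in> {0..T}"
  shows "norm (residual t) \<le> Cres * small"
proof -
  note ab = amp_bounds[OF t]
  note ks = norm_K_small[of 1 1 t] norm_K_small[of 0 3 t] norm_K_small[of 1 2 t] norm_K_small[of 1 0 t] norm_K_small[of 0 2 t]
  have tri: "norm (x - y - z) \<le> norm x + norm y + norm z" for x y z :: "real l2"
    using norm_triangle_ineq4[of "x - y" z] norm_triangle_ineq4[of x y] by linarith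
  have "norm (residual t) \<le> norm (\<sigma> *\<^sub>R E1 t - (2 * amp') *\<^sub>R K 1 1 t - amp t *\<^sub>R K 0 3 t)
     + norm (amp t *\<^sub>R K 1 2 t - (\<sigma> * amp') *\<^sub>R K 1 0 t - (2 * amp' + \<sigma> * amp t) *\<^sub>R K 0 2 t) + norm (0 :: real l2)"
    unfolding residual_def by (rule norm_state_le)
  also have "\<dots> \<le> (\<sigma> * norm (E1 t) + (2 * amp') * norm (K 1 1 t) + amp t * norm (K 0 3 t))
     + (amp t * norm (K 1 2 t) + (\<sigma> * amp') * norm (K 1 0 t) + (2 * amp' + \<sigma> * amp t) * norm (K 0 2 t)) + 0"
    using tri[of "\<sigma> *\<^sub>R E1 t" "(2 * amp') *\<^sub>R K 1 1 t" "amp t *\<^sub>R K 0 3 t"]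
      tri[of "amp t *\<^sub>R K 1 2 t" "(\<sigma> * amp') *\<^sub>R K 1 0 t" "(2 * amp' + \<sigma> * amp t) *\<^sub>R K 0 2 t"] \<sigma> amp'_pos ab
    by (intro add_mono) simp_all
  also have "\<dots> \<le> (\<sigma> * ((amp' + amp_max) * small) + (2 * amp') * small + amp_max * small)
     + (amp_max * small + (\<sigma> * amp') * small + (2 * amp' + \<sigma> * amp_max) * small) + 0"
    using E1_small[OF t] ks \<sigma> amp'_pos ab small_nonneg unfolding small_def[symmetric]
    by (intro add_mono mult_mono) (auto intro!: add_nonneg_nonneg mult_nonneg_nonneg)
  also have "\<dots> = Cres * small" by (simp add: Cres_def algebra_simps)
  finally show ?thesis .
qed

text \<open>The part amp p'' q of b, which is also the leading part of E2. It alone survives as h tends to 0.\<close>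

definition \<beta> :: "real \<Rightarrow> real^2 \<Rightarrow> real" where
  "\<beta> t x = amp t * wave x0 (p 2) (q 0) t x"

lemma square_integrable_wave20: "square_integrable (wave x0 (p 2) (q 0) t)"
  by (intro square_integrable_wave bump_periodic_continuous[OF p] bump_periodic_continuous[OF q]) auto

lemma continuous_beta: "continuous_on UNIV (\<beta> t)"
  unfolding \<beta>_def
  by (intro continuous_intros continuous_on_wave bump_periodic_continuous[OF p] bump_periodic_continuous[OF q]) auto

lemma abs_beta: "abs_l2 (\<beta> t) = amp t *\<^sub>R K 2 0 t"
  using abs_l2_scaleR[OF square_integrable_wave20, of "amp t" t] by (simp add: \<beta>_def[abs_def] K_def wave_l2_def)

lemma norm_beta: "(norm (abs_l2 (\<beta> t)))\<^sup>2 = (amp t)\<^sup>2"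
  using norm_K[of 2 0 t] by (simp add: abs_beta power_mult_distrib p2 q0)

lemma beta_support: "\<beta> t x \<noteq> 0 \<Longrightarrow> norm (wrap (x - x_c x0 t)) < h + h'"
  by (rule wave_support[OF p q h(1) pi_bounds(1) h'(1) pi_bounds(2), of 2 0]) (auto simp: \<beta>_def)

lemma beta_L1:
  assumes t: "t \<in> {0..T}"
  shows "(LINT x|torus. \<bar>\<beta> t x\<bar>) \<le> amp_max * (sqrt h * (3 / 2) * (3 / 2))"
proof -
  have "(LINT x|torus. \<bar>\<beta> t x\<bar>) = amp t * ((LINT s|circle. \<bar>p 2 s\<bar>) * (LINT s|circle. \<bar>q 0 s\<bar>))"
    using amp_bounds[OF t] wave_L1[OF bump_periodic_continuous[OF p] bump_periodic_continuous[OF q], of 2 0 x0 t]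
    by (simp add: \<beta>_def abs_mult)
  also have "\<dots> \<le> amp_max * (sqrt h * (3 / 2) * (3 / 2))"
  proof (intro mult_mono)
    show "(LINT s|circle. \<bar>p 2 s\<bar>) \<le> sqrt h * (3 / 2)"
      using bump_L1[OF p h(1) pi_bounds(1), of 2] p2 by simp
    have "sqrt h' \<le> 1" using h' by simp
    then have "sqrt h' * (3 / 2) \<le> 1 * (3 / 2)" by (intro mult_right_mono) auto
    moreover have "(LINT s|circle. \<bar>q 0 s\<bar>) \<le> sqrt h' * (3 / 2)"
      using bump_L1[OF q h'(1) pi_bounds(2), of 0] q0 by simp
    ultimately show "(LINT s|circle. \<bar>q 0 s\<bar>) \<le> 3 / 2" by linarith
  qed (use amp_bounds[OF t] h in \<open>auto intro!: mult_nonneg_nonneg\<close>)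
  finally show ?thesis .
qed

text \<open>The growth factor of the Volterra equation times the constant of the residual: exact and approximate
  solution differ by at most Gain * small.\<close>

definition Gain :: real where "Gain = 2 * Cres * exp ((2 * (\<sigma> * M) + 1) * T)"

definition Cerr :: real where
  "Cerr = (amp' + amp_max) + amp' + amp_max + Gain + \<sigma> * ((amp' + amp_max) + amp' + A 0 * amp_max + Gain + M * Gain)"

lemma ohmic_state_eq: "ohmic_state \<sigma> E t = (exp (- \<sigma> * t) *\<^sub>R background, 0)"
proof -
  have "abs_l2 (\<lambda>_. exp (- \<sigma> * t) *\<^sub>R E) = exp (- \<sigma> * t) *\<^sub>R background"
    unfolding background_def by (rule abs_l2_scaleR[symmetric]) (rule square_integrable_continuous, simp)
  then show ?thesis by (simp add: ohmic_state_def)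
qed

text \<open>The exact solution with the initial state of Y differs from Y by at most a constant times the
  residual; the constant depends on n through the bound M of the coefficient, but not on h. All entries of Y other
  than the Ohmic background and the two copies of \<beta> carry at most one derivative of p and are
  small as well.\<close>

theorem exact_solution:
  "\<exists>X. energy_solution \<sigma> T u X \<and> X 0 = Y 0 \<and> (\<forall>t\<in>{0..T}.
     norm (X t - ohmic_state \<sigma> E t - (embed 2 (abs_l2 (\<beta> t)), abs_l2 (\<beta> t))) \<le> Cerr * small \<and>
     norm (current \<sigma> (u t) (X t) - \<sigma> *\<^sub>R fst (ohmic_state \<sigma> E t) - (\<sigma> * (1 - A t)) *\<^sub>R embed 2 (abs_l2 (\<beta> t))) \<le> Cerr * small)"
proof -
  interpret sg: spectral_generator mode_proj "mode_op \<sigma>"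
    using \<sigma> by (intro spectral_generator_mode_op) simp
  have Kc: "continuous_on {0..T} (K i j)" if "i \<le> 2" "j \<le> 3" for i j
    unfolding continuous_on_eq_continuous_within
    using K_derivative[OF that] by (auto intro: has_vector_derivative_continuous)
  have ampc: "continuous_on {0..T} amp"
    unfolding amp_def using T by (intro continuous_intros) auto
  have E1c: "continuous_on {0..T} E1"
    unfolding E1_def by (intro continuous_intros Kc ampc) auto
  have Yc: "continuous_on {0..T} Y"
    unfolding continuous_on_eq_continuous_within using Y_derivative by (auto intro: has_vector_derivative_continuous)
  have "continuous_on {0..T} (\<lambda>t. residual t + magB t (Y t))"
    unfolding residual_def
    by (intro continuous_intros continuous_on_family_apply[OF magB_family] Yc E1c Kc ampc
        bounded_linear.continuous_on[OF embed_bounded_linear]) auto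
  then have cont: "continuous_on {0..T} (\<lambda>t. Y' t - AY t)"
  proof (rule continuous_on_eq)
    show "residual t + magB t (Y t) = Y' t - AY t" if "t \<in> {0..T}" for t
      using residual_eq[of t] that by (simp add: algebra_simps)
  qed
  have res: "norm (Y' t - AY t - magB t (Y t)) \<le> Cres * small" if "t \<in> {0..T}" for t
    using residual_small[OF that] residual_eq[of t] that by simp
  have "\<exists>X. continuous_on {0..T} X \<and> X 0 = Y 0 \<and>
    (\<forall>t\<in>{0..T}. ((\<lambda>s. sg.evolution (t - s) (magB s (X s))) has_integral (X t - sg.evolution t (X 0))) {0..t}) \<and>
    (\<forall>t\<in>{0..T}. norm (X t - Y t) \<le> 2 * (Cres * small) * exp ((2 * (\<sigma> * M) + 1) * T))"
    by (rule sg.exact_near_approximate[OF _ Y_derivative mode_op_Y magB_family _ cont res])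
      (use T \<sigma> M in auto)
  then obtain X where X: "continuous_on {0..T} X \<and> X 0 = Y 0 \<and>
    (\<forall>t\<in>{0..T}. ((\<lambda>s. sg.evolution (t - s) (magB s (X s))) has_integral (X t - sg.evolution t (X 0))) {0..t}) \<and>
    (\<forall>t\<in>{0..T}. norm (X t - Y t) \<le> 2 * (Cres * small) * exp ((2 * (\<sigma> * M) + 1) * T))"
    by (rule exE)
  note Xc = conjunct1[OF X] and X0 = conjunct1[OF conjunct2[OF X]]
    and XI = conjunct1[OF conjunct2[OF conjunct2[OF X]]]
    and XY = conjunct2[OF conjunct2[OF conjunct2[OF X]]]
  have Z: "norm (X t - Y t) \<le> Gain * small" if "t \<in> {0..T}" for t
    using XY that by (simp add: Gain_def mult_ac)
  have es: "energy_solution \<sigma> T u X"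
    unfolding energy_solution_def
  proof (intro conjI exI[of _ sg.evolution])
    show "generator sg.evolution = maxwell_ohm_operator \<sigma>"
      unfolding sg.generator_evolution maxwell_ohm_operator_spectral ..
    show "mild_solution sg.evolution \<sigma> T u X"
      unfolding mild_solution_def using XI unfolding magB_def .
  qed (rule Xc sg.contraction_semigroup_evolution)+
  have est: "norm (X t - ohmic_state \<sigma> E t - (embed 2 (abs_l2 (\<beta> t)), abs_l2 (\<beta> t))) \<le> Cerr * small \<and>
     norm (current \<sigma> (u t) (X t) - \<sigma> *\<^sub>R fst (ohmic_state \<sigma> E t) - (\<sigma> * (1 - A t)) *\<^sub>R embed 2 (abs_l2 (\<beta> t))) \<le> Cerr * small"
    if t: "t \<in> {0..T}" for t
  proof -
    have t0: "t \<ge> 0" using t by simp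
    note ab = amp_bounds[OF t] and A1 = A_coeff_bounds[OF \<sigma> t0, of n]
    define Zt where "Zt = X t - Y t"
    have Zn: "norm Zt \<le> Gain * small" using Z[OF t] by (simp add: Zt_def)
    have Zf: "norm (fst Zt) \<le> Gain * small" and Zs: "norm (snd Zt) \<le> Gain * small"
      using Zn norm_fst_le[where x="fst Zt" and y="snd Zt"] norm_snd_le[where x="fst Zt" and y="snd Zt"] by simp_all
    have XZ: "X t = Y t + Zt" by (simp add: Zt_def)
    have ks: "norm (K 1 0 t) \<le> small" "norm (K 0 2 t) \<le> small"
      unfolding small_def using norm_K_small[of 1 0 t] norm_K_small[of 0 2 t] by auto
    have Gain0: "Gain \<ge> 0" using Cres_nonneg by (simp add: Gain_def)
    note e1 = E1_small[OF t]
    have k10: "amp' * norm (K 1 0 t) \<le> amp' * small" using ks amp'_pos by (intro mult_left_mono) auto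
    have k02: "amp t * norm (K 0 2 t) \<le> amp_max * small" using ks ab by (intro mult_mono) auto
    have "X t - ohmic_state \<sigma> E t - (embed 2 (abs_l2 (\<beta> t)), abs_l2 (\<beta> t))
        = Zt + (embed 1 (E1 t) + embed 2 (- (amp' *\<^sub>R K 1 0 t)), amp t *\<^sub>R K 0 2 t)"
      by (simp add: XZ Y_def ohmic_state_eq abs_beta E2_def b_def prod_eq_iff linear_diff[OF embed_linear] linear_neg[OF embed_linear] algebra_simps)
    then have "norm (X t - ohmic_state \<sigma> E t - (embed 2 (abs_l2 (\<beta> t)), abs_l2 (\<beta> t)))
        \<le> norm Zt + norm (embed 1 (E1 t) + embed 2 (- (amp' *\<^sub>R K 1 0 t)), amp t *\<^sub>R K 0 2 t)"
      using norm_triangle_ineq by metis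
    also have "\<dots> \<le> norm Zt + (norm (E1 t) + norm (- (amp' *\<^sub>R K 1 0 t)) + norm (amp t *\<^sub>R K 0 2 t))"
      by (intro add_left_mono norm_state_le)
    also have "\<dots> \<le> Gain * small + ((amp' + amp_max) * small + amp' * small + amp_max * small)"
      using Zn e1 k10 k02 amp'_pos ab by (intro add_mono) simp_all
    also have "\<dots> = ((amp' + amp_max) + amp' + amp_max + Gain) * small" by (simp add: algebra_simps)
    also have "\<dots> \<le> Cerr * small"
    proof (rule mult_right_mono[OF _ small_nonneg])
      have "0 \<le> \<sigma> * ((amp' + amp_max) + amp' + A 0 * amp_max + Gain + M * Gain)"
        using \<sigma> amp'_pos ab A1 Gain0 M by (intro mult_nonneg_nonneg add_nonneg_nonneg) auto
      then show "(amp' + amp_max) + amp' + amp_max + Gain \<le> Cerr" by (simp add: Cerr_def)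
    qed
    finally have first: "norm (X t - ohmic_state \<sigma> E t - (embed 2 (abs_l2 (\<beta> t)), abs_l2 (\<beta> t))) \<le> Cerr * small" .
    let ?m = "magnetic_term (u t)"
    have l: "linear ?m" by (rule magnetic_term_linear[OF u_measurable[OF t0] M(2)[OF t0]])
    have "current \<sigma> (u t) (X t) - \<sigma> *\<^sub>R fst (ohmic_state \<sigma> E t) - (\<sigma> * (1 - A t)) *\<^sub>R embed 2 (abs_l2 (\<beta> t))
        = \<sigma> *\<^sub>R (embed 1 (E1 t) + embed 2 (- (amp' *\<^sub>R K 1 0 t)) + fst Zt + ?m (snd Zt) - (A t * amp t) *\<^sub>R embed 2 (K 0 2 t))"
      unfolding current_def XZ snd_add fst_add linear_add[OF l]
      by (simp add: magnetic_term_b[OF t0] Y_def ohmic_state_eq abs_beta E2_def linear_diff[OF embed_linear] linear_neg[OF embed_linear]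
          linear_add[OF embed_linear] linear_cmul[OF embed_linear] algebra_simps)
    then have "norm (current \<sigma> (u t) (X t) - \<sigma> *\<^sub>R fst (ohmic_state \<sigma> E t) - (\<sigma> * (1 - A t)) *\<^sub>R embed 2 (abs_l2 (\<beta> t)))
        = \<sigma> * norm (embed 1 (E1 t) + embed 2 (- (amp' *\<^sub>R K 1 0 t)) + fst Zt + ?m (snd Zt) - (A t * amp t) *\<^sub>R embed 2 (K 0 2 t))"
      using \<sigma> by simp
    also have "\<dots> \<le> \<sigma> * (norm (embed 1 (E1 t)) + norm (embed 2 (- (amp' *\<^sub>R K 1 0 t))) + norm (fst Zt) + norm (?m (snd Zt))
        + norm ((A t * amp t) *\<^sub>R embed 2 (K 0 2 t)))"
    proof (rule mult_left_mono)
      have "norm (v1 + v2 + v3 + v4 - v5) \<le> norm v1 + norm v2 + norm v3 + norm v4 + norm v5" for v1 v2 v3 v4 v5 :: "(real^2) l2"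
        using norm_triangle_ineq4[of "v1 + v2 + v3 + v4" v5] norm_triangle_ineq[of "v1 + v2 + v3" v4]
          norm_triangle_ineq[of "v1 + v2" v3] norm_triangle_ineq[of v1 v2] by linarith
      then show "norm (embed 1 (E1 t) + embed 2 (- (amp' *\<^sub>R K 1 0 t)) + fst Zt + ?m (snd Zt) - (A t * amp t) *\<^sub>R embed 2 (K 0 2 t))
        \<le> norm (embed 1 (E1 t)) + norm (embed 2 (- (amp' *\<^sub>R K 1 0 t))) + norm (fst Zt) + norm (?m (snd Zt))
        + norm ((A t * amp t) *\<^sub>R embed 2 (K 0 2 t))" .
    qed (use \<sigma> in simp)
    also have "\<dots> \<le> \<sigma> * ((amp' + amp_max) * small + amp' * small + Gain * small + M * (Gain * small) + A 0 * (amp_max * small))"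
    proof (intro mult_left_mono add_mono)
      show "norm (embed 1 (E1 t)) \<le> (amp' + amp_max) * small" using e1 by (simp add: norm_embed)
      show "norm (embed 2 (- (amp' *\<^sub>R K 1 0 t))) \<le> amp' * small" using k10 amp'_pos by (simp add: norm_embed)
      show "norm (?m (snd Zt)) \<le> M * (Gain * small)"
        using magnetic_term_norm[OF u_measurable[OF t0] M(2)[OF t0], of "snd Zt"] mult_left_mono[OF Zs M(1)] by linarith
      have "A t * (amp t * norm (K 0 2 t)) \<le> A 0 * (amp_max * small)"
        using A1 ks ab small_nonneg by (intro mult_mono) auto
      then show "norm ((A t * amp t) *\<^sub>R embed 2 (K 0 2 t)) \<le> A 0 * (amp_max * small)"
        using A1 ab by (simp add: norm_embed abs_mult mult.assoc)
    qed (use Zf \<sigma> in auto)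
    also have "\<dots> = \<sigma> * ((amp' + amp_max) + amp' + A 0 * amp_max + Gain + M * Gain) * small" by (simp add: algebra_simps)
    also have "\<dots> \<le> Cerr * small"
      using amp'_pos ab Gain0 by (intro mult_right_mono[OF _ small_nonneg]) (simp add: Cerr_def)
    finally show ?thesis using first by blast
  qed
  show ?thesis using es X0 est by blast
qed

end

section \<open>Packets of arbitrarily small width\<close>

text \<open>All that the limits need to know about the solution. Up to errors of size \<epsilon> the field b is \<beta>, the
  electric field is the Ohmic one plus \<beta> e_2, and the current is the Ohmic one plus \<sigma> (1 - A) \<beta> e_2.
  The packet \<beta> has the prescribed L^2 norm, while its support and its L^1 norm shrink.\<close>

definition concentrating_packet ::
    "real \<Rightarrow> real \<Rightarrow> (real \<Rightarrow> real) \<Rightarrow> real \<Rightarrow> real^2 \<Rightarrow> real^2 \<Rightarrow> nat \<Rightarrow> real \<Rightarrow> (real \<Rightarrow> state) \<Rightarrow> (real \<Rightarrow> real^2 \<Rightarrow> real) \<Rightarrow> bool" where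
  "concentrating_packet T \<sigma> \<Theta> r0 x0 E n \<epsilon> X \<beta> \<longleftrightarrow>
     energy_solution \<sigma> T (u_coeff \<Theta> r0 \<sigma> x0 n) X \<and> (\<forall>t\<in>{0..T}.
     norm (X t - ohmic_state \<sigma> E t - (embed 2 (abs_l2 (\<beta> t)), abs_l2 (\<beta> t))) \<le> \<epsilon> \<and>
     norm (current \<sigma> (u_coeff \<Theta> r0 \<sigma> x0 n t) (X t) - \<sigma> *\<^sub>R fst (ohmic_state \<sigma> E t)
        - (\<sigma> * (1 - A_coeff \<sigma> n t)) *\<^sub>R embed 2 (abs_l2 (\<beta> t))) \<le> \<epsilon> \<and>
     continuous_on UNIV (\<beta> t) \<and> (norm (abs_l2 (\<beta> t)))\<^sup>2 = ((t + exp (- real n)) / (2 * T))\<^sup>2 \<and>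
     (\<forall>x. \<beta> t x \<noteq> 0 \<longrightarrow> norm (wrap (x - x_c x0 t)) < \<epsilon>) \<and>
     (LINT x|torus. \<bar>\<beta> t x\<bar>) \<le> \<epsilon>)"

text \<open>The order of choices matters. The index n determines the bound and the core of the coefficient, the
  core determines the transversal profile q, and only then is the width h of the longitudinal profile
  taken small.\<close>

lemma concentrating_packet_exists:
  fixes T \<sigma> r0 \<epsilon> :: real and x0 E :: "real^2" and \<Theta> :: "real \<Rightarrow> real"
  assumes T: "T > 0" and \<sigma>: "\<sigma> > 0" and r0: "0 < r0" "r0 < pi" and prof: "cutoff_profile \<Theta>" and \<epsilon>: "\<epsilon> > 0"
  shows "\<exists>X \<beta>. concentrating_packet T \<sigma> \<Theta> r0 x0 E n \<epsilon> X \<beta>"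
proof -
  obtain M where M: "M \<ge> 0" "\<forall>t\<ge>0. \<forall>x. norm (u_coeff \<Theta> r0 \<sigma> x0 n t x) \<le> M"
    using u_coeff_bounded[OF prof r0 \<sigma>] by blast
  obtain \<rho> where \<rho>: "\<rho> > 0" "\<forall>t\<ge>0. \<forall>x. norm (wrap (x - x_c x0 t)) < \<rho> \<longrightarrow> u_coeff \<Theta> r0 \<sigma> x0 n t x = A_coeff \<sigma> n t *\<^sub>R e_dir"
    using u_coeff_core[OF prof r0 \<sigma>] by blast
  define h' where "h' = min (1 / 2) (min (\<rho> / 2) (\<epsilon> / 2))"
  have h': "0 < h'" "h' \<le> 1 / 2" "h' \<le> \<rho> / 2" "h' \<le> \<epsilon> / 2" using \<rho>(1) \<epsilon> by (auto simp: h'_def)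
  have "h' < pi" using h' pi_gt3 by linarith
  then obtain q where q: "bump h' q" "energy (q 0) = 1"
    using normalized_bump_exists[of h' 0] h'(1) by auto
  define Q where "Q = 1 + (\<Sum>j\<le>3. energy (q j))"
  have s0: "(\<Sum>j\<le>3. energy (q j)) \<ge> 0" by (intro sum_nonneg energy_nonneg)
  have Q: "energy (q j) \<le> Q\<^sup>2" if "j \<le> 3" for j
  proof -
    have "energy (q j) \<le> (\<Sum>j\<le>3. energy (q j))"
      by (rule member_le_sum) (use that energy_nonneg in auto)
    also have "\<dots> \<le> Q" by (simp add: Q_def)
    also have "\<dots> \<le> Q\<^sup>2" using self_le_power[of Q 2] s0 by (simp add: Q_def)
    finally show ?thesis .
  qed
  define C where "C = wave_packet.Cerr \<sigma> T n M"
  define D where "D = wave_packet.amp_max T n"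
  have "((\<lambda>h. C * (2 * h * Q)) \<longlongrightarrow> C * (2 * 0 * Q)) (at_right 0)"
    by (intro tendsto_intros)
  then have c1: "\<forall>\<^sub>F h in at_right 0. C * (2 * h * Q) < \<epsilon>"
    using \<epsilon> by (intro order_tendstoD(2)) auto
  have "((\<lambda>h. D * (sqrt h * (3 / 2) * (3 / 2))) \<longlongrightarrow> D * (sqrt 0 * (3 / 2) * (3 / 2))) (at_right 0)"
    by (intro tendsto_intros)
  then have c2: "\<forall>\<^sub>F h in at_right 0. D * (sqrt h * (3 / 2) * (3 / 2)) < \<epsilon>"
    using \<epsilon> by (intro order_tendstoD(2)) auto
  have c3: "\<forall>\<^sub>F h in at_right 0. h \<in> {0<..<h'}"
    using h'(1) by (rule eventually_at_right_real)
  have "\<forall>\<^sub>F h in at_right 0. C * (2 * h * Q) < \<epsilon> \<and> D * (sqrt h * (3 / 2) * (3 / 2)) < \<epsilon> \<and> h \<in> {0<..<h'}"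
    using c1 c2 c3 by eventually_elim simp
  then have "\<exists>h. C * (2 * h * Q) < \<epsilon> \<and> D * (sqrt h * (3 / 2) * (3 / 2)) < \<epsilon> \<and> h \<in> {0<..<h'}"
    using eventually_happens'[OF trivial_limit_at_right_real] by blast
  then obtain h where hC: "C * (2 * h * Q) < \<epsilon>" and hD: "D * (sqrt h * (3 / 2) * (3 / 2)) < \<epsilon>"
    and h: "0 < h" "h < h'" by auto
  have hpi: "h < pi" using h h' pi_gt3 by linarith
  obtain p where p: "bump h p" "energy (p 2) = 1"
    using normalized_bump_exists[OF h(1) hpi, of 2] by auto
  have radius: "h + h' \<le> \<epsilon>" using h h' by linarith
  interpret wave_packet \<Theta> r0 \<sigma> T x0 E n h h' M Q p q
  proof
    show "u_coeff \<Theta> r0 \<sigma> x0 n t x = A_coeff \<sigma> n t *\<^sub>R e_dir" if "t \<ge> 0" "norm (wrap (x - x_c x0 t)) < h + h'" for t x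
      using \<rho>(2) that h h' by auto
  qed (use T \<sigma> r0 prof p q h h' M Q s0 in \<open>auto simp: Q_def\<close>)
  obtain X where X: "energy_solution \<sigma> T (u_coeff \<Theta> r0 \<sigma> x0 n) X"
    and est: "\<forall>t\<in>{0..T}. norm (X t - ohmic_state \<sigma> E t - (embed 2 (abs_l2 (\<beta> t)), abs_l2 (\<beta> t))) \<le> Cerr * small \<and>
     norm (current \<sigma> (u_coeff \<Theta> r0 \<sigma> x0 n t) (X t) - \<sigma> *\<^sub>R fst (ohmic_state \<sigma> E t) - (\<sigma> * (1 - A_coeff \<sigma> n t)) *\<^sub>R embed 2 (abs_l2 (\<beta> t))) \<le> Cerr * small"
    using exact_solution by blast
  have sm: "Cerr * small \<le> \<epsilon>" using hC by (simp add: small_def C_def)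
  show ?thesis
    unfolding concentrating_packet_def
  proof (intro exI conjI ballI)
    show "energy_solution \<sigma> T (u_coeff \<Theta> r0 \<sigma> x0 n) X" by (rule X)
    fix t assume t: "t \<in> {0..T}"
    show "norm (X t - ohmic_state \<sigma> E t - (embed 2 (abs_l2 (\<beta> t)), abs_l2 (\<beta> t))) \<le> \<epsilon>"
      using bspec[OF est t] sm by linarith
    show "norm (current \<sigma> (u_coeff \<Theta> r0 \<sigma> x0 n t) (X t) - \<sigma> *\<^sub>R fst (ohmic_state \<sigma> E t)
        - (\<sigma> * (1 - A_coeff \<sigma> n t)) *\<^sub>R embed 2 (abs_l2 (\<beta> t))) \<le> \<epsilon>"
      using bspec[OF est t] sm by linarith
    show "continuous_on UNIV (\<beta> t)" by (rule continuous_beta)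
    show "(norm (abs_l2 (\<beta> t)))\<^sup>2 = ((t + exp (- real n)) / (2 * T))\<^sup>2"
      unfolding norm_beta amp_def \<delta>_def ..
    show "\<forall>x. \<beta> t x \<noteq> 0 \<longrightarrow> norm (wrap (x - x_c x0 t)) < \<epsilon>"
    proof (intro allI impI)
      fix x assume "\<beta> t x \<noteq> 0"
      then show "norm (wrap (x - x_c x0 t)) < \<epsilon>" using beta_support[of t x] radius by linarith
    qed
    show "(LINT x|torus. \<bar>\<beta> t x\<bar>) \<le> \<epsilon>"
      using beta_L1[OF t] hD by (simp add: D_def)
  qed
qed

section \<open>The Lorentz force of a concentrating packet\<close>

lemma rot_inner: "rot z \<bullet> w = - (z \<bullet> rot w)"
  by (simp add: inner_vec_def sum_2)

text \<open>The Lorentz force is only integrable, but R is antisymmetric. Testing the force with \<psi> is therefore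
  the L^2 pairing of the current with the magnetic term whose coefficient is \<psi>.\<close>

lemma lorentz_pairing:
  fixes \<psi> :: "real^2 \<Rightarrow> real^2"
  assumes m: "\<psi> \<in> borel_measurable torus" and B: "\<And>x. norm (\<psi> x) \<le> B"
  shows "(LINT x|torus. (rep_l2 b x *\<^sub>R rot (rep_l2 J x)) \<bullet> \<psi> x) = - (J \<bullet> magnetic_term \<psi> b)"
proof -
  have "(rep_l2 b x *\<^sub>R rot (rep_l2 J x)) \<bullet> \<psi> x = - (rep_l2 J x \<bullet> (rep_l2 b x *\<^sub>R rot (\<psi> x)))" for x
    by (simp add: rot_inner)
  then show ?thesis
    unfolding magnetic_term_def
    by (simp add: inner_abs_l2_right[OF square_integrable_magnetic[OF rep_l2_square_integrable m B]])
qed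

text \<open>The leading contribution is c \<beta>^2 e_1, of total mass c a^2, against \<psi>. The four errors come from
  replacing b by \<beta>, from the deviation of the current, from the constant background current V paired
  with \<beta>, which is controlled by the L^1 norm of \<beta>, and from the oscillation of \<psi> on its
  support.\<close>

lemma lorentz_estimate:
  fixes \<psi> :: "real^2 \<Rightarrow> real^2" and \<beta> :: "real^2 \<Rightarrow> real" and V :: "real^2"
  assumes \<psi>: "continuous_on UNIV \<psi>" and B: "\<And>x. norm (\<psi> x) \<le> B"
    and \<beta>: "continuous_on UNIV \<beta>" and a: "(norm (abs_l2 \<beta>))\<^sup>2 = a\<^sup>2" "a \<ge> 0" and L1: "(LINT x|torus. \<bar>\<beta> x\<bar>) \<le> e"
    and z: "norm (b - abs_l2 \<beta>) \<le> e"
    and J: "norm (J - abs_l2 (\<lambda>_. V) - c *\<^sub>R embed 2 (abs_l2 \<beta>)) \<le> e"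
    and near: "\<And>x. \<beta> x \<noteq> 0 \<Longrightarrow> \<bar>\<psi> x $ 1 - P\<bar> \<le> w"
  shows "\<bar>(LINT x|torus. (rep_l2 b x *\<^sub>R rot (rep_l2 J x)) \<bullet> \<psi> x) - c * a\<^sup>2 * P\<bar>
    \<le> norm J * (B * e) + e * (B * a) + norm V * (B * e) + \<bar>c\<bar> * (w * a\<^sup>2)"
proof -
  have m: "\<psi> \<in> borel_measurable torus"
    using \<psi> by (intro measurable_torus borel_measurable_continuous_onI)
  have B0: "B \<ge> 0" using B[of 0] norm_ge_zero order_trans by blast
  have sq\<beta>: "square_integrable \<beta>" by (rule square_integrable_continuous[OF \<beta>])
  let ?m = "magnetic_term \<psi>"
  have lin: "linear ?m" by (rule magnetic_term_linear[OF m B])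
  define bb where "bb = abs_l2 \<beta>"
  define z' where "z' = b - bb"
  define \<zeta> where "\<zeta> = J - abs_l2 (\<lambda>_. V) - c *\<^sub>R embed 2 bb"
  have nb: "norm bb = a" using a by (simp add: bb_def power2_eq_iff_nonneg)
  have mb: "?m bb = abs_l2 (\<lambda>x. \<beta> x *\<^sub>R rot (\<psi> x))"
    unfolding bb_def by (rule magnetic_term_abs[OF sq\<beta> m B])
  have sqm: "square_integrable (\<lambda>x. \<beta> x *\<^sub>R rot (\<psi> x))" by (rule square_integrable_magnetic[OF sq\<beta> m B])
  have sqV: "square_integrable (\<lambda>_. V)" by (rule square_integrable_continuous) simp
  have i\<beta>: "integrable torus (\<lambda>x. \<bar>\<beta> x\<bar>)" "integrable torus (\<lambda>x. (\<beta> x)\<^sup>2)"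
    "integrable torus (\<lambda>x. (\<beta> x)\<^sup>2 * \<psi> x $ 1)"
    by (intro integrable_torus_continuous continuous_intros \<beta> \<psi>)+
  have t1: "\<bar>J \<bullet> ?m z'\<bar> \<le> norm J * (B * e)"
  proof -
    have "\<bar>J \<bullet> ?m z'\<bar> \<le> norm J * norm (?m z')" by (rule Cauchy_Schwarz_ineq2)
    also have "norm (?m z') \<le> B * norm z'" by (rule magnetic_term_norm[OF m B])
    also have "B * norm z' \<le> B * e" using z B0 by (intro mult_left_mono) (auto simp: z'_def bb_def)
    finally show ?thesis by (simp add: mult_left_mono)
  qed
  have t2: "\<bar>\<zeta> \<bullet> ?m bb\<bar> \<le> e * (B * a)"
  proof -
    have "\<bar>\<zeta> \<bullet> ?m bb\<bar> \<le> norm \<zeta> * norm (?m bb)" by (rule Cauchy_Schwarz_ineq2)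
    also have "\<dots> \<le> e * (B * a)"
      using J magnetic_term_norm[OF m B, of bb] order_trans[OF norm_ge_zero J] by (intro mult_mono) (auto simp: \<zeta>_def bb_def[symmetric] nb)
    finally show ?thesis .
  qed
  have t3: "\<bar>abs_l2 (\<lambda>_. V) \<bullet> ?m bb\<bar> \<le> norm V * (B * e)"
  proof -
    have "abs_l2 (\<lambda>_. V) \<bullet> ?m bb = (LINT x|torus. V \<bullet> (\<beta> x *\<^sub>R rot (\<psi> x)))"
      unfolding mb by (rule inner_abs_l2[OF sqV sqm])
    also have "\<bar>\<dots>\<bar> \<le> (LINT x|torus. \<bar>V \<bullet> (\<beta> x *\<^sub>R rot (\<psi> x))\<bar>)" by (rule integral_abs_bound)
    also have "\<dots> \<le> (LINT x|torus. norm V * B * \<bar>\<beta> x\<bar>)"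
    proof (rule integral_mono)
      show "integrable torus (\<lambda>x. \<bar>V \<bullet> (\<beta> x *\<^sub>R rot (\<psi> x))\<bar>)"
        by (intro Bochner_Integration.integrable_abs integrable_inner_l2[OF sqV sqm])
      show "integrable torus (\<lambda>x. norm V * B * \<bar>\<beta> x\<bar>)" using i\<beta> by simp
      fix x
      have "\<bar>V \<bullet> (\<beta> x *\<^sub>R rot (\<psi> x))\<bar> \<le> norm V * norm (\<beta> x *\<^sub>R rot (\<psi> x))" by (rule Cauchy_Schwarz_ineq2)
      also have "\<dots> = norm V * (\<bar>\<beta> x\<bar> * norm (\<psi> x))" by (simp add: norm_rot)
      also have "\<dots> \<le> norm V * (\<bar>\<beta> x\<bar> * B)" using B by (intro mult_left_mono) auto
      finally show "\<bar>V \<bullet> (\<beta> x *\<^sub>R rot (\<psi> x))\<bar> \<le> norm V * B * \<bar>\<beta> x\<bar>" by (simp add: mult_ac)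
    qed
    also have "\<dots> = norm V * B * (LINT x|torus. \<bar>\<beta> x\<bar>)" by simp
    also have "\<dots> \<le> norm V * B * e" using L1 B0 by (intro mult_left_mono) auto
    finally show ?thesis by (simp add: mult.assoc)
  qed
  have a2: "(LINT x|torus. (\<beta> x)\<^sup>2) = a\<^sup>2"
    using norm_abs_l2[OF sq\<beta>] a(1) by simp
  have t4: "embed 2 bb \<bullet> ?m bb = - (LINT x|torus. (\<beta> x)\<^sup>2 * \<psi> x $ 1)"
  proof -
    have "embed 2 bb \<bullet> ?m bb = (LINT x|torus. (\<beta> x *\<^sub>R axis 2 1) \<bullet> (\<beta> x *\<^sub>R rot (\<psi> x)))"
      unfolding mb unfolding bb_def embed_abs_l2[OF sq\<beta>] by (rule inner_abs_l2[OF square_integrable_embed[OF sq\<beta>] sqm])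
    also have "\<dots> = (LINT x|torus. - ((\<beta> x)\<^sup>2 * \<psi> x $ 1))"
      by (simp add: inner_axis' power2_eq_square mult.assoc)
    finally show ?thesis by simp
  qed
  have t5: "\<bar>(LINT x|torus. (\<beta> x)\<^sup>2 * \<psi> x $ 1) - a\<^sup>2 * P\<bar> \<le> w * a\<^sup>2"
  proof -
    have "(LINT x|torus. (\<beta> x)\<^sup>2 * \<psi> x $ 1) - a\<^sup>2 * P = (LINT x|torus. (\<beta> x)\<^sup>2 * \<psi> x $ 1 - (\<beta> x)\<^sup>2 * P)"
      using i\<beta> by (simp add: a2)
    also have "\<bar>\<dots>\<bar> \<le> (LINT x|torus. \<bar>(\<beta> x)\<^sup>2 * \<psi> x $ 1 - (\<beta> x)\<^sup>2 * P\<bar>)" by (rule integral_abs_bound)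
    also have "\<dots> \<le> (LINT x|torus. w * (\<beta> x)\<^sup>2)"
    proof (rule integral_mono)
      show "integrable torus (\<lambda>x. \<bar>(\<beta> x)\<^sup>2 * \<psi> x $ 1 - (\<beta> x)\<^sup>2 * P\<bar>)" using i\<beta> by auto
      show "integrable torus (\<lambda>x. w * (\<beta> x)\<^sup>2)" using i\<beta> by simp
      fix x
      show "\<bar>(\<beta> x)\<^sup>2 * \<psi> x $ 1 - (\<beta> x)\<^sup>2 * P\<bar> \<le> w * (\<beta> x)\<^sup>2"
      proof (cases "\<beta> x = 0")
        case False
        then have "(\<beta> x)\<^sup>2 * \<bar>\<psi> x $ 1 - P\<bar> \<le> (\<beta> x)\<^sup>2 * w" using near by (intro mult_left_mono) auto
        moreover have "\<bar>(\<beta> x)\<^sup>2 * \<psi> x $ 1 - (\<beta> x)\<^sup>2 * P\<bar> = (\<beta> x)\<^sup>2 * \<bar>\<psi> x $ 1 - P\<bar>"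
          by (simp add: right_diff_distrib[symmetric] abs_mult)
        ultimately show ?thesis by (simp add: mult.commute)
      qed simp
    qed
    also have "\<dots> = w * a\<^sup>2" by (simp add: a2)
    finally show ?thesis .
  qed
  have bz: "b = bb + z'" and Jz: "J = \<zeta> + abs_l2 (\<lambda>_. V) + c *\<^sub>R embed 2 bb"
    by (simp_all add: z'_def \<zeta>_def)
  have "J \<bullet> ?m b = J \<bullet> ?m z' + J \<bullet> ?m bb" unfolding bz linear_add[OF lin] by (simp add: inner_add_right)
  also have "J \<bullet> ?m bb = \<zeta> \<bullet> ?m bb + abs_l2 (\<lambda>_. V) \<bullet> ?m bb + c * (embed 2 bb \<bullet> ?m bb)"
    by (subst (1) Jz) (simp add: inner_add_left)
  finally have e1: "J \<bullet> ?m b = J \<bullet> ?m z' + (\<zeta> \<bullet> ?m bb + abs_l2 (\<lambda>_. V) \<bullet> ?m bb - c * (LINT x|torus. (\<beta> x)\<^sup>2 * \<psi> x $ 1))"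
    by (simp add: t4)
  have "\<bar>c * (LINT x|torus. (\<beta> x)\<^sup>2 * \<psi> x $ 1) - c * a\<^sup>2 * P\<bar> = \<bar>c\<bar> * \<bar>(LINT x|torus. (\<beta> x)\<^sup>2 * \<psi> x $ 1) - a\<^sup>2 * P\<bar>"
    by (simp add: abs_mult[symmetric] right_diff_distrib mult.assoc)
  also have "\<dots> \<le> \<bar>c\<bar> * (w * a\<^sup>2)" using t5 by (intro mult_left_mono) auto
  finally show ?thesis
    unfolding lorentz_pairing[OF m B] using e1 t1 t2 t3 by linarith
qed

section \<open>Loss of convergence and the limiting force\<close>

lemma LIMSEQ_exp_neg: "(\<lambda>n. exp (- real n)) \<longlonglongrightarrow> 0"
  by (rule filterlim_compose[OF exp_at_bot filterlim_compose[OF filterlim_uminus_at_bot_at_top filterlim_real_sequentially]])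

text \<open>The net factor by which the leading part of the current multiplies \<beta>. It is large where the amplitude is
  small, and the product with the amplitude (t + exp (- n)) / (2 T) is the constant - 1 / T: the currents
  stay bounded.\<close>

lemma damping_minus_gain:
  assumes "\<sigma> > 0" "t \<ge> 0"
  shows "\<sigma> * (1 - A_coeff \<sigma> n t) = - 2 / (t + exp (- real n))"
proof -
  have "\<sigma> * (2 / (\<sigma> * d)) = 2 / d" for d using assms by simp
  then show ?thesis by (simp add: A_coeff_def)
qed

theorem corollary3p6:
  fixes T \<sigma> r0 :: real and x0 E_star :: "real^2" and \<Theta> :: "real \<Rightarrow> real"
  assumes "T > 0" and "\<sigma> > 0"
    and "0 < r0" and "r0 < pi" and "cutoff_profile \<Theta>"
    and "E_star \<noteq> 0"
  shows "\<exists>X :: nat \<Rightarrow> real \<Rightarrow> state.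
    (\<forall>n\<ge>1. energy_solution \<sigma> T (u_coeff \<Theta> r0 \<sigma> x0 n) (X n)) \<and>
    (\<lambda>n. X n 0) \<longlonglongrightarrow> (abs_l2 (\<lambda>_. E_star), 0) \<and>
    liminf (\<lambda>n. ereal (norm (X n T - ohmic_state \<sigma> E_star T))) > 0 \<and>
    (\<exists>C::real. \<forall>n\<ge>1.
       (\<integral>\<^sup>+t\<in>{0<..<T}. ennreal ((norm (current \<sigma> (u_coeff \<Theta> r0 \<sigma> x0 n t) (X n t)))\<^sup>2) \<partial>lborel)
         \<le> ennreal C) \<and>
    (\<forall>\<Psi> :: real \<Rightarrow> real^2 \<Rightarrow> real^2.
       continuous_on ({0..T} \<times> UNIV) (\<lambda>(t, x). \<Psi> t x) \<and> (\<forall>t\<in>{0..T}. periodic (\<Psi> t)) \<longrightarrow>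
       (\<lambda>n. LINT t:{0..T}|lborel. LINT x|torus.
               lorentz_force \<sigma> (u_coeff \<Theta> r0 \<sigma> x0 n t) (X n t) x \<bullet> \<Psi> t x)
         \<longlonglongrightarrow> - (LINT t:{0..T}|lborel. t / (2 * T\<^sup>2) * (e_dir \<bullet> \<Psi> t (x_c x0 t))))"
proof -
  note T = assms(1) and \<sigma> = assms(2) and r0 = assms(3,4) and prof = assms(5)
  \<comment> \<open>The accuracy of the n-th packet; any null sequence would do.\<close>
  define e where "e n = inverse (real (Suc n))" for n
  have e: "e n > 0" "e n \<le> 1" for n by (simp_all add: e_def field_simps)
  have e_lim: "e \<longlonglongrightarrow> 0" unfolding e_def[abs_def] by (rule LIMSEQ_inverse_real_of_nat)
  let ?u = "u_coeff \<Theta> r0 \<sigma> x0"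
  have "\<forall>n. \<exists>X \<beta>. concentrating_packet T \<sigma> \<Theta> r0 x0 E_star n (e n) X \<beta>"
    using concentrating_packet_exists[OF T \<sigma> r0 prof e(1)] by blast
  from choice[OF this] obtain X where "\<forall>n. \<exists>\<beta>. concentrating_packet T \<sigma> \<Theta> r0 x0 E_star n (e n) (X n) \<beta>" ..
  from choice[OF this] obtain \<beta> where X\<beta>: "\<forall>n. concentrating_packet T \<sigma> \<Theta> r0 x0 E_star n (e n) (X n) (\<beta> n)" ..
  define bb where "bb n t = abs_l2 (\<beta> n t)" for n t
  define J where "J n t = current \<sigma> (?u n t) (X n t)" for n t
  define a where "a n t = (t + exp (- real n)) / (2 * T)" for n t
  define c where "c n t = \<sigma> * (1 - A_coeff \<sigma> n t)" for n t
  define background where "background = abs_l2 (\<lambda>_::real^2. E_star)"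
  have cert:
    "energy_solution \<sigma> T (?u n) (X n)"
    "t \<in> {0..T} \<Longrightarrow> norm (X n t - ohmic_state \<sigma> E_star t - (embed 2 (bb n t), bb n t)) \<le> e n"
    "t \<in> {0..T} \<Longrightarrow> norm (J n t - \<sigma> *\<^sub>R fst (ohmic_state \<sigma> E_star t) - c n t *\<^sub>R embed 2 (bb n t)) \<le> e n"
    "t \<in> {0..T} \<Longrightarrow> continuous_on UNIV (\<beta> n t)"
    "t \<in> {0..T} \<Longrightarrow> (norm (bb n t))\<^sup>2 = (a n t)\<^sup>2"
    "t \<in> {0..T} \<Longrightarrow> \<beta> n t x \<noteq> 0 \<Longrightarrow> norm (wrap (x - x_c x0 t)) < e n"
    "t \<in> {0..T} \<Longrightarrow> (LINT x|torus. \<bar>\<beta> n t x\<bar>) \<le> e n" for n t x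
    using X\<beta>[rule_format, of n] unfolding concentrating_packet_def bb_def J_def a_def c_def by blast+
  have ex: "exp (- real n) > 0" "exp (- real n) \<le> 1" for n by auto
  have a0: "a n t \<ge> 0" "a n t \<le> (T + 1) / (2 * T)" if "t \<in> {0..T}" for n t
    using that T ex[of n] add_mono[of t T "exp (- real n)" 1] unfolding a_def by (auto intro!: divide_right_mono)
  have nbb: "norm (bb n t) = a n t" if "t \<in> {0..T}" for n t
    using cert(5)[OF that] a0(1)[OF that] by (simp add: power2_eq_iff_nonneg)
  have c_eq: "c n t = - 2 / (t + exp (- real n))" if "t \<in> {0..T}" for n t
    unfolding c_def by (rule damping_minus_gain[OF \<sigma>]) (use that in simp)
  have tpos: "t + exp (- real n) > 0" if "t \<in> {0..T}" for n t using that ex(1)[of n] by (auto intro: add_nonneg_pos)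
  have ca: "\<bar>c n t\<bar> * a n t = 1 / T" "c n t * (a n t)\<^sup>2 = - ((t + exp (- real n)) / (2 * T\<^sup>2))" if t: "t \<in> {0..T}" for n t
  proof -
    have "\<bar>- 2 / d\<bar> * (d / (2 * T)) = 1 / T" "(- 2 / d) * (d / (2 * T))\<^sup>2 = - (d / (2 * T\<^sup>2))" if "d > 0" for d
      using that T by (simp_all add: power2_eq_square)
    from this[OF tpos[OF t, of n]] show "\<bar>c n t\<bar> * a n t = 1 / T" "c n t * (a n t)\<^sup>2 = - ((t + exp (- real n)) / (2 * T\<^sup>2))"
      unfolding c_eq[OF t] a_def by simp_all
  qed
  have sqE: "square_integrable (\<lambda>_::real^2. E_star)" by (rule square_integrable_continuous) simp
  have ohm: "fst (ohmic_state \<sigma> E_star t) = exp (- \<sigma> * t) *\<^sub>R background" for t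
    unfolding ohmic_state_def background_def by (simp add: abs_l2_scaleR[OF sqE])

  have initial: "(\<lambda>n. X n 0) \<longlonglongrightarrow> (abs_l2 (\<lambda>_. E_star), 0)"
  proof -
    have 0: "0 \<in> {0..T}" using T by simp
    have bnd: "norm (X n 0 - (abs_l2 (\<lambda>_. E_star), 0)) \<le> e n + 2 * a n 0" for n
    proof -
      have o: "ohmic_state \<sigma> E_star 0 = (abs_l2 (\<lambda>_. E_star), 0)" by (simp add: ohmic_state_def)
      have "norm (embed 2 (bb n 0), bb n 0) \<le> norm (embed 2 (bb n 0)) + norm (bb n 0)"
        unfolding norm_Pair by (rule sqrt_sum_squares_le_sum) auto
      then have "norm (embed 2 (bb n 0), bb n 0) \<le> 2 * a n 0" by (simp add: norm_embed nbb[OF 0])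
      then show ?thesis
        using cert(2)[OF 0, of n] norm_triangle_ineq[of "X n 0 - ohmic_state \<sigma> E_star 0 - (embed 2 (bb n 0), bb n 0)" "(embed 2 (bb n 0), bb n 0)"]
        unfolding o by simp
    qed
    have "(\<lambda>n. e n + 2 * a n 0) \<longlonglongrightarrow> 0 + 2 * ((0 + 0) / (2 * T))"
      unfolding a_def using T by (intro tendsto_intros e_lim LIMSEQ_exp_neg) auto
    then have lim: "(\<lambda>n. e n + 2 * a n 0) \<longlonglongrightarrow> 0" by simp
    have "\<forall>\<^sub>F n in sequentially. norm (X n 0 - (abs_l2 (\<lambda>_. E_star), 0)) \<le> e n + 2 * a n 0"
      by (intro always_eventually allI bnd)
    then have "(\<lambda>n. X n 0 - (abs_l2 (\<lambda>_. E_star), 0)) \<longlonglongrightarrow> 0"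
      using lim by (rule Lim_null_comparison)
    then show ?thesis by (simp add: LIM_zero_iff)
  qed

  have final: "liminf (\<lambda>n. ereal (norm (X n T - ohmic_state \<sigma> E_star T))) > 0"
  proof -
    have TT: "T \<in> {0..T}" using T by simp
    have low: "norm (X n T - ohmic_state \<sigma> E_star T) \<ge> 1 / 2 - e n" for n
    proof -
      have "1 / 2 \<le> a n T" using T ex(1)[of n] by (simp add: a_def field_simps)
      also have "a n T \<le> norm (embed 2 (bb n T), bb n T)"
        using norm_snd_le[where x="embed 2 (bb n T)" and y="bb n T"] by (simp add: nbb[OF TT])
      finally show ?thesis
        using cert(2)[OF TT, of n] norm_triangle_ineq3[of "X n T - ohmic_state \<sigma> E_star T" "(embed 2 (bb n T), bb n T)"]
        by linarith
    qed
    have "\<forall>\<^sub>F n in sequentially. e n < 1 / 4"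
      by (rule order_tendstoD(2)[OF e_lim]) simp
    then have "\<forall>\<^sub>F n in sequentially. ereal (1 / 4) \<le> ereal (norm (X n T - ohmic_state \<sigma> E_star T))"
    proof eventually_elim
      case (elim n)
      then have "1 / 4 \<le> norm (X n T - ohmic_state \<sigma> E_star T)" using low[of n] by linarith
      then show ?case by simp
    qed
    then have "ereal (1 / 4) \<le> liminf (\<lambda>n. ereal (norm (X n T - ohmic_state \<sigma> E_star T)))"
      by (rule Liminf_bounded)
    then show ?thesis by (rule less_le_trans[rotated]) simp
  qed

  \<comment> \<open>The three summands bound the error, the Ohmic current and the packet current.\<close>
  define C0 where "C0 = 1 + \<sigma> * norm background + 1 / T"
  have C0: "C0 \<ge> 0" using \<sigma> T by (simp add: C0_def)
  have Jb: "norm (J n t) \<le> C0" if t: "t \<in> {0..T}" for n t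
  proof -
    have "norm (\<sigma> *\<^sub>R fst (ohmic_state \<sigma> E_star t)) \<le> \<sigma> * norm background"
      unfolding ohm using \<sigma> t by (simp add: mult_left_le_one_le)
    moreover have "norm (c n t *\<^sub>R embed 2 (bb n t)) = 1 / T"
      by (simp add: norm_embed nbb[OF t] ca(1)[OF t])
    moreover have "norm (J n t) \<le> norm (J n t - \<sigma> *\<^sub>R fst (ohmic_state \<sigma> E_star t) - c n t *\<^sub>R embed 2 (bb n t))
        + norm (\<sigma> *\<^sub>R fst (ohmic_state \<sigma> E_star t)) + norm (c n t *\<^sub>R embed 2 (bb n t))"
    proof -
      have "norm x \<le> norm (x - y - z) + norm y + norm z" for x y z :: "(real^2) l2"
        using norm_triangle_ineq[of "x - y - z" "y + z"] norm_triangle_ineq[of y z] by simp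
      then show ?thesis .
    qed
    ultimately show ?thesis using cert(3)[OF t, of n] e(2)[of n] unfolding C0_def by linarith
  qed
  have currents: "(\<integral>\<^sup>+t\<in>{0<..<T}. ennreal ((norm (current \<sigma> (?u n t) (X n t)))\<^sup>2) \<partial>lborel) \<le> ennreal (C0\<^sup>2 * T)" for n
  proof -
    have "(\<integral>\<^sup>+t\<in>{0<..<T}. ennreal ((norm (current \<sigma> (?u n t) (X n t)))\<^sup>2) \<partial>lborel)
        \<le> (\<integral>\<^sup>+t. ennreal (C0\<^sup>2) * indicator {0<..<T} t \<partial>lborel)"
    proof (intro nn_integral_mono)
      fix t :: real
      show "ennreal ((norm (current \<sigma> (?u n t) (X n t)))\<^sup>2) * indicator {0<..<T} t \<le> ennreal (C0\<^sup>2) * indicator {0<..<T} t"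
      proof (cases "t \<in> {0<..<T}")
        case True
        then have "norm (current \<sigma> (?u n t) (X n t)) \<le> C0" using Jb[of t n] by (simp add: J_def)
        then show ?thesis using True by (simp add: ennreal_leI power_mono)
      qed simp
    qed
    also have "\<dots> = ennreal (C0\<^sup>2) * ennreal T" using T by (simp add: nn_integral_cmult_indicator)
    also have "\<dots> = ennreal (C0\<^sup>2 * T)" using T by (simp add: ennreal_mult)
    finally show ?thesis .
  qed

  have lorentz: "(\<lambda>n. LINT t:{0..T}|lborel. LINT x|torus. lorentz_force \<sigma> (?u n t) (X n t) x \<bullet> \<Psi> t x)
         \<longlonglongrightarrow> - (LINT t:{0..T}|lborel. t / (2 * T\<^sup>2) * (e_dir \<bullet> \<Psi> t (x_c x0 t)))"
    if \<Psi>: "continuous_on ({0..T} \<times> UNIV) (\<lambda>(t, x). \<Psi> t x)" and per: "\<forall>t\<in>{0..T}. periodic (\<Psi> t)"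
    for \<Psi> :: "real \<Rightarrow> real^2 \<Rightarrow> real^2"
  proof -
    have "compact ((\<lambda>(t, x). \<Psi> t x) ` ({0..T} \<times> cbox (\<chi> i. - pi) (\<chi> i. pi)))"
      by (intro compact_continuous_image continuous_on_subset[OF \<Psi>] compact_Times) auto
    from compact_imp_bounded[OF this] obtain B
      where B0: "\<forall>y\<in>(\<lambda>(t, x). \<Psi> t x) ` ({0..T} \<times> cbox (\<chi> i. - pi) (\<chi> i. pi)). norm y \<le> B"
      unfolding bounded_iff by blast
    have B: "norm (\<Psi> t x) \<le> B" if "t \<in> {0..T}" for t x
    proof -
      have "wrap x \<in> cbox (\<chi> i. - pi) (\<chi> i. pi)" using wrap_in_cell torus_cell_subset by auto
      then have "norm (\<Psi> t (wrap x)) \<le> B" using B0 that by simp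
      moreover have "\<Psi> t (wrap x) = \<Psi> t x"
        using periodic_wrap[of "\<Psi> t" 0 x] per that by simp
      ultimately show ?thesis by simp
    qed
    \<comment> \<open>The test field is frozen after T, since strongly continuous families live on the half line.\<close>
    define \<Phi> where "\<Phi> t x = \<Psi> (min t T) x" for t x
    have \<Phi>: "continuous_on ({0..} \<times> UNIV) (\<lambda>(t, x). \<Phi> t x)"
    proof -
      have "continuous_on ({0..} \<times> UNIV) (\<lambda>z. (\<lambda>(t, x). \<Psi> t x) (min (fst z) T, snd z))"
        by (rule continuous_on_compose2[OF \<Psi>]) (use T in \<open>auto intro!: continuous_intros\<close>)
      then show ?thesis by (simp add: \<Phi>_def case_prod_beta)
    qed
    have \<Phi>B: "norm (\<Phi> t x) \<le> B" if "t \<ge> 0" for t x unfolding \<Phi>_def using that T by (intro B) auto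
    have \<Phi>\<Psi>: "\<Phi> t = \<Psi> t" if "t \<in> {0..T}" for t using that by (simp add: \<Phi>_def fun_eq_iff min_def)
    define F where "F n t = (LINT x|torus. lorentz_force \<sigma> (?u n t) (X n t) x \<bullet> \<Psi> t x)" for n t
    define G where "G t = - (t / (2 * T\<^sup>2) * (e_dir \<bullet> \<Psi> t (x_c x0 t)))" for t
    have Fc: "continuous_on {0..T} (F n)" for n
    proof -
      obtain M where M: "\<And>t x. t \<ge> 0 \<Longrightarrow> norm (?u n t x) \<le> M"
        using u_coeff_bounded[OF prof r0 \<sigma>] by blast
      have Xc: "continuous_on {0..T} (X n)" using cert(1) by (simp add: energy_solution_def)
      have m: "continuous_on {0..T} (\<lambda>t. magnetic_term (?u n t) (snd (X n t)))"
        by (rule continuous_on_family_apply[OF magnetic_term_family[OF u_coeff_continuous[OF prof r0 \<sigma>] M]]) (auto intro!: continuous_intros Xc)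
      have Jc: "continuous_on {0..T} (J n)"
        unfolding J_def current_def by (intro continuous_intros Xc m)
      have "continuous_on {0..T} (\<lambda>t. - (J n t \<bullet> magnetic_term (\<Phi> t) (snd (X n t))))"
        by (intro continuous_intros Jc continuous_on_family_apply[OF magnetic_term_family[OF \<Phi> \<Phi>B]] Xc) auto
      then show ?thesis
      proof (rule continuous_on_eq)
        fix t assume t: "t \<in> {0..T}"
        then have t0: "t \<ge> 0" by simp
        show "- (J n t \<bullet> magnetic_term (\<Phi> t) (snd (X n t))) = F n t"
          unfolding F_def lorentz_force_def J_def \<Phi>\<Psi>[OF t, symmetric]
          by (rule lorentz_pairing[OF continuous_slice_measurable[OF \<Phi> t0] \<Phi>B[OF t0], symmetric])
      qed
    qed
    have xc: "continuous_on {0..T} (\<lambda>t. \<Psi> t (x_c x0 t))"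
    proof -
      have "continuous_on {0..T} (\<lambda>t. (\<lambda>(t, x). \<Psi> t x) (t, x_c x0 t))"
        unfolding x_c_def by (rule continuous_on_compose2[OF \<Psi>]) (auto intro!: continuous_intros)
      then show ?thesis by simp
    qed
    have Gc: "continuous_on {0..T} G"
      unfolding G_def using T by (intro continuous_intros xc) auto
    define S where "S n = C0 * (B * e n) + e n * (B * ((T + 1) / (2 * T))) + \<sigma> * norm E_star * (B * e n) + exp (- real n) * B / (2 * T\<^sup>2)" for n
    have "S \<longlonglongrightarrow> C0 * (B * 0) + 0 * (B * ((T + 1) / (2 * T))) + \<sigma> * norm E_star * (B * 0) + 0 * B / (2 * T\<^sup>2)"
      unfolding S_def[abs_def] using T by (intro tendsto_intros e_lim LIMSEQ_exp_neg) auto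
    then have S: "S \<longlonglongrightarrow> 0" by simp
    have B_nn: "B \<ge> 0" by (rule order_trans[OF norm_ge_zero B[of 0 0]]) (use T in simp)
    \<comment> \<open>The spatial integrals converge uniformly in time, so their time integrals converge.\<close>
    have unif: "uniform_limit {0..T} F G sequentially"
    proof (rule uniform_limitI)
      fix \<eta> :: real assume \<eta>: "\<eta> > 0"
      \<comment> \<open>The admissible oscillation of the test field on the packet: it contributes at most \<eta> / 4 below.\<close>
      define w where "w = \<eta> * T\<^sup>2 / (T + 1) / 2"
      have w: "w > 0" using \<eta> T by (simp add: w_def)
      have "compact ({0..T} \<times> cball x0 (T + 1))" by (intro compact_Times) auto
      then have "uniformly_continuous_on ({0..T} \<times> cball x0 (T + 1)) (\<lambda>(t, x). \<Psi> t x)"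
        by (intro compact_uniformly_continuous continuous_on_subset[OF \<Psi>]) auto
      then obtain d where d: "d > 0" "\<And>z z'. z \<in> {0..T} \<times> cball x0 (T + 1) \<Longrightarrow> z' \<in> {0..T} \<times> cball x0 (T + 1) \<Longrightarrow>
          dist z' z < d \<Longrightarrow> dist ((\<lambda>(t, x). \<Psi> t x) z') ((\<lambda>(t, x). \<Psi> t x) z) < w"
        using w unfolding uniformly_continuous_on_def by metis
      have near: "norm (\<Psi> t (x_c x0 t + v) - \<Psi> t (x_c x0 t)) \<le> w" if t: "t \<in> {0..T}" and v: "norm v < min d 1" for t v
      proof -
        have n1: "norm (t *\<^sub>R e_dir) \<le> T" using t by (simp add: norm_e_dir)
        have n2: "norm (t *\<^sub>R e_dir + v) \<le> T + 1"
          using n1 norm_triangle_ineq[of "t *\<^sub>R e_dir" v] v by linarith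
        have xs: "x_c x0 t - x0 = t *\<^sub>R e_dir" "x_c x0 t + v - x0 = t *\<^sub>R e_dir + v"
          by (simp_all add: x_c_def)
        have "dist (x_c x0 t) x0 \<le> T + 1" "dist (x_c x0 t + v) x0 \<le> T + 1"
          unfolding dist_norm xs using n1 n2 by linarith+
        then have "x_c x0 t \<in> cball x0 (T + 1)" "x_c x0 t + v \<in> cball x0 (T + 1)"
          by (simp_all only: mem_cball dist_commute[of x0])
        moreover have "dist (t, x_c x0 t + v) (t, x_c x0 t) < d" using v by (simp add: dist_prod_def dist_norm)
        ultimately show ?thesis
          using d(2)[of "(t, x_c x0 t)" "(t, x_c x0 t + v)"] t by (simp add: dist_norm)
      qed
      have "\<forall>\<^sub>F n in sequentially. e n < min d 1" using d(1) by (intro order_tendstoD(2)[OF e_lim]) simp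
      moreover have "\<forall>\<^sub>F n in sequentially. S n < \<eta> / 2" using \<eta> by (intro order_tendstoD(2)[OF S]) simp
      ultimately show "\<forall>\<^sub>F n in sequentially. \<forall>t\<in>{0..T}. dist (F n t) (G t) < \<eta>"
      proof eventually_elim
        case (elim n)
        show ?case
        proof
          fix t assume t: "t \<in> {0..T}"
          then have t0: "t \<ge> 0" by simp
          define P where "P = \<Psi> t (x_c x0 t) $ 1"
          define V where "V = (\<sigma> * exp (- \<sigma> * t)) *\<^sub>R E_star"
          have V: "\<sigma> *\<^sub>R fst (ohmic_state \<sigma> E_star t) = abs_l2 (\<lambda>_. V)"
            unfolding ohm V_def background_def abs_l2_scaleR[OF sqE] by (simp add: abs_l2_scaleR[OF square_integrable_scaleR[OF sqE]])
          have nV: "norm V \<le> \<sigma> * norm E_star"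
            unfolding V_def using \<sigma> t0 by (simp add: mult_left_le_one_le)
          have close: "\<bar>\<Psi> t x $ 1 - P\<bar> \<le> w" if "\<beta> n t x \<noteq> 0" for x
          proof -
            have "norm (wrap (x - x_c x0 t)) < min d 1" using cert(6)[OF t that] elim(1) by linarith
            then have "norm (\<Psi> t x - \<Psi> t (x_c x0 t)) \<le> w"
              using near[OF t, of "wrap (x - x_c x0 t)"] periodic_wrap[of "\<Psi> t" "x_c x0 t" x] per t by simp
            then show ?thesis
              using component_le_norm_cart[of "\<Psi> t x - \<Psi> t (x_c x0 t)" 1] by (simp add: P_def)
          qed
          have z: "norm (snd (X n t) - bb n t) \<le> e n"
          proof -
            have "norm (snd Z) \<le> norm Z" for Z :: state
              using norm_snd_le[where x="fst Z" and y="snd Z"] by simp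
            from order_trans[OF this cert(2)[OF t, of n]] show ?thesis by (simp add: ohmic_state_def)
          qed
          have \<psi>c: "continuous_on UNIV (\<Psi> t)"
          proof -
            have "continuous_on UNIV (\<lambda>x. (\<lambda>(t, x). \<Psi> t x) (t, x))"
              by (rule continuous_on_compose2[OF \<Psi>]) (use t in \<open>auto intro!: continuous_intros\<close>)
            then show ?thesis by simp
          qed
          have est: "\<bar>F n t - c n t * (a n t)\<^sup>2 * P\<bar>
            \<le> norm (J n t) * (B * e n) + e n * (B * a n t) + norm V * (B * e n) + \<bar>c n t\<bar> * (w * (a n t)\<^sup>2)"
            unfolding F_def lorentz_force_def J_def[symmetric]
            by (rule lorentz_estimate[OF \<psi>c B[OF t] cert(4)[OF t] _ a0(1)[OF t] cert(7)[OF t] z[unfolded bb_def] _ close])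
              (use cert(3)[OF t, of n] cert(5)[OF t, of n] in \<open>simp_all add: V bb_def\<close>)
          also have "\<dots> \<le> C0 * (B * e n) + e n * (B * ((T + 1) / (2 * T))) + \<sigma> * norm E_star * (B * e n) + w * ((T + 1) / (2 * T\<^sup>2))"
          proof (intro add_mono)
            show "norm (J n t) * (B * e n) \<le> C0 * (B * e n)"
              using Jb[OF t] B_nn e(1)[of n] by (intro mult_right_mono) auto
            show "e n * (B * a n t) \<le> e n * (B * ((T + 1) / (2 * T)))"
              using a0(2)[OF t] B_nn e(1)[of n] by (intro mult_left_mono) auto
            show "norm V * (B * e n) \<le> \<sigma> * norm E_star * (B * e n)"
              using nV B_nn e(1)[of n] by (intro mult_right_mono) auto
            have "\<bar>c n t\<bar> * (a n t)\<^sup>2 = (t + exp (- real n)) / (2 * T\<^sup>2)"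
            proof -
              have "\<bar>c n t\<bar> * (a n t)\<^sup>2 = \<bar>c n t * (a n t)\<^sup>2\<bar>" by (simp add: abs_mult)
              then show ?thesis using ca(2)[OF t, of n] tpos[OF t, of n] by simp
            qed
            also have "\<dots> \<le> (T + 1) / (2 * T\<^sup>2)"
              using t ex(2)[of n] by (intro divide_right_mono add_mono) auto
            finally have "w * (\<bar>c n t\<bar> * (a n t)\<^sup>2) \<le> w * ((T + 1) / (2 * T\<^sup>2))" using w by (intro mult_left_mono) auto
            then show "\<bar>c n t\<bar> * (w * (a n t)\<^sup>2) \<le> w * ((T + 1) / (2 * T\<^sup>2))" by (simp add: mult_ac)
          qed
          also have "w * ((T + 1) / (2 * T\<^sup>2)) = \<eta> / 4"
          proof -
            have cancel: "\<eta> * s / r / 2 * (r / (2 * s)) = \<eta> / 4" if "r \<noteq> 0" "s \<noteq> 0" for r s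
              using that by (simp add: field_simps)
            have "T + 1 \<noteq> 0" "T\<^sup>2 \<noteq> 0" using T by auto
            from cancel[OF this] show ?thesis unfolding w_def .
          qed
          finally have 1: "\<bar>F n t - c n t * (a n t)\<^sup>2 * P\<bar>
            \<le> C0 * (B * e n) + e n * (B * ((T + 1) / (2 * T))) + \<sigma> * norm E_star * (B * e n) + \<eta> / 4" .
          have "e_dir \<bullet> \<Psi> t (x_c x0 t) = P" by (simp add: P_def e_dir_def inner_axis')
          then have "c n t * (a n t)\<^sup>2 * P - G t = - (exp (- real n) * P / (2 * T\<^sup>2))"
            unfolding ca(2)[OF t] G_def by (simp add: add_divide_distrib algebra_simps)
          then have "\<bar>c n t * (a n t)\<^sup>2 * P - G t\<bar> = exp (- real n) * \<bar>P\<bar> / (2 * T\<^sup>2)"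
            by (simp add: abs_mult)
          also have "\<dots> \<le> exp (- real n) * B / (2 * T\<^sup>2)"
          proof (intro divide_right_mono mult_left_mono)
            show "\<bar>P\<bar> \<le> B" unfolding P_def
              by (rule order_trans[OF component_le_norm_cart B[OF t]])
          qed auto
          finally have 2: "\<bar>c n t * (a n t)\<^sup>2 * P - G t\<bar> \<le> exp (- real n) * B / (2 * T\<^sup>2)" .
          have "\<bar>F n t - G t\<bar> \<le> S n + \<eta> / 4" using 1 2 unfolding S_def by linarith
          then show "dist (F n t) (G t) < \<eta>" using elim(2) \<eta> unfolding dist_real_def by linarith
        qed
      qed
    qed
    obtain I J' where I: "\<And>n. (F n has_integral I n) {0..T}" and J': "(G has_integral J') {0..T}" and lim: "I \<longlonglongrightarrow> J'"
      using uniform_limit_integral[OF unif Fc sequentially_bot] by blast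
    have "(LINT t:{0..T}|lborel. F n t) = I n" for n
      using set_borel_integral_eq_integral(2)[OF borel_integrable_atLeastAtMost'[OF Fc]] integral_unique[OF I] by simp
    moreover have "(LINT t:{0..T}|lborel. G t) = J'"
      using set_borel_integral_eq_integral(2)[OF borel_integrable_atLeastAtMost'[OF Gc]] integral_unique[OF J'] by simp
    moreover have "(LINT t:{0..T}|lborel. G t) = - (LINT t:{0..T}|lborel. t / (2 * T\<^sup>2) * (e_dir \<bullet> \<Psi> t (x_c x0 t)))"
      unfolding G_def set_lebesgue_integral_def by simp
    ultimately show ?thesis using lim unfolding F_def by simp
  qed
  show ?thesis
    using cert(1) initial final currents lorentz by (intro exI[of _ X] conjI exI[of _ "C0\<^sup>2 * T"] allI impI) auto
qed

end
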